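(* Let $(U,P_0)\in C^\infty(\mathbb R^4\setminus\{0\};\mathbb R^4\times\mathbb R)$ solve the stationary Navier--Stokes equations $$-\Delta U+(U\cdot\nabla)U+\nabla P_0=0,\qquad\operatorname{div}U=0\qquad\text{in }\mathbb R^4\setminus\{0\}.$$ Assume, for the velocity alone, that $$\mathcal M_{3,4}(U)=\sup_{R>0}R^{-1}\int_{B_R}|U|^3\,dx<\infty .$$ Then $U=0$ and $P_0=c$ for a constant $c$. The canonical normalization $P^\sharp=P_0-c$ satisfies $$\sup_{R>0}R^{-1}\int_{B_R}|P^\sharp|^{3/2}\,dx<\infty$$ and is identically zero.
   Context: $B_R\subset\mathbb R^4$ is the open ball of radius $R$ centered at the origin. Functions defined on $\mathbb R^4\setminus\{0\}$ are regarded as defined almost everywhere on $\mathbb R^4$ for the purpose of integration. Canonical normalization: for $(U,P_0)$ as in the claim, the canonical pressure $P^\sharp\in L^{3/2}_{\rm loc}(\mathbb R^4)$ is the unique pressure representative of the form $P_0-c$, $c\in\mathbb R$, satisfying $\sup_{R>0}R^{-1}\int_{B_R}|P^\sharp|^{3/2}\,dx\le C\,\mathcal M_{3,4}(U)$ with a universal constant $C$; it also satisfies $-\Delta P^\sharp=\partial_i\partial_j(U_iU_j)$ and $-\Delta U+\operatorname{div}(U\otimes U)+\nabla P^\sharp=0$, $\operatorname{div}U=0$ in $\mathcal D'(\mathbb R^4)$. *)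

theory Defs
  imports "HOL-Analysis.Analysis"
begin

text \<open>
  Functions on the punctured space are total functions on \<open>real ^ 4\<close> whose value at the
  origin is irrelevant: pointwise claims are restricted to \<open>- {0}\<close>, and the origin is a null set
  for \<open>lborel\<close>.
\<close>

text \<open>For \<^term>\<open>S\<close> open, \<open>Ck_on k S f\<close> means that \<open>f\<close> is of class \<open>C^k\<close> on \<open>S\<close>.\<close>

primrec Ck_on :: "nat \<Rightarrow> 'a::real_normed_vector set \<Rightarrow> ('a \<Rightarrow> 'b::real_normed_vector) \<Rightarrow> bool" where
  "Ck_on 0 S f \<longleftrightarrow> continuous_on S f"
| "Ck_on (Suc k) S f \<longleftrightarrow>
     (\<forall>x\<in>S. f differentiable (at x)) \<and> (\<forall>v. Ck_on k S (\<lambda>x. frechet_derivative f (at x) v))"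

definition smooth_on :: "'a::real_normed_vector set \<Rightarrow> ('a \<Rightarrow> 'b::real_normed_vector) \<Rightarrow> bool" where
  "smooth_on S f \<longleftrightarrow> (\<forall>k. Ck_on k S f)"

definition pderiv_at :: "'n::finite \<Rightarrow> (real ^ 'n \<Rightarrow> 'b::real_normed_vector) \<Rightarrow> real ^ 'n \<Rightarrow> 'b" where
  "pderiv_at i f x = frechet_derivative f (at x) (axis i 1)"

definition laplacian :: "(real ^ 'n::finite \<Rightarrow> 'b::real_normed_vector) \<Rightarrow> real ^ 'n \<Rightarrow> 'b" where
  "laplacian f x = (\<Sum>i\<in>UNIV. pderiv_at i (pderiv_at i f) x)"

definition gradient :: "(real ^ 'n::finite \<Rightarrow> real) \<Rightarrow> real ^ 'n \<Rightarrow> real ^ 'n" where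
  "gradient p x = (\<chi> i. pderiv_at i p x)"

definition divergence :: "(real ^ 'n::finite \<Rightarrow> real ^ 'n) \<Rightarrow> real ^ 'n \<Rightarrow> real" where
  "divergence U x = (\<Sum>i\<in>UNIV. pderiv_at i U x $ i)"

definition convection :: "(real ^ 'n::finite \<Rightarrow> real ^ 'n) \<Rightarrow> real ^ 'n \<Rightarrow> real ^ 'n" where
  "convection U x = (\<Sum>j\<in>UNIV. (U x $ j) *\<^sub>R pderiv_at j U x)"

definition stationary_NS_on ::
    "(real ^ 'n::finite) set \<Rightarrow> (real ^ 'n \<Rightarrow> real ^ 'n) \<Rightarrow> (real ^ 'n \<Rightarrow> real) \<Rightarrow> bool" where
  "stationary_NS_on S U P \<longleftrightarrow>
     (\<forall>x\<in>S. - laplacian U x + convection U x + gradient P x = 0 \<and> divergence U x = 0)"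

text \<open>The supremum over \<open>R > 0\<close> of \<open>1/R\<close> times the integral of \<open>g \<ge> 0\<close> over the ball \<open>B_R\<close>,
  possibly infinite.\<close>

definition sup_ball_mean :: "(real ^ 4 \<Rightarrow> real) \<Rightarrow> ennreal" where
  "sup_ball_mean g =
     (SUP R\<in>{0<..}. ennreal (1 / R) * (\<integral>\<^sup>+x\<in>ball 0 R. ennreal (g x) \<partial>lborel))"

definition M34 :: "(real ^ 4 \<Rightarrow> real ^ 4) \<Rightarrow> ennreal" where
  "M34 U = sup_ball_mean (\<lambda>x. norm (U x) ^ 3)"

definition pressure_growth :: "(real ^ 4 \<Rightarrow> real) \<Rightarrow> ennreal" where
  "pressure_growth P = sup_ball_mean (\<lambda>x. \<bar>P x\<bar> powr (3 / 2))"

definition Lp_loc :: "real \<Rightarrow> ('a::euclidean_space \<Rightarrow> 'b::euclidean_space) \<Rightarrow> bool" where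
  "Lp_loc p f \<longleftrightarrow> f \<in> borel_measurable lborel \<and>
     (\<forall>K. compact K \<longrightarrow> set_integrable lborel K (\<lambda>x. norm (f x) powr p))"

text \<open>The pressure normalization with constant \<open>C\<close>. The distributional equations are consequences
  and not part of the definition.\<close>

definition canonical_pressure ::
    "real \<Rightarrow> (real ^ 4 \<Rightarrow> real ^ 4) \<Rightarrow> (real ^ 4 \<Rightarrow> real) \<Rightarrow> (real ^ 4 \<Rightarrow> real) \<Rightarrow> bool" where
  "canonical_pressure C U P0 P \<longleftrightarrow>
     (\<exists>c. \<forall>x\<in>- {0}. P x = P0 x - c) \<and> Lp_loc (3 / 2) P \<and>
     pressure_growth P \<le> ennreal C * M34 U"

definition test_function :: "('a::euclidean_space \<Rightarrow> real) \<Rightarrow> bool" where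
  "test_function \<phi> \<longleftrightarrow> smooth_on UNIV \<phi> \<and> compact (closure {x. \<phi> x \<noteq> 0})"

text \<open>The equations \<open>-\<Delta>P = \<partial>_i\<partial>_j(U_i U_j)\<close>, \<open>-\<Delta>U + div(U \<otimes> U) + \<nabla>P = 0\<close> and \<open>div U = 0\<close> on the
  whole space in the sense of distributions, tested componentwise; the local integrability
  conditions make every pairing an honest integral.\<close>

definition distributional_NS ::
    "(real ^ 'n::finite \<Rightarrow> real ^ 'n) \<Rightarrow> (real ^ 'n \<Rightarrow> real) \<Rightarrow> bool" where
  "distributional_NS U P \<longleftrightarrow>
     Lp_loc 2 U \<and> Lp_loc 1 P \<and>
     (\<forall>\<phi>. test_function \<phi> \<longrightarrow>
        - (\<integral>x. P x * laplacian \<phi> x \<partial>lborel) =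
          (\<Sum>i\<in>UNIV. \<Sum>j\<in>UNIV.
             \<integral>x. U x $ i * U x $ j * pderiv_at i (pderiv_at j \<phi>) x \<partial>lborel) \<and>
        (\<forall>i. - (\<integral>x. U x $ i * laplacian \<phi> x \<partial>lborel)
              - (\<Sum>j\<in>UNIV. \<integral>x. U x $ i * U x $ j * pderiv_at j \<phi> x \<partial>lborel)
              - (\<integral>x. P x * pderiv_at i \<phi> x \<partial>lborel) = 0) \<and>
        - (\<Sum>j\<in>UNIV. \<integral>x. U x $ j * pderiv_at j \<phi> x \<partial>lborel) = 0)"

end

theory Submission
  imports Defs
begin

text \<open>
  Let \<open>E\<close> be the Dirichlet energy of \<open>U\<close> and \<open>n\<close> its \<open>L^3\<close> norm, on an annulus of unit size.
  Testing with \<open>\<phi> U\<close>, \<open>\<phi>\<close> radial, all terms are of size \<open>n^2 + n^3\<close> except \<open>\<integral> P g\<close> with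
  \<open>g = U \<cdot> \<nabla>\<phi>\<close>. For that one compare \<open>P\<close> with its mollification \<open>P_s\<close>. Since \<open>div U = 0\<close> and the
  mollifier is radial, \<open>\<partial>_s P_s\<close> is \<open>1/s\<close> times an average of \<open>U \<otimes> U\<close> over a ball of radius \<open>s\<close> against a
  kernel of mean zero. For \<open>s\<close> bounded below this is controlled by \<open>n\<close> alone; for small \<open>s\<close> the mean
  value property, \<open>\<nabla>U \<in> L^2\<close> and a weak-type Sobolev estimate gain a power of \<open>s\<close> at the cost of one
  factor \<open>E\<close>. Hence \<open>\<bar>\<integral> P g\<bar> \<le> \<epsilon> E + C(\<epsilon>, n)\<close>, without Calderon-Zygmund theory; the smooth remainder
  \<open>P_s\<close> has bounded oscillation on the annulus and \<open>\<integral> g = 0\<close>.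

  Absorbing \<open>\<epsilon> E\<close> over nested annuli and rescaling bounds the energy of every dyadic annulus, so a
  cutoff that changes only near radii \<open>\<epsilon>\<close> and \<open>R\<close> gives \<open>\<nabla>U \<in> L^2\<close> and, by Hardy's inequality,
  \<open>U/\<bar>x\<bar> \<in> L^2\<close>. The tails of these integrals tend to zero at both ends, which forces the rescaled
  \<open>n\<close>, hence both boundary terms, to tend to zero. Therefore \<open>U = 0\<close>, \<open>\<nabla>P = 0\<close>, and \<open>P\<close> is constant.
\<close>

section \<open>Integration on Euclidean space\<close>

text \<open>The obstacle is the pressure: nothing is assumed on its size, and a possible singularity
  at the origin rules out a global representation by \<open>U\<close>. Locally the equations fix
  \<open>P\<close> only up to a constant. That constant disappears when \<open>g\<close> has
  integral zero, which is automatic for a cutoff compactly supported off the origin. For a cutoff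
  changing at one end only, it says that the flux of \<open>U\<close> through a shell vanishes; this
  flux is the same at all radii and, by scaling, at most a constant times \<epsilon>^2 at radius
  \<epsilon>, so it is zero. In the weak-type estimate a level \<mu> is paired with a radius r by
  \<mu>^3 r^4 = const n^3. Raising \<mu> to 16 \<mu> divides r by 8, and the layers \<mu> r^2 then
  decay like 16^k / 64^k. With r = \<sigma>^3 the level is a multiple of n / \<sigma>^4, and the
  mollification scale \<sigma>^5 makes both \<mu> \<sigma>^5 and \<mu> r^2 at most a multiple of n
  \<sigma>. In dimension four the energy, the Hardy integral and the boundary terms are invariant
  under rescaling. All constants are therefore the same on every annulus, and smallness can come
  only from tails of convergent integrals.\<close>

lemma set_integrable_compact:
  fixes f :: "'a::euclidean_space \<Rightarrow> real"
  assumes "compact K" "continuous_on K f"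
  shows "set_integrable lborel K f"
  unfolding set_integrable_def using borel_integrable_compact[OF assms] .

lemma Fubini_compact:
  fixes f :: "'a::euclidean_space \<Rightarrow> 'b::euclidean_space \<Rightarrow> real"
  assumes K: "compact K" and L: "compact L" and f: "continuous_on (K \<times> L) (\<lambda>(x, y). f x y)"
  shows "(LINT x:K|lborel. LINT y:L|lborel. f x y) = (LINT y:L|lborel. LINT x:K|lborel. f x y)"
    and "set_integrable lborel K (\<lambda>x. LINT y:L|lborel. f x y)"
    and "set_integrable lborel L (\<lambda>y. LINT x:K|lborel. f x y)"
proof -
  let ?F = "\<lambda>x y. indicator K x *\<^sub>R (indicator L y *\<^sub>R f x y)"
  have "integrable (lborel \<Otimes>\<^sub>M lborel) (\<lambda>p. indicator (K \<times> L) p *\<^sub>R (case p of (x, y) \<Rightarrow> f x y))"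
    unfolding lborel_prod using borel_integrable_compact[OF compact_Times[OF K L] f] .
  also have "(\<lambda>p. indicator (K \<times> L) p *\<^sub>R (case p of (x, y) \<Rightarrow> f x y)) = (\<lambda>(x, y). ?F x y)"
    by (auto simp: fun_eq_iff indicator_def)
  finally have int: "integrable (lborel \<Otimes>\<^sub>M lborel) (\<lambda>(x, y). ?F x y)" .
  have 1: "(LINT y|lborel. ?F x y) = indicator K x *\<^sub>R (LINT y:L|lborel. f x y)" for x
    by (simp add: set_lebesgue_integral_def)
  have 2: "(LINT x|lborel. ?F x y) = indicator L y *\<^sub>R (LINT x:K|lborel. f x y)" for y
  proof -
    have "(LINT x|lborel. ?F x y) = (LINT x|lborel. indicator L y *\<^sub>R (indicator K x *\<^sub>R f x y))"
      by (simp add: ac_simps)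
    then show ?thesis by (simp add: set_lebesgue_integral_def)
  qed
  show "(LINT x:K|lborel. LINT y:L|lborel. f x y) = (LINT y:L|lborel. LINT x:K|lborel. f x y)"
    using lborel_pair.Fubini_integral[OF int] unfolding 1 2
    by (simp add: set_lebesgue_integral_def)
  show "set_integrable lborel K (\<lambda>x. LINT y:L|lborel. f x y)"
    using lborel_pair.integrable_fst[OF int] unfolding 1 by (simp add: set_integrable_def)
  show "set_integrable lborel L (\<lambda>y. LINT x:K|lborel. f x y)"
    using lborel_pair.integrable_snd[OF int] unfolding 2 by (simp add: set_integrable_def)
qed

section \<open>Translations, the fundamental theorem on segments, and integration by parts\<close>

lemma lborel_integral_translate:
  fixes f :: "'a::euclidean_space \<Rightarrow> real"
  shows "(LINT x|lborel. f (x + v)) = (LINT x|lborel. f x)"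
proof (cases "f \<in> borel_measurable borel")
  case True
  have "(LINT x|lborel. f x) = (LINT x|distr lborel borel ((+) v). f x)"
    by (simp add: lborel_distr_plus)
  also have "\<dots> = (LINT x|lborel. f (v + x))"
    using True by (intro integral_distr) auto
  finally show ?thesis by (simp add: add.commute)
next
  \<comment> \<open>A nonmeasurable function has nonmeasurable translates, so both integrals take
    the default value 0 and no hypothesis on \<open>f\<close> is required.\<close>
  case False
  have "(\<lambda>x. f (x + v)) \<notin> borel_measurable borel"
  proof
    assume "(\<lambda>x. f (x + v)) \<in> borel_measurable borel"
    from measurable_compose[OF _ this, of "\<lambda>x. x - v" borel]
    have "(\<lambda>x. f ((x - v) + v)) \<in> borel_measurable borel"
      by simp
    with False show False by simp
  qed
  from this False have "\<not> integrable lborel (\<lambda>x. f (x + v))" "\<not> integrable lborel f" by auto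
  then show ?thesis by (simp add: not_integrable_integral_eq)
qed

lemma integrable_lborel_translate:
  fixes f :: "'a::euclidean_space \<Rightarrow> real"
  assumes "integrable lborel f"
  shows "integrable lborel (\<lambda>x. f (x + v))"
proof -
  have "integrable (distr lborel borel ((+) v)) f"
    using assms by (simp add: lborel_distr_plus)
  from integrable_distr[OF _ this] have "integrable lborel (\<lambda>x. f (v + x))"
    by simp
  then show ?thesis by (simp add: add.commute)
qed

lemma integral_segment:
  fixes f :: "'a::euclidean_space \<Rightarrow> real"
  assumes d: "\<And>t. t \<in> {0..1} \<Longrightarrow> GDERIV f (x + t *\<^sub>R v) :> df (x + t *\<^sub>R v)"
    and c: "continuous_on {0..1} (\<lambda>t. df (x + t *\<^sub>R v))"
  shows "(LINT t:{0..1}|lborel. df (x + t *\<^sub>R v) \<bullet> v) = f (x + v) - f x"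
proof -
  have "((\<lambda>t. f (x + t *\<^sub>R v)) has_vector_derivative (df (x + t *\<^sub>R v) \<bullet> v)) (at t within {0..1})"
    if t: "t \<in> {0..1}" for t
  proof -
    have 1: "((\<lambda>t. x + t *\<^sub>R v) has_derivative (\<lambda>h. h *\<^sub>R v)) (at t within {0..1})"
      by (auto intro!: derivative_eq_intros)
    have "(f has_derivative (\<lambda>h. h \<bullet> df (x + t *\<^sub>R v))) (at (x + t *\<^sub>R v))"
      using d[OF t] by (simp add: gderiv_def)
    from has_derivative_compose[OF 1 this]
    show ?thesis
      by (simp add: has_vector_derivative_def inner_commute)
  qed
  from integral_FTC_atLeastAtMost[OF _ this] c
  show ?thesis
    by (simp add: set_lebesgue_integral_def continuous_intros)
qed

text \<open>Compute the integral of \<open>f (x + v) - f x\<close> in two ways. It is zero by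
  translation invariance, and by the fundamental theorem and Fubini it is the average over t of the
  integrals of \<open>df (x + t *\<^sub>R v) \<bullet> v\<close>, each of which is the desired
  integral. No slicing by coordinates is involved.\<close>

lemma integral_gderiv_zero_UNIV:
  fixes f :: "'a::euclidean_space \<Rightarrow> real"
  assumes d: "\<And>x. GDERIV f x :> df x" and c: "continuous_on UNIV df" and K: "compact K"
    and z: "\<And>x. x \<notin> K \<Longrightarrow> f x = 0" "\<And>x. x \<notin> K \<Longrightarrow> df x = 0"
  shows "(LINT x|lborel. df x \<bullet> v) = 0"
proof -
  obtain r where r: "K \<subseteq> cball 0 r"
    using compact_imp_bounded[OF K] by (auto simp: bounded_iff subset_iff)
  \<comment> \<open>Large enough that no segment from \<open>x\<close> to \<open>x + v\<close> with
    \<open>x\<close> outside \<open>L\<close> meets \<open>K\<close>; Fubini can then be applied on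
    a compact product.\<close>
  define L where "L = cball (0::'a) (r + norm v)"
  have out: "x + t *\<^sub>R v \<notin> K" if "x \<notin> L" "t \<in> {0..1}" for x t
  proof
    assume "x + t *\<^sub>R v \<in> K"
    then have "norm (x + t *\<^sub>R v) \<le> r" using r by auto
    moreover have "norm x \<le> norm (x + t *\<^sub>R v) + norm (t *\<^sub>R v)"
      using norm_triangle_ineq4[of "x + t *\<^sub>R v" "t *\<^sub>R v"] by simp
    moreover have "norm (t *\<^sub>R v) \<le> norm v" using that(2) by (simp add: mult_left_le_one_le)
    ultimately show False using that(1) by (simp add: L_def)
  qed
  have cf: "continuous_on UNIV f"
    using d by (auto simp: continuous_on_eq_continuous_at gderiv_def intro: has_derivative_continuous)
  have fint: "integrable lborel f"
  proof -
    have "set_integrable lborel K f"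
      by (rule set_integrable_compact[OF K]) (use cf continuous_on_subset in blast)
    moreover have "(\<lambda>x. indicator K x *\<^sub>R f x) = f" using z by (auto simp: indicator_def fun_eq_iff)
    ultimately show ?thesis by (simp add: set_integrable_def)
  qed
  have L: "compact L" by (simp add: L_def)
  have cc: "continuous_on (L \<times> {0..1}) (\<lambda>(x, t). df (x + t *\<^sub>R v) \<bullet> v)"
    unfolding case_prod_beta by (intro continuous_intros continuous_on_compose2[OF c]) auto
  have 1: "(LINT x:L|lborel. df (x + t *\<^sub>R v) \<bullet> v) = (LINT x|lborel. df x \<bullet> v)" if "t \<in> {0..1}" for t
  proof -
    have "(LINT x:L|lborel. df (x + t *\<^sub>R v) \<bullet> v) = (LINT x|lborel. df (x + t *\<^sub>R v) \<bullet> v)"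
      unfolding set_lebesgue_integral_def
      by (rule Bochner_Integration.integral_cong) (use out z that in \<open>auto simp: indicator_def\<close>)
    then show ?thesis by (simp add: lborel_integral_translate[of "\<lambda>x. df x \<bullet> v"])
  qed
  have 2: "(LINT t:{0..1}|lborel. df (x + t *\<^sub>R v) \<bullet> v) = f (x + v) - f x" for x
    by (intro integral_segment d continuous_on_compose2[OF c] continuous_intros) auto
  have "(LINT x|lborel. df x \<bullet> v) = (LINT t:{0..1::real}|lborel. (LINT x|lborel. df x \<bullet> v))"
    by (simp add: set_lebesgue_integral_def)
  also have "\<dots> = (LINT t:{0..1}|lborel. LINT x:L|lborel. df (x + t *\<^sub>R v) \<bullet> v)"
    by (intro set_lebesgue_integral_cong) (auto simp: 1)
  also have "\<dots> = (LINT x:L|lborel. f (x + v) - f x)"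
    using Fubini_compact(1)[OF L _ cc] by (simp add: 2)
  also have "\<dots> = (LINT x|lborel. f (x + v) - f x)"
    unfolding set_lebesgue_integral_def
    by (rule Bochner_Integration.integral_cong)
      (use out[of _ 0] out[of _ 1] z in \<open>auto simp: indicator_def\<close>)
  also have "\<dots> = 0"
    using fint integrable_lborel_translate[OF fint, of v] lborel_integral_translate[of f v] by simp
  finally show ?thesis .
qed

text \<open>Extension by zero reduces this to the whole space. The extension is of class C^1 because
  \<open>f\<close> vanishes on the open set \<open>S - K\<close>, hence so does its gradient
  there.\<close>

lemma integral_gderiv_zero:
  fixes f :: "'a::euclidean_space \<Rightarrow> real"
  assumes K: "compact K" and S: "open S" "K \<subseteq> S"
    and d: "\<And>x. x \<in> S \<Longrightarrow> GDERIV f x :> df x" and c: "continuous_on S df"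
    and z: "\<And>x. x \<in> S - K \<Longrightarrow> f x = 0"
  shows "(LINT x:K|lborel. df x \<bullet> v) = 0"
proof -
  define g where "g x = (if x \<in> K then f x else 0)" for x
  define dg where "dg x = (if x \<in> K then df x else 0)" for x
  have oK: "open (- K)" using K by (simp add: compact_imp_closed open_Compl)
  have dz: "df x = 0" if "x \<in> S - K" for x
  proof -
    have o: "open (S - K)" using S oK by (simp add: Diff_eq open_Int)
    have "(f has_derivative (\<lambda>h. h \<bullet> df x)) (at x)" using d that by (auto simp: gderiv_def)
    moreover have "(f has_derivative (\<lambda>h. 0)) (at x)"
      using has_derivative_transform_within_open[OF has_derivative_const o that, of 0 f UNIV] z by auto
    ultimately have "(\<lambda>h. h \<bullet> df x) = (\<lambda>h. 0)" by (rule has_derivative_unique)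
    from fun_cong[OF this, of "df x"] show ?thesis by simp
  qed
  have "GDERIV g x :> dg x" for x
  proof (cases "x \<in> S")
    case True
    have "dg x = df x" using dz True by (auto simp: dg_def)
    moreover have "(g has_derivative (\<lambda>h. h \<bullet> df x)) (at x)"
      using d[OF True] unfolding gderiv_def
      by (rule has_derivative_transform_within_open[OF _ S(1) True]) (use z in \<open>auto simp: g_def\<close>)
    ultimately show ?thesis by (simp add: gderiv_def)
  next
    case False
    then have x: "x \<in> - K" using S by auto
    have "(g has_derivative (\<lambda>h. 0)) (at x)"
      by (rule has_derivative_transform_within_open[OF has_derivative_const oK x]) (auto simp: g_def)
    then show ?thesis using x by (simp add: gderiv_def dg_def)
  qed
  moreover have "continuous_on UNIV dg"
  proof -
    have "continuous_on S dg"
      using c by (rule continuous_on_eq) (use dz in \<open>auto simp: dg_def\<close>)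
    moreover have "continuous_on (- K) dg"
      by (rule continuous_on_eq[of _ "\<lambda>_. 0"]) (auto simp: dg_def)
    ultimately have "continuous_on (S \<union> - K) dg" using S oK by (intro continuous_on_open_Un)
    moreover have "S \<union> - K = UNIV" using S by auto
    ultimately show ?thesis by simp
  qed
  ultimately have "(LINT x|lborel. dg x \<bullet> v) = 0"
    using K by (rule integral_gderiv_zero_UNIV) (auto simp: g_def dg_def)
  moreover have "(LINT x|lborel. dg x \<bullet> v) = (LINT x:K|lborel. df x \<bullet> v)"
    unfolding set_lebesgue_integral_def
    by (rule Bochner_Integration.integral_cong) (auto simp: dg_def indicator_def)
  ultimately show ?thesis by simp
qed

lemma set_integral_translate_le:
  fixes f :: "'a::euclidean_space \<Rightarrow> real"
  assumes D: "D \<in> sets borel" and L: "set_integrable lborel L f"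
    and sub: "\<And>x. x \<in> D \<Longrightarrow> x + v \<in> L" and nn: "\<And>x. x \<in> L \<Longrightarrow> 0 \<le> f x"
  shows "(LINT x:D|lborel. f (x + v)) \<le> (LINT x:L|lborel. f x)"
    and "set_integrable lborel D (\<lambda>x. f (x + v))"
proof -
  let ?g = "\<lambda>x. indicator L x *\<^sub>R f x"
  have g: "integrable lborel ?g" using L by (simp add: set_integrable_def)
  have gt: "integrable lborel (\<lambda>x. ?g (x + v))" by (rule integrable_lborel_translate[OF g])
  have eq: "indicator D x *\<^sub>R f (x + v) = indicator D x *\<^sub>R ?g (x + v)" for x
    using sub by (auto simp: indicator_def)
  show "set_integrable lborel D (\<lambda>x. f (x + v))"
    unfolding set_integrable_def eq using D by (intro integrable_mult_indicator gt) auto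
  then have "(LINT x:D|lborel. f (x + v)) \<le> (LINT x|lborel. ?g (x + v))"
    unfolding set_lebesgue_integral_def using gt
    by (intro integral_mono) (use sub nn in \<open>auto simp: set_integrable_def indicator_def\<close>)
  then show "(LINT x:D|lborel. f (x + v)) \<le> (LINT x:L|lborel. f x)"
    by (simp only: lborel_integral_translate[of ?g] set_lebesgue_integral_def)
qed

lemma set_integral_mono_set:
  fixes f :: "'a::euclidean_space \<Rightarrow> real"
  assumes "set_integrable lborel L f" "D \<in> sets borel" "D \<subseteq> L" "\<And>x. x \<in> L \<Longrightarrow> 0 \<le> f x"
  shows "(LINT x:D|lborel. f x) \<le> (LINT x:L|lborel. f x)"
  using set_integral_translate_le(1)[of D L f 0] assms by auto

lemma set_integral_sum:
  fixes f :: "'i \<Rightarrow> 'a::euclidean_space \<Rightarrow> real"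
  assumes "\<And>i. i \<in> I \<Longrightarrow> set_integrable lborel A (f i)"
  shows "(LINT x:A|lborel. \<Sum>i\<in>I. f i x) = (\<Sum>i\<in>I. LINT x:A|lborel. f i x)"
  using assms unfolding set_integrable_def set_lebesgue_integral_def
  by (simp add: scaleR_sum_right del: real_scaleR_def)

text \<open>Truncated powers replace smooth cutoffs in the whole proof: the positive part to the
  power n + 2 is of class C^(n + 1), and its derivatives are explicit, so that every constant can be
  computed.\<close>

lemma DERIV_pos_power:
  fixes s :: real
  shows "DERIV (\<lambda>s. (max 0 s) ^ (n + 2)) s :> real (n + 2) * (max 0 s) ^ (n + 1)"
proof (cases s "0::real" rule: linorder_cases)
  case less
  have "((\<lambda>s::real. 0) has_field_derivative 0) (at s)" by simp
  then have "((\<lambda>s::real. (max 0 s) ^ (n + 2)) has_field_derivative 0) (at s)"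
    by (rule DERIV_cong_ev[THEN iffD1, rotated -1, OF _ refl _ refl])
      (use less in \<open>auto intro!: eventually_nhds[THEN iffD2] exI[of _ "{..<0}"]\<close>)
  then show ?thesis using less by simp
next
  case greater
  have "((\<lambda>s::real. s ^ (n + 2)) has_field_derivative (real (n + 2) * s ^ (n + 1))) (at s)"
    using DERIV_pow[of "n + 2" s] by simp
  then have "((\<lambda>s::real. (max 0 s) ^ (n + 2)) has_field_derivative (real (n + 2) * s ^ (n + 1))) (at s)"
    by (rule DERIV_cong_ev[THEN iffD1, rotated -1, OF _ refl _ refl])
      (use greater in \<open>auto intro!: eventually_nhds[THEN iffD2] exI[of _ "{0<..}"]\<close>)
  then show ?thesis using greater by simp
next
  case equal
  \<comment> \<open>At the kink the difference quotient is exactly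
    \<open>(max 0 h) ^ (n + 1)\<close>.\<close>
  have "((\<lambda>h::real. (max 0 h) ^ (n + 1)) \<longlongrightarrow> (max 0 0) ^ (n + 1)) (at 0)"
    by (intro tendsto_intros)
  also have "?this \<longleftrightarrow> ((\<lambda>h::real. ((max 0 (0 + h)) ^ (n + 2) - (max 0 0) ^ (n + 2)) / h) \<longlongrightarrow> (max 0 0) ^ (n + 1)) (at 0)"
    by (rule LIM_equal) (auto simp: max_def field_simps)
  finally show ?thesis using equal by (simp add: DERIV_def)
qed

section \<open>An explicit mollifier\<close>

text \<open>The mollifier will be \<open>bump z ^ 3\<close>, a C^2 function supported in the unit
  ball; two derivatives are what the viscous term asks for.\<close>

definition bump :: "'a::real_inner \<Rightarrow> real" where
  "bump z = max 0 (1 - z \<bullet> z)"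

lemma bump_nonneg: "0 \<le> bump z" and bump_le_1: "bump z \<le> 1"
  by (auto simp: bump_def)

lemma bump_eq_0: "z \<notin> cball 0 1 \<Longrightarrow> bump z = 0"
  by (simp add: bump_def dot_square_norm abs_square_le_1 flip: abs_le_square_iff)

lemma continuous_on_bump [continuous_intros]: "continuous_on S bump"
  unfolding bump_def[abs_def] by (intro continuous_intros)

lemma GDERIV_inner_self: "GDERIV (\<lambda>z. z \<bullet> z) z :> 2 *\<^sub>R z"
  unfolding gderiv_def by (auto intro!: derivative_eq_intros simp: inner_commute algebra_simps)

lemma GDERIV_bump_power:
  "GDERIV (\<lambda>z. bump z ^ (n + 2)) z :> (- 2 * real (n + 2) * bump z ^ (n + 1)) *\<^sub>R z"
proof -
  have "GDERIV (\<lambda>z. 1 - z \<bullet> z) z :> 0 - 2 *\<^sub>R z"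
    by (intro GDERIV_diff GDERIV_const GDERIV_inner_self)
  from GDERIV_DERIV_compose[OF this DERIV_pos_power[of n]]
  show ?thesis unfolding bump_def by (rule GDERIV_subst) (simp add: algebra_simps)
qed

lemma GDERIV_component: "GDERIV (\<lambda>z. z $ i) z :> axis i 1"
  unfolding gderiv_def
  by (simp add: inner_axis bounded_linear_imp_has_derivative bounded_linear_vec_nth)

lemma continuous_on_shift:
  fixes f :: "'a::real_normed_vector \<Rightarrow> 'b::topological_space"
  assumes "continuous_on (- {0}) f" "0 \<le> s" "s < norm x"
  shows "continuous_on (cball 0 1) (\<lambda>z. f (x - s *\<^sub>R z))"
proof (rule continuous_on_compose2[OF assms(1)])
  show "(\<lambda>z. x - s *\<^sub>R z) ` cball 0 1 \<subseteq> - {0}"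
  proof safe
    fix z :: 'a assume z: "z \<in> cball 0 1" "x - s *\<^sub>R z = 0"
    then have "norm x \<le> s * 1" using assms(2) by (simp add: mult_left_le)
    then show False using assms(3) by simp
  qed
qed (intro continuous_intros)

text \<open>The product of \<eta> and \<open>f (x - s *\<^sub>R z)\<close> vanishes outside the unit
  ball, so its z-derivative integrates to zero. The chain rule contributes the factor -s, whence 1 /
  s for each derivative moved to the mollifier. The condition \<open>s < norm x\<close> keeps the
  points \<open>x - s *\<^sub>R z\<close> off the origin.\<close>

lemma convolution_by_parts:
  fixes f \<eta> :: "'a::euclidean_space \<Rightarrow> real"
  assumes \<eta>: "\<And>z. GDERIV \<eta> z :> d\<eta> z" "continuous_on UNIV d\<eta>" "\<And>z. z \<notin> cball 0 1 \<Longrightarrow> \<eta> z = 0"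
    and f: "\<And>x. x \<noteq> 0 \<Longrightarrow> GDERIV f x :> df x" "continuous_on (- {0}) df"
    and s: "0 < s" "s < norm x"
  shows "(LINT z:cball 0 1|lborel. \<eta> z * (df (x - s *\<^sub>R z) \<bullet> v)) =
         (1 / s) * (LINT z:cball 0 1|lborel. (d\<eta> z \<bullet> v) * f (x - s *\<^sub>R z))"
proof -
  let ?S = "{z. x - s *\<^sub>R z \<noteq> 0}"
  let ?g = "\<lambda>z. \<eta> z * f (x - s *\<^sub>R z)"
  let ?dg = "\<lambda>z. \<eta> z *\<^sub>R (- s *\<^sub>R df (x - s *\<^sub>R z)) + f (x - s *\<^sub>R z) *\<^sub>R d\<eta> z"
  have cf: "continuous_on (- {0}) f"
    using f by (auto simp: continuous_on_eq_continuous_at gderiv_def open_Compl intro: has_derivative_continuous)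
  have c\<eta>: "continuous_on UNIV \<eta>"
    using \<eta> by (auto simp: continuous_on_eq_continuous_at gderiv_def intro: has_derivative_continuous)
  have S: "open ?S" by (intro open_Collect_neq continuous_intros)
  have sub: "cball 0 1 \<subseteq> ?S"
  proof safe
    fix z :: 'a assume z: "z \<in> cball 0 1" "x - s *\<^sub>R z = 0"
    then have "norm x \<le> s * 1" using s by (simp add: mult_left_le)
    then show False using s by simp
  qed
  have d: "GDERIV ?g z :> ?dg z" if z: "z \<in> ?S" for z
  proof (rule GDERIV_mult[OF \<eta>(1)])
    have 1: "((\<lambda>z. x - s *\<^sub>R z) has_derivative (\<lambda>h. - s *\<^sub>R h)) (at z)"
      by (auto intro!: derivative_eq_intros)
    have "(f has_derivative (\<lambda>h. h \<bullet> df (x - s *\<^sub>R z))) (at (x - s *\<^sub>R z))"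
      using f z by (simp add: gderiv_def)
    from has_derivative_compose[OF 1 this]
    show "GDERIV (\<lambda>z. f (x - s *\<^sub>R z)) z :> - s *\<^sub>R df (x - s *\<^sub>R z)"
      by (simp add: gderiv_def)
  qed
  have c: "continuous_on ?S ?dg"
    by (intro continuous_intros continuous_on_compose2[OF f(2)] continuous_on_compose2[OF cf]
        continuous_on_compose2[OF c\<eta>] continuous_on_compose2[OF \<eta>(2)]) auto
  have z0: "?g z = 0" if "z \<in> ?S - cball 0 1" for z
    using \<eta>(3) that by auto
  have 0: "(LINT z:cball 0 1|lborel. ?dg z \<bullet> v) = 0"
    using integral_gderiv_zero[OF compact_cball S sub d c z0] .
  have c1: "continuous_on (cball 0 1) (\<lambda>z. df (x - s *\<^sub>R z))" "continuous_on (cball 0 1) (\<lambda>z. f (x - s *\<^sub>R z))"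
    using s by (auto intro!: continuous_on_shift f cf)
  have i1: "set_integrable lborel (cball 0 1) (\<lambda>z. \<eta> z * (df (x - s *\<^sub>R z) \<bullet> v))"
    and i2: "set_integrable lborel (cball 0 1) (\<lambda>z. (d\<eta> z \<bullet> v) * f (x - s *\<^sub>R z))"
    by (intro set_integrable_compact compact_cball continuous_intros c1
        continuous_on_compose2[OF c\<eta>] continuous_on_compose2[OF \<eta>(2)]; auto)+
  have "(LINT z:cball 0 1|lborel. ?dg z \<bullet> v) =
     (LINT z:cball 0 1|lborel. (d\<eta> z \<bullet> v) * f (x - s *\<^sub>R z) - s * (\<eta> z * (df (x - s *\<^sub>R z) \<bullet> v)))"
    by (intro set_lebesgue_integral_cong) (auto simp: inner_add_left algebra_simps)
  also have "\<dots> = (LINT z:cball 0 1|lborel. (d\<eta> z \<bullet> v) * f (x - s *\<^sub>R z))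
      - s * (LINT z:cball 0 1|lborel. \<eta> z * (df (x - s *\<^sub>R z) \<bullet> v))"
    using i1 i2 by (subst set_integral_diff(2)) auto
  finally show ?thesis using 0 s by (simp add: field_simps)
qed

section \<open>Solutions on the punctured space\<close>

text \<open>\<open>A i\<close> is the gradient of \<open>U $ i\<close>, \<open>B i j\<close> that of \<open>A i $ j\<close>, and \<open>G\<close> that of \<open>P\<close>.\<close>

locale NS4 =
  fixes U :: "real ^ 4 \<Rightarrow> real ^ 4" and A :: "4 \<Rightarrow> real ^ 4 \<Rightarrow> real ^ 4"
    and B :: "4 \<Rightarrow> 4 \<Rightarrow> real ^ 4 \<Rightarrow> real ^ 4" and P :: "real ^ 4 \<Rightarrow> real" and G :: "real ^ 4 \<Rightarrow> real ^ 4"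
    and M :: real
  assumes dU: "\<And>i x. x \<noteq> 0 \<Longrightarrow> GDERIV (\<lambda>x. U x $ i) x :> A i x"
    and dA: "\<And>i j x. x \<noteq> 0 \<Longrightarrow> GDERIV (\<lambda>x. A i x $ j) x :> B i j x"
    and dP: "\<And>x. x \<noteq> 0 \<Longrightarrow> GDERIV P x :> G x"
    and cB: "\<And>i j. continuous_on (- {0}) (B i j)"
    and cG: "continuous_on (- {0}) G"
    and momentum: "\<And>i x. x \<noteq> 0 \<Longrightarrow> G x $ i = (\<Sum>j\<in>UNIV. B i j x $ j) - (\<Sum>j\<in>UNIV. U x $ j * A i x $ j)"
    and incompressible: "\<And>x. x \<noteq> 0 \<Longrightarrow> (\<Sum>i\<in>UNIV. A i x $ i) = 0"
    and morrey: "\<And>R. 0 < R \<Longrightarrow> (\<integral>\<^sup>+x\<in>ball 0 R. ennreal (norm (U x) ^ 3) \<partial>lborel) \<le> ennreal (M * R)"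
    and M_nonneg: "0 \<le> M"
begin

lemma cU: "continuous_on (- {0}) U"
proof -
  have "continuous_on (- {0}) (\<lambda>x. U x $ i)" for i
    by (intro continuous_at_imp_continuous_on ballI has_derivative_continuous[OF dU[unfolded gderiv_def]]) auto
  then have "continuous_on (- {0}) (\<lambda>x. \<chi> i. U x $ i)" by (intro continuous_on_vec_lambda)
  then show ?thesis by simp
qed

lemma cA: "continuous_on (- {0}) (A i)"
proof -
  have "continuous_on (- {0}) (\<lambda>x. A i x $ j)" for j
    by (intro continuous_at_imp_continuous_on ballI has_derivative_continuous[OF dA[unfolded gderiv_def]]) auto
  then have "continuous_on (- {0}) (\<lambda>x. \<chi> j. A i x $ j)" by (intro continuous_on_vec_lambda)
  then show ?thesis by simp
qed

lemma cP: "continuous_on (- {0}) P"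
  by (intro continuous_at_imp_continuous_on ballI has_derivative_continuous[OF dP[unfolded gderiv_def]]) auto

end

text \<open>The field \<open>bump z ^ 3 *\<^sub>R z\<close> is the gradient of \<open>- bump z ^ 4 / 8\<close>; \<open>hess_row i\<close> is a row of the
  Hessian of that potential, \<open>hess_trace\<close> its Laplacian, and \<open>quad_kernel z\<close> the Hessian as a
  quadratic form.\<close>

definition quad_kernel :: "real ^ 4 \<Rightarrow> real ^ 4 \<Rightarrow> real" where
  "quad_kernel z v = bump z ^ 3 * (v \<bullet> v) - 6 * bump z ^ 2 * (z \<bullet> v)\<^sup>2"

definition hess_row :: "4 \<Rightarrow> real ^ 4 \<Rightarrow> real ^ 4" where
  "hess_row i z = (bump z ^ 3) *\<^sub>R axis i 1 + (- 6 * bump z ^ 2 * z $ i) *\<^sub>R z"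

definition hess_row_grad :: "4 \<Rightarrow> 4 \<Rightarrow> real ^ 4 \<Rightarrow> real ^ 4" where
  "hess_row_grad i j z = (if i = j then (- 6 * bump z ^ 2) *\<^sub>R z else 0)
     + ((24 * bump z * z $ i * z $ j) *\<^sub>R z - (6 * bump z ^ 2) *\<^sub>R (z $ i *\<^sub>R axis j 1 + z $ j *\<^sub>R axis i 1))"

lemma GDERIV_bump3: "GDERIV (\<lambda>z. bump z ^ 3) z :> (- 6 * bump z ^ 2) *\<^sub>R z"
  using GDERIV_bump_power[of 1 z] by (simp add: numeral_eq_Suc)

lemma GDERIV_bump2: "GDERIV (\<lambda>z. bump z ^ 2) z :> (- 4 * bump z) *\<^sub>R z"
  using GDERIV_bump_power[of 0 z] by (simp add: numeral_eq_Suc)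

lemma GDERIV_cmult: "GDERIV f x :> D \<Longrightarrow> GDERIV (\<lambda>x. c * f x) x :> c *\<^sub>R D"
  using GDERIV_mult[OF GDERIV_const[of c x]] by simp

lemma GDERIV_bump3_component: "GDERIV (\<lambda>z. bump z ^ 3 * z $ i) z :> hess_row i z"
  by (rule GDERIV_subst[OF GDERIV_mult[OF GDERIV_bump3 GDERIV_component]])
    (simp add: hess_row_def algebra_simps)

lemma hess_row_component: "hess_row i z $ j = (if i = j then bump z ^ 3 else 0) - 6 * (bump z ^ 2 * (z $ i * z $ j))"
  by (simp add: hess_row_def axis_def)

lemma GDERIV_hess_row: "GDERIV (\<lambda>z. hess_row i z $ j) z :> hess_row_grad i j z"
proof -
  have 1: "GDERIV (\<lambda>z. bump z ^ 2 * (z $ i * z $ j)) z :>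
     (bump z ^ 2) *\<^sub>R (z $ i *\<^sub>R axis j 1 + z $ j *\<^sub>R axis i 1) + (z $ i * z $ j) *\<^sub>R ((- 4 * bump z) *\<^sub>R z)"
    by (intro GDERIV_mult GDERIV_bump2 GDERIV_component)
  have 2: "GDERIV (\<lambda>z. if i = j then bump z ^ 3 else 0) z :> (if i = j then (- 6 * bump z ^ 2) *\<^sub>R z else 0)"
    using GDERIV_bump3 GDERIV_const[of 0 z] by auto
  show ?thesis unfolding hess_row_component
    by (rule GDERIV_subst[OF GDERIV_diff[OF 2 GDERIV_cmult[OF 1]]])
      (simp add: hess_row_grad_def algebra_simps)
qed

definition hess_trace :: "real ^ 4 \<Rightarrow> real" where
  "hess_trace z = 4 * bump z ^ 3 - 6 * (bump z ^ 2 * (z \<bullet> z))"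

lemma GDERIV_hess_trace: "GDERIV hess_trace z :> (24 * bump z * (z \<bullet> z) - 36 * bump z ^ 2) *\<^sub>R z"
  unfolding hess_trace_def[abs_def]
  by (rule GDERIV_subst[OF GDERIV_diff[OF GDERIV_cmult[OF GDERIV_bump3] GDERIV_cmult[OF GDERIV_mult[OF GDERIV_bump2 GDERIV_inner_self]]]])
    (simp add: vec_eq_iff algebra_simps)

text \<open>The divergence of a Hessian row is a derivative of the Laplacian: the right side is
  component i of the gradient in \<open>GDERIV_hess_trace\<close>. This symmetry lets the viscous
  term be rewritten with div U.\<close>

lemma sum_hess_row_grad: "(\<Sum>j\<in>UNIV. hess_row_grad i j z $ j) = (24 * bump z * (z \<bullet> z) - 36 * bump z ^ 2) * z $ i"
proof -
  have "(\<Sum>j\<in>UNIV. hess_row_grad i j z $ j) =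
    (\<Sum>j\<in>UNIV. (if i = j then - 12 * bump z ^ 2 * z $ i else 0)) + (\<Sum>j\<in>UNIV. 24 * bump z * z $ i * (z $ j * z $ j))
      - (\<Sum>j\<in>(UNIV::4 set). 6 * bump z ^ 2 * z $ i)"
    unfolding sum.distrib[symmetric] sum_subtractf[symmetric]
    by (intro sum.cong) (auto simp: hess_row_grad_def axis_def algebra_simps)
  also have "(\<Sum>j\<in>UNIV. 24 * bump z * z $ i * (z $ j * z $ j)) = 24 * bump z * z $ i * (z \<bullet> z)"
    by (simp add: inner_vec_def sum_distrib_left)
  finally show ?thesis by (simp add: algebra_simps)
qed

lemma sum_hess_row: "(\<Sum>i\<in>UNIV. \<Sum>j\<in>UNIV. hess_row i z $ j * (v $ j * v $ i)) = quad_kernel z v"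
proof -
    have "(\<Sum>i\<in>UNIV. \<Sum>j\<in>UNIV. hess_row i z $ j * (v $ j * v $ i)) =
       (\<Sum>i\<in>UNIV. \<Sum>j\<in>UNIV. (if i = j then bump z ^ 3 * (v $ i * v $ i) else 0)) -
       6 * bump z ^ 2 * (\<Sum>i\<in>UNIV. \<Sum>j\<in>UNIV. (z $ i * v $ i) * (z $ j * v $ j))"
      unfolding sum_distrib_left sum_subtractf[symmetric]
      by (intro sum.cong) (auto simp: hess_row_component algebra_simps)
    also have "(\<Sum>i\<in>UNIV. \<Sum>j\<in>UNIV. (z $ i * v $ i) * (z $ j * v $ j)) = (z \<bullet> v)\<^sup>2"
      by (simp add: inner_vec_def power2_eq_square sum_product)
    also have "(\<Sum>i\<in>UNIV. \<Sum>j\<in>UNIV. (if i = j then bump z ^ 3 * (v $ i * v $ i) else 0)) = bump z ^ 3 * (v \<bullet> v)"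
      by (simp add: inner_vec_def sum_distrib_left)
    finally show ?thesis
      by (simp add: quad_kernel_def)
qed

lemma continuous_on_hess_row: "continuous_on S (hess_row i)" "continuous_on S (hess_row_grad i j)"
  unfolding hess_row_def[abs_def] hess_row_grad_def[abs_def]
  by (cases "i = j"; auto intro!: continuous_intros)+

context NS4
begin

definition stress_grad :: "4 \<Rightarrow> 4 \<Rightarrow> real ^ 4 \<Rightarrow> real ^ 4" where
  "stress_grad i j x = U x $ j *\<^sub>R A i x + U x $ i *\<^sub>R A j x"

lemma GDERIV_stress: "x \<noteq> 0 \<Longrightarrow> GDERIV (\<lambda>x. U x $ j * U x $ i) x :> stress_grad i j x"
  unfolding stress_grad_def by (intro GDERIV_mult dU)

lemma continuous_on_stress_grad: "continuous_on (- {0}) (stress_grad i j)"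
  unfolding stress_grad_def[abs_def] by (intro continuous_intros cU cA)

text \<open>The second half of \<open>stress_grad\<close> contributes \<open>U x $ i\<close> times
  div U, so the convection term is a divergence.\<close>

lemma sum_stress_grad:
  "x \<noteq> 0 \<Longrightarrow> (\<Sum>j\<in>UNIV. stress_grad i j x $ j) = (\<Sum>j\<in>UNIV. U x $ j * A i x $ j)"
  using incompressible[of x] by (simp add: stress_grad_def sum.distrib flip: sum_distrib_left)

text \<open>The viscous term disappears after two integrations by parts because the mollifier is radial and
  \<open>div U = 0\<close>.\<close>

lemma pressure_average:
  assumes s: "0 < s" "s < norm x"
  shows "(LINT z:cball 0 1|lborel. bump z ^ 3 * (z \<bullet> G (x - s *\<^sub>R z))) =
      - (1 / s) * (LINT z:cball 0 1|lborel. quad_kernel z (U (x - s *\<^sub>R z)))"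
proof -
  let ?I = "\<lambda>f::real^4\<Rightarrow>real. LINT z:cball 0 1|lborel. f z"
  let ?y = "\<lambda>z. x - s *\<^sub>R z"
  have s0: "0 \<le> s" using s by simp
  have nz: "?y z \<noteq> 0" if "z \<in> cball 0 1" for z
  proof
    assume "?y z = 0"
    then have "norm x \<le> s * 1" using s that by (simp add: mult_left_le)
    then show False using s by simp
  qed
  note sh = continuous_on_shift[OF _ s0 s(2)]
  have b0: "bump z ^ 3 * z $ i = 0" "hess_row i z $ j = 0" "hess_trace z = 0" if "z \<notin> cball 0 1" for z i j
    using bump_eq_0[OF that] by (auto simp: hess_row_component hess_trace_def)
  have ck: "continuous_on UNIV (\<lambda>z::real^4. (24 * bump z * (z \<bullet> z) - 36 * bump z ^ 2) *\<^sub>R z)"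
    by (intro continuous_intros)
  have eB: "?I (\<lambda>z. (bump z ^ 3 * z $ i) * B i j (?y z) $ j) = (1 / s) * ?I (\<lambda>z. hess_row i z $ j * A i (?y z) $ j)" for i j
    using convolution_by_parts[OF GDERIV_bump3_component continuous_on_hess_row(1) b0(1) dA cB s, where v = "axis j 1"]
    by (simp add: inner_axis)
  have eA: "?I (\<lambda>z. hess_row i z $ j * A i (?y z) $ j) = (1 / s) * ?I (\<lambda>z. hess_row_grad i j z $ j * U (?y z) $ i)" for i j
    using convolution_by_parts[OF GDERIV_hess_row continuous_on_hess_row(2) b0(2) dU cA s, where v = "axis j 1"]
    by (simp add: inner_axis)
  have eK: "?I (\<lambda>z. hess_trace z * A i (?y z) $ i) = (1 / s) * ?I (\<lambda>z. (24 * bump z * (z \<bullet> z) - 36 * bump z ^ 2) * z $ i * U (?y z) $ i)" for i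
    using convolution_by_parts[OF GDERIV_hess_trace ck b0(3) dU cA s, where v = "axis i 1"]
    by (simp add: inner_axis)
  have eF: "?I (\<lambda>z. (bump z ^ 3 * z $ i) * stress_grad i j (?y z) $ j) = (1 / s) * ?I (\<lambda>z. hess_row i z $ j * (U (?y z) $ j * U (?y z) $ i))" for i j
    using convolution_by_parts[OF GDERIV_bump3_component continuous_on_hess_row(1) b0(1) GDERIV_stress continuous_on_stress_grad s, where v = "axis j 1"]
    by (simp add: inner_axis)
  note int = set_integrable_compact[OF compact_cball]
  have cUy: "continuous_on (cball 0 1) (\<lambda>z. U (?y z))" and cAy: "\<And>i. continuous_on (cball 0 1) (\<lambda>z. A i (?y z))"
    and cBy: "\<And>i j. continuous_on (cball 0 1) (\<lambda>z. B i j (?y z))"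
    and cFy: "\<And>i j. continuous_on (cball 0 1) (\<lambda>z. stress_grad i j (?y z))"
    by (intro sh cU cA cB continuous_on_stress_grad)+
  note ci = continuous_intros cUy cAy cBy cFy continuous_on_hess_row
  have ckap: "continuous_on (cball 0 1) hess_trace" unfolding hess_trace_def[abs_def] by (intro continuous_intros)
  \<comment> \<open>Two derivatives go from \<open>U $ i\<close> to the mollifier; then
    \<open>sum_hess_row_grad\<close> allows one to be moved back, leaving \<open>hess_trace\<close>
    against the i-th derivative of \<open>U $ i\<close>. The sum over i is div U.\<close>
  have lin: "(\<Sum>i\<in>UNIV. \<Sum>j\<in>UNIV. ?I (\<lambda>z. (bump z ^ 3 * z $ i) * B i j (?y z) $ j)) = 0"
  proof -
    have "(\<Sum>j\<in>UNIV. ?I (\<lambda>z. (bump z ^ 3 * z $ i) * B i j (?y z) $ j)) = (1 / s) * ?I (\<lambda>z. hess_trace z * A i (?y z) $ i)" for i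
    proof -
      have "(\<Sum>j\<in>UNIV. ?I (\<lambda>z. (bump z ^ 3 * z $ i) * B i j (?y z) $ j)) =
         (1 / s) * ((1 / s) * (\<Sum>j\<in>UNIV. ?I (\<lambda>z. hess_row_grad i j z $ j * U (?y z) $ i)))"
        unfolding eB eA by (simp add: sum_distrib_left)
      also have "(\<Sum>j\<in>UNIV. ?I (\<lambda>z. hess_row_grad i j z $ j * U (?y z) $ i)) = ?I (\<lambda>z. \<Sum>j\<in>UNIV. hess_row_grad i j z $ j * U (?y z) $ i)"
        by (intro set_integral_sum[symmetric] int ci)
      also have "(\<lambda>z. \<Sum>j\<in>UNIV. hess_row_grad i j z $ j * U (?y z) $ i) = (\<lambda>z. (24 * bump z * (z \<bullet> z) - 36 * bump z ^ 2) * z $ i * U (?y z) $ i)"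
        by (simp add: fun_eq_iff sum_hess_row_grad flip: sum_distrib_right)
      finally show ?thesis by (simp only: eK)
    qed
    then have "(\<Sum>i\<in>UNIV. \<Sum>j\<in>UNIV. ?I (\<lambda>z. (bump z ^ 3 * z $ i) * B i j (?y z) $ j)) =
        (1 / s) * (\<Sum>i\<in>UNIV. ?I (\<lambda>z. hess_trace z * A i (?y z) $ i))"
      by (simp add: sum_distrib_left)
    also have "(\<Sum>i\<in>UNIV. ?I (\<lambda>z. hess_trace z * A i (?y z) $ i)) = ?I (\<lambda>z. \<Sum>i\<in>UNIV. hess_trace z * A i (?y z) $ i)"
      by (intro set_integral_sum[symmetric] int ci ckap)
    also have "\<dots> = ?I (\<lambda>z. 0)"
      by (intro set_lebesgue_integral_cong) (auto simp: incompressible[OF nz] simp flip: sum_distrib_left)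
    finally show ?thesis by simp
  qed
  \<comment> \<open>Momentum replaces \<open>G\<close> by viscous minus convective terms. Only the
    latter survive, and a single integration by parts there gives the single factor 1 / s.\<close>
  have "?I (\<lambda>z. bump z ^ 3 * (z \<bullet> G (?y z))) =
     ?I (\<lambda>z. \<Sum>i\<in>UNIV. \<Sum>j\<in>UNIV. (bump z ^ 3 * z $ i) * B i j (?y z) $ j - (bump z ^ 3 * z $ i) * stress_grad i j (?y z) $ j)"
  proof (intro set_lebesgue_integral_cong allI impI)
    fix z :: "real^4" assume z: "z \<in> cball 0 1"
    have "bump z ^ 3 * (z \<bullet> G (?y z)) = (\<Sum>i\<in>UNIV. (bump z ^ 3 * z $ i) * G (?y z) $ i)"
      by (simp add: inner_vec_def sum_distrib_left mult.assoc)
    also have "\<dots> = (\<Sum>i\<in>UNIV. (bump z ^ 3 * z $ i) * ((\<Sum>j\<in>UNIV. B i j (?y z) $ j) - (\<Sum>j\<in>UNIV. stress_grad i j (?y z) $ j)))"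
      by (simp only: momentum[OF nz[OF z]] sum_stress_grad[OF nz[OF z]])
    finally show "bump z ^ 3 * (z \<bullet> G (?y z)) =
       (\<Sum>i\<in>UNIV. \<Sum>j\<in>UNIV. (bump z ^ 3 * z $ i) * B i j (?y z) $ j - (bump z ^ 3 * z $ i) * stress_grad i j (?y z) $ j)"
      by (simp add: sum_subtractf sum_distrib_left right_diff_distrib)
  qed auto
  also have "\<dots> = (\<Sum>i\<in>UNIV. \<Sum>j\<in>UNIV. ?I (\<lambda>z. (bump z ^ 3 * z $ i) * B i j (?y z) $ j) - ?I (\<lambda>z. (bump z ^ 3 * z $ i) * stress_grad i j (?y z) $ j))"
    by (subst set_integral_sum set_integral_diff(2), (intro int ci continuous_on_sum)+)+ simp
  also have "\<dots> = - (\<Sum>i\<in>UNIV. \<Sum>j\<in>UNIV. (1 / s) * ?I (\<lambda>z. hess_row i z $ j * (U (?y z) $ j * U (?y z) $ i)))"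
    using lin by (simp add: sum_subtractf eF)
  also have "\<dots> = - (1 / s) * ?I (\<lambda>z. \<Sum>i\<in>UNIV. \<Sum>j\<in>UNIV. hess_row i z $ j * (U (?y z) $ j * U (?y z) $ i))"
    by (subst set_integral_sum, (intro int ci continuous_on_sum)+)+ (simp add: sum_distrib_left sum_negf)
  also have "(\<lambda>z. \<Sum>i\<in>UNIV. \<Sum>j\<in>UNIV. hess_row i z $ j * (U (?y z) $ j * U (?y z) $ i)) = (\<lambda>z. quad_kernel z (U (?y z)))"
    by (simp add: sum_hess_row)
  finally show ?thesis .
qed

end

section \<open>Estimates at unit scale\<close>

lemma nn_integral_lborel_affine:
  fixes t :: "'a::euclidean_space"
  assumes [measurable]: "f \<in> borel_measurable borel" and c: "c \<noteq> 0"
  shows "(\<integral>\<^sup>+x. f x \<partial>lborel) = ennreal (\<bar>c\<bar> ^ DIM('a)) * (\<integral>\<^sup>+x. f (t + c *\<^sub>R x) \<partial>lborel)"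
  by (subst lborel_affine[OF c, of t])
     (simp add: nn_integral_density nn_integral_distr nn_integral_cmult ennreal_power)

lemma lborel_integrable_affine:
  fixes f :: "'a::euclidean_space \<Rightarrow> real"
  assumes f: "integrable lborel f" and c: "c \<noteq> 0"
  shows "integrable lborel (\<lambda>x. f (t + c *\<^sub>R x))"
  using f f[THEN borel_measurable_integrable] unfolding integrable_iff_bounded
  by (subst (asm) nn_integral_lborel_affine[OF _ c, of _ t]) (auto simp: ennreal_mult_less_top c)

lemma lborel_integral_affine:
  fixes f :: "'a::euclidean_space \<Rightarrow> real"
  assumes f: "integrable lborel f" and c: "c \<noteq> 0"
  shows "(LINT x|lborel. f x) = \<bar>c\<bar> ^ DIM('a) * (LINT x|lborel. f (t + c *\<^sub>R x))"
proof -
  have m: "lborel = density (distr lborel borel (\<lambda>x. t + c *\<^sub>R x)) (\<lambda>_. ennreal (\<bar>c\<bar> ^ DIM('a)))"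
    using lborel_affine[OF c, of t] by (simp add: ennreal_power)
  show ?thesis
    using c f[THEN borel_measurable_integrable] lborel_integrable_affine[OF f c, of t]
    by (subst m) (simp add: integral_density integral_distr)
qed

lemma set_integral_affine_le:
  fixes f :: "'a::euclidean_space \<Rightarrow> real"
  assumes L: "set_integrable lborel L f" and D: "D \<in> sets borel" and c: "c \<noteq> 0"
    and sub: "\<And>x. x \<in> D \<Longrightarrow> t + c *\<^sub>R x \<in> L" and nn: "\<And>x. x \<in> L \<Longrightarrow> 0 \<le> f x"
  shows "(LINT x:D|lborel. f (t + c *\<^sub>R x)) \<le> (LINT x:L|lborel. f x) / \<bar>c\<bar> ^ DIM('a)"
proof -
  let ?g = "\<lambda>x. indicator L x *\<^sub>R f x"
  have g: "integrable lborel ?g" using L by (simp add: set_integrable_def)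
  have gt: "integrable lborel (\<lambda>x. ?g (t + c *\<^sub>R x))" by (rule lborel_integrable_affine[OF g c])
  have eq: "indicator D x *\<^sub>R f (t + c *\<^sub>R x) = indicator D x *\<^sub>R ?g (t + c *\<^sub>R x)" for x
    using sub by (auto simp: indicator_def)
  have "integrable lborel (\<lambda>x. indicator D x *\<^sub>R f (t + c *\<^sub>R x))"
    unfolding eq using D by (intro integrable_mult_indicator gt) auto
  then have "(LINT x:D|lborel. f (t + c *\<^sub>R x)) \<le> (LINT x|lborel. ?g (t + c *\<^sub>R x))"
    unfolding set_lebesgue_integral_def using gt
    by (intro integral_mono) (use sub nn in \<open>auto simp: indicator_def\<close>)
  also have "\<dots> = (LINT x:L|lborel. f x) / \<bar>c\<bar> ^ DIM('a)"
    using lborel_integral_affine[OF g c, of t] c unfolding set_lebesgue_integral_def by simp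
  finally show ?thesis .
qed

text \<open>Cauchy-Schwarz on the unit interval, read off from the nonnegativity of the variance of
  \<open>f\<close>.\<close>

lemma integral_power2_le:
  fixes f :: "real \<Rightarrow> real"
  assumes "continuous_on {0..1} f"
  shows "(LINT t:{0..1}|lborel. f t)\<^sup>2 \<le> (LINT t:{0..1}|lborel. (f t)\<^sup>2)"
proof -
  define c where "c = (LINT t:{0..1}|lborel. f t)"
  have i: "set_integrable lborel {0..1} f" "set_integrable lborel {0..1} (\<lambda>t. (f t)\<^sup>2)"
    "set_integrable lborel {0..1::real} (\<lambda>t. c\<^sup>2)" "set_integrable lborel {0..1} (\<lambda>t. 2 * c * f t)"
    by (auto intro!: set_integrable_compact compact_Icc continuous_intros assms)
  have "0 \<le> (LINT t:{0..1}|lborel. (f t - c)\<^sup>2)"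
    by (simp add: set_lebesgue_integral_def)
  also have "\<dots> = (LINT t:{0..1}|lborel. ((f t)\<^sup>2 - 2 * c * f t) + c\<^sup>2)"
    by (simp add: power2_diff algebra_simps)
  also have "\<dots> = (LINT t:{0..1}|lborel. (f t)\<^sup>2) - (LINT t:{0..1}|lborel. 2 * c * f t) + (LINT t:{0..1::real}|lborel. c\<^sup>2)"
    by (simp only: set_integral_add(2)[OF set_integral_diff(1)[OF i(2,4)] i(3)] set_integral_diff(2)[OF i(2,4)])
  also have "(LINT t:{0..1}|lborel. 2 * c * f t) = 2 * c * c"
    by (simp add: c_def)
  also have "(LINT t:{0..1::real}|lborel. c\<^sup>2) = c\<^sup>2"
    by (simp add: set_lebesgue_integral_def)
  finally show ?thesis by (simp add: c_def[symmetric] power2_eq_square)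
qed

section \<open>Annuli, and bounds for the kernel\<close>

definition ann :: "real \<Rightarrow> real \<Rightarrow> (real ^ 4) set" where
  "ann a b = {x. a \<le> norm x \<and> norm x \<le> b}"

lemma compact_ann [simp]: "compact (ann a b)"
proof -
  have "ann a b = cball 0 b \<inter> {x. a \<le> norm x}" by (auto simp: ann_def)
  moreover have "closed {x::real^4. a \<le> norm x}" by (intro closed_Collect_le continuous_intros)
  ultimately show ?thesis by (metis compact_Int_closed compact_cball)
qed

lemma sets_ann [simp, measurable]: "ann a b \<in> sets borel"
  using compact_imp_closed[OF compact_ann] by (rule borel_closed)

lemma ann_shift: "x \<in> ann a b \<Longrightarrow> norm h \<le> r \<Longrightarrow> x + h \<in> ann (a - r) (b + r)"
  using norm_triangle_ineq[of x h] norm_triangle_ineq2[of x "- h"] by (auto simp: ann_def)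

lemma ann_nonzero: "0 < a \<Longrightarrow> ann a b \<subseteq> - {0}"
  by (auto simp: ann_def)

lemma ann_mono: "a' \<le> a \<Longrightarrow> b \<le> b' \<Longrightarrow> ann a b \<subseteq> ann a' b'"
  by (auto simp: ann_def)

text \<open>Annuli of positive inner radius are compact and avoid the origin, so continuity off the
  origin is all that integrability over them requires.\<close>

lemma set_integrable_ann:
  "continuous_on (- {0}) f \<Longrightarrow> 0 < a \<Longrightarrow> set_integrable lborel (ann a b) (f :: real ^ 4 \<Rightarrow> real)"
  by (intro set_integrable_compact compact_ann continuous_on_subset[OF _ ann_nonzero])

lemma borel_measurable_punctured:
  fixes f :: "'a::t1_space \<Rightarrow> 'b::topological_space"
  assumes "continuous_on (- {a}) f"
  shows "f \<in> borel_measurable borel"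
proof -
  have "(\<lambda>x. if x \<in> - {a} then f x else f a) \<in> borel_measurable borel"
    by (intro borel_measurable_continuous_on_if assms continuous_on_const) auto
  moreover have "(\<lambda>x. if x \<in> - {a} then f x else f a) = f" by auto
  ultimately show ?thesis by simp
qed

text \<open>7 = 1 + 6 adds the two coefficients of the form. The second bound is polarization: the
  difference of the values at \<open>v\<close> and \<open>w\<close> is the bilinear form at
  \<open>v - w\<close> and \<open>v + w\<close>.\<close>

lemma quad_kernel_bound:
  assumes "z \<in> cball 0 1" shows "\<bar>quad_kernel z v\<bar> \<le> 7 * (norm v)\<^sup>2"
    and "\<bar>quad_kernel z v - quad_kernel z w\<bar> \<le> 7 * (norm (v - w) * (norm v + norm w))"
proof -
  have b: "0 \<le> bump z ^ 3" "bump z ^ 3 \<le> 1" "0 \<le> bump z ^ 2" "bump z ^ 2 \<le> 1"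
    by (auto intro!: power_le_one simp: bump_nonneg bump_le_1)
  have ip: "\<bar>z \<bullet> v\<bar> \<le> norm v" for v
    using Cauchy_Schwarz_ineq2[of z v] assms mult_right_mono[of "norm z" 1 "norm v"] by auto
  have gen: "\<bar>bump z ^ 3 * p - 6 * bump z ^ 2 * q\<bar> \<le> 7 * c" if "\<bar>p\<bar> \<le> c" "\<bar>q\<bar> \<le> c" for p q c
  proof -
    have "\<bar>bump z ^ 3 * p\<bar> \<le> 1 * c" unfolding abs_mult using b that by (intro mult_mono) auto
    moreover have "\<bar>bump z ^ 2 * q\<bar> \<le> 1 * c" unfolding abs_mult using b that by (intro mult_mono) auto
    ultimately show ?thesis by (simp add: abs_le_iff)
  qed
  have 1: "\<bar>(a \<bullet> c) * (b \<bullet> d)\<bar> \<le> x * y" if "\<bar>a \<bullet> c\<bar> \<le> x" "\<bar>b \<bullet> d\<bar> \<le> y" for a b c d :: "real^4" and x y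
    unfolding abs_mult using that by (intro mult_mono) auto
  show "\<bar>quad_kernel z v\<bar> \<le> 7 * (norm v)\<^sup>2"
    unfolding quad_kernel_def using 1[OF ip ip, of v v]
    by (intro gen) (auto simp: power2_eq_square dot_square_norm)
  have e: "quad_kernel z v - quad_kernel z w = bump z ^ 3 * ((v - w) \<bullet> (v + w)) - 6 * bump z ^ 2 * ((z \<bullet> (v - w)) * (z \<bullet> (v + w)))"
    by (simp add: quad_kernel_def inner_simps power2_eq_square algebra_simps inner_commute)
  have m: "norm (v - w) * norm (v + w) \<le> norm (v - w) * (norm v + norm w)"
    by (intro mult_left_mono norm_triangle_ineq) auto
  show "\<bar>quad_kernel z v - quad_kernel z w\<bar> \<le> 7 * (norm (v - w) * (norm v + norm w))"
    unfolding e using Cauchy_Schwarz_ineq2[of "v - w" "v + w"] 1[OF ip ip, of "v - w" "v + w"] m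
    by (intro gen) auto
qed

lemma continuous_on_quad_kernel:
  assumes "continuous_on S f" "continuous_on S g"
  shows "continuous_on S (\<lambda>x. quad_kernel (f x) (g x))"
  unfolding quad_kernel_def bump_def by (intro continuous_intros assms)

text \<open>Each entry of the Hessian is a derivative of a function vanishing outside the unit ball.
  This cancellation is what makes small scales summable.\<close>

lemma integral_quad_kernel: "(LINT z:cball 0 1|lborel. quad_kernel z v) = 0"
proof -
  have 0: "(LINT z:cball 0 1|lborel. hess_row i z $ j) = 0" for i j
  proof -
    have "(LINT z:cball 0 1|lborel. hess_row i z \<bullet> axis j 1) = 0"
      by (rule integral_gderiv_zero[OF compact_cball open_UNIV _ GDERIV_bump3_component continuous_on_hess_row(1)])
        (auto simp: bump_eq_0)
    then show ?thesis by (simp add: inner_axis)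
  qed
  have c: "set_integrable lborel (cball 0 1) (\<lambda>z. hess_row i z $ j * (v $ j * v $ i))" for i j
    by (intro set_integrable_compact compact_cball continuous_intros continuous_on_hess_row)
  have c2: "set_integrable lborel (cball 0 1) (\<lambda>z. \<Sum>j\<in>UNIV. hess_row i z $ j * (v $ j * v $ i))" for i
    by (intro set_integrable_compact compact_cball continuous_intros continuous_on_hess_row)
  have "(LINT z:cball 0 1|lborel. quad_kernel z v) = (LINT z:cball 0 1|lborel. \<Sum>i\<in>UNIV. \<Sum>j\<in>UNIV. hess_row i z $ j * (v $ j * v $ i))"
    by (simp add: sum_hess_row)
  also have "\<dots> = (\<Sum>i\<in>UNIV. \<Sum>j\<in>UNIV. LINT z:cball 0 1|lborel. hess_row i z $ j * (v $ j * v $ i))"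
    by (simp only: set_integral_sum[OF c2] set_integral_sum[OF c])
  finally show ?thesis by (simp add: 0)
qed

definition vol1 :: real where "vol1 = measure lborel (cball (0::real^4) 1)"
definition vol4 :: real where "vol4 = measure lborel (cball (0::real^4) 4)"

lemma vol1_pos: "0 < vol1" and vol4_nonneg: "0 \<le> vol4"
  by (simp_all add: vol1_def vol4_def content_cball_pos)

lemma set_integral_const_vol1: "(LINT z:cball (0::real^4) 1|lborel. (c::real)) = c * vol1"
  by (simp add: set_lebesgue_integral_def vol1_def)

lemma measure_ann: "b \<le> 4 \<Longrightarrow> measure lborel (ann a b) \<le> vol4"
  unfolding vol4_def by (intro measure_mono_fmeasurable) (auto simp: ann_def fmeasurable_compact)

context NS4
begin

definition energy :: "real \<Rightarrow> real \<Rightarrow> real" where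
  "energy a b = (LINT x:ann a b|lborel. \<Sum>i\<in>UNIV. A i x \<bullet> A i x)"

text \<open>The third power of the L^3 norm. The estimates below take a number \<open>n\<close>
  whose cube dominates it, so that no cube roots occur.\<close>

definition cubic :: "real \<Rightarrow> real \<Rightarrow> real" where
  "cubic a b = (LINT x:ann a b|lborel. norm (U x) ^ 3)"

lemma continuous_on_energy_density: "continuous_on (- {0}) (\<lambda>x. \<Sum>i\<in>UNIV. A i x \<bullet> A i x)"
  by (intro continuous_intros cA)

lemma energy_density_nonneg: "0 \<le> (\<Sum>i\<in>UNIV. A i x \<bullet> A i x)"
  by (intro sum_nonneg) auto

lemma continuous_on_cube: "continuous_on (- {0}) (\<lambda>x. norm (U x) ^ 3)"
  by (intro continuous_intros cU)

lemma energy_mono: "0 < a' \<Longrightarrow> a' \<le> a \<Longrightarrow> b \<le> b' \<Longrightarrow> energy a b \<le> energy a' b'"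
  unfolding energy_def by (intro set_integral_mono_set set_integrable_ann continuous_on_energy_density ann_mono energy_density_nonneg) auto

lemma cubic_mono: "0 < a' \<Longrightarrow> a' \<le> a \<Longrightarrow> b \<le> b' \<Longrightarrow> cubic a b \<le> cubic a' b'"
  unfolding cubic_def by (intro set_integral_mono_set set_integrable_ann continuous_on_cube ann_mono) auto

lemma energy_nonneg: "0 \<le> energy a b"
  unfolding energy_def set_lebesgue_integral_def
  by (auto intro!: Bochner_Integration.integral_nonneg mult_nonneg_nonneg energy_density_nonneg)

text \<open>Integrate the gradient along the segment from \<open>x\<close> to \<open>x + h\<close>,
  apply Cauchy-Schwarz in t, and exchange the integrals. Each translate of the annulus lies in the
  one enlarged by \<open>r\<close> on both sides, which is where the larger energy comes
  from.\<close>

lemma difference_estimate: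
  assumes h: "norm h \<le> r" and a: "0 < a - r"
  shows "(LINT x:ann a b|lborel. (norm (U (x + h) - U x))\<^sup>2) \<le> r\<^sup>2 * energy (a - r) (b + r)"
proof -
  let ?e = "\<lambda>x. \<Sum>i\<in>UNIV. A i x \<bullet> A i x"
  have r0: "0 \<le> r" using h norm_ge_zero[of h] by linarith
  have nz: "x + t *\<^sub>R h \<in> ann (a - r) (b + r)" if "x \<in> ann a b" "t \<in> {0..1}" for x t
  proof (rule ann_shift[OF that(1)])
    show "norm (t *\<^sub>R h) \<le> r" using h that(2) mult_right_mono[of t 1 "norm h"] by auto
  qed
  have nz': "x + t *\<^sub>R h \<noteq> 0" if "x \<in> ann a b" "t \<in> {0..1}" for x t
    using nz[OF that] ann_nonzero[OF a] by blast
  have cc: "continuous_on (ann a b \<times> {0..1}) (\<lambda>(x, t). ?e (x + t *\<^sub>R h))"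
    unfolding case_prod_beta
  proof (rule continuous_on_compose2[OF continuous_on_energy_density])
    show "(\<lambda>p. fst p + snd p *\<^sub>R h) ` (ann a b \<times> {0..1}) \<subseteq> - {0}" using nz' by force
  qed (intro continuous_intros)
  have pt: "(norm (U (x + h) - U x))\<^sup>2 \<le> r\<^sup>2 * (LINT t:{0..1}|lborel. ?e (x + t *\<^sub>R h))" if x: "x \<in> ann a b" for x
  proof -
    have cx: "continuous_on {0..1} (\<lambda>t. A i (x + t *\<^sub>R h))" for i
    proof (rule continuous_on_compose2[OF cA])
      show "(\<lambda>t. x + t *\<^sub>R h) ` {0..1} \<subseteq> - {0}" using nz'[OF x] by force
    qed (intro continuous_intros)
    have "(norm (U (x + h) - U x))\<^sup>2 = (\<Sum>i\<in>UNIV. (U (x + h) $ i - U x $ i)\<^sup>2)"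
      unfolding dot_square_norm[symmetric] inner_vec_def by (simp add: power2_eq_square)
    also have "\<dots> = (\<Sum>i\<in>UNIV. (LINT t:{0..1}|lborel. A i (x + t *\<^sub>R h) \<bullet> h)\<^sup>2)"
    proof -
      have "(LINT t:{0..1}|lborel. A i (x + t *\<^sub>R h) \<bullet> h) = U (x + h) $ i - U x $ i" for i
        by (rule integral_segment[of "\<lambda>x. U x $ i"]) (use dU nz'[OF x] cx in auto)
      then show ?thesis by simp
    qed
    also have "\<dots> \<le> (\<Sum>i\<in>UNIV. LINT t:{0..1}|lborel. (A i (x + t *\<^sub>R h) \<bullet> h)\<^sup>2)"
      by (intro sum_mono integral_power2_le continuous_intros cx)
    also have "\<dots> = (LINT t:{0..1}|lborel. \<Sum>i\<in>UNIV. (A i (x + t *\<^sub>R h) \<bullet> h)\<^sup>2)"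
      by (intro set_integral_sum[symmetric] set_integrable_compact compact_Icc continuous_intros cx)
    also have "\<dots> \<le> (LINT t:{0..1}|lborel. r\<^sup>2 * ?e (x + t *\<^sub>R h))"
    proof (intro set_integral_mono set_integrable_compact compact_Icc continuous_intros cx)
      fix t :: real
      have "(A i (x + t *\<^sub>R h) \<bullet> h)\<^sup>2 \<le> r\<^sup>2 * (A i (x + t *\<^sub>R h) \<bullet> A i (x + t *\<^sub>R h))" for i
      proof -
        have "h \<bullet> h \<le> r\<^sup>2" using h by (simp add: dot_square_norm power_mono)
        then have "(A i (x + t *\<^sub>R h) \<bullet> A i (x + t *\<^sub>R h)) * (h \<bullet> h) \<le> (A i (x + t *\<^sub>R h) \<bullet> A i (x + t *\<^sub>R h)) * r\<^sup>2"
          by (intro mult_left_mono) auto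
        then show ?thesis using Cauchy_Schwarz_ineq[of "A i (x + t *\<^sub>R h)" h] by (simp add: mult.commute)
      qed
      then show "(\<Sum>i\<in>UNIV. (A i (x + t *\<^sub>R h) \<bullet> h)\<^sup>2) \<le> r\<^sup>2 * ?e (x + t *\<^sub>R h)"
        unfolding sum_distrib_left by (intro sum_mono)
    qed
    finally show ?thesis by simp
  qed
  have cUh: "continuous_on (ann a b) (\<lambda>x. U (x + h))"
  proof (rule continuous_on_compose2[OF cU])
    show "(\<lambda>x. x + h) ` ann a b \<subseteq> - {0}" using nz'[of _ 1] by force
  qed (intro continuous_intros)
  have cU0: "continuous_on (ann a b) U"
    using a r0 by (intro continuous_on_subset[OF cU ann_nonzero]) auto
  have "(LINT x:ann a b|lborel. (norm (U (x + h) - U x))\<^sup>2) \<le> (LINT x:ann a b|lborel. r\<^sup>2 * (LINT t:{0..1}|lborel. ?e (x + t *\<^sub>R h)))"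
    by (intro set_integral_mono pt set_integrable_compact compact_ann set_integrable_mult_right
        Fubini_compact(2)[OF _ _ cc] compact_Icc continuous_intros cUh cU0)
  also have "\<dots> = r\<^sup>2 * (LINT t:{0..1}|lborel. LINT x:ann a b|lborel. ?e (x + t *\<^sub>R h))"
    using Fubini_compact(1)[OF compact_ann compact_Icc cc] by simp
  also have "\<dots> \<le> r\<^sup>2 * (LINT t:{0..1::real}|lborel. energy (a - r) (b + r))"
  proof (intro mult_left_mono set_integral_mono Fubini_compact(3)[OF _ _ cc] compact_Icc compact_ann)
    fix t :: real assume "t \<in> {0..1}"
    then show "(LINT x:ann a b|lborel. ?e (x + t *\<^sub>R h)) \<le> energy (a - r) (b + r)"
      unfolding energy_def using nz a by (intro set_integral_translate_le(1) set_integrable_ann continuous_on_energy_density energy_density_nonneg) auto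
  qed (auto intro!: set_integrable_compact)
  finally show ?thesis by (simp add: set_lebesgue_integral_def)
qed

end

section \<open>Level sets of the velocity and a Sobolev-type bound for its cubic tail\<close>

lemma set_integral_abs_le:
  fixes f F :: "'a::euclidean_space \<Rightarrow> real"
  assumes "set_integrable lborel A f" "set_integrable lborel A F" "\<And>x. x \<in> A \<Longrightarrow> \<bar>f x\<bar> \<le> F x"
  shows "\<bar>LINT x:A|lborel. f x\<bar> \<le> (LINT x:A|lborel. F x)"
proof -
  have "(LINT x:A|lborel. f x) \<le> (LINT x:A|lborel. F x)"
    using assms by (intro set_integral_mono) (auto simp: abs_le_iff)
  moreover have "(LINT x:A|lborel. - f x) \<le> (LINT x:A|lborel. F x)"
    using assms set_integrable_mult_right[of "-1" lborel A f]
    by (intro set_integral_mono) (auto simp: abs_le_iff)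
  ultimately show ?thesis using assms(1) by (simp add: set_integral_uminus abs_le_iff)
qed

text \<open>After exchanging the integrals a bound on the x-integral that is uniform in the kernel
  variable z suffices, at the price of the volume of the unit ball.\<close>

lemma double_integral_bound:
  fixes f F :: "real ^ 4 \<Rightarrow> real ^ 4 \<Rightarrow> real"
  assumes D: "compact D" and f: "continuous_on (D \<times> cball 0 1) (\<lambda>(x, z). f x z)"
    and F: "continuous_on (D \<times> cball 0 1) (\<lambda>(x, z). F x z)"
    and le: "\<And>x z. x \<in> D \<Longrightarrow> z \<in> cball 0 1 \<Longrightarrow> \<bar>f x z\<bar> \<le> F x z"
    and c: "\<And>z. z \<in> cball 0 1 \<Longrightarrow> (LINT x:D|lborel. F x z) \<le> c"
  shows "\<bar>LINT x:D|lborel. LINT z:cball 0 1|lborel. f x z\<bar> \<le> c * vol1"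
proof -
  have cx: "continuous_on D (\<lambda>x. h x z)" if "z \<in> cball 0 1" "continuous_on (D \<times> cball 0 1) (\<lambda>(x, z). h x z)"
    for z and h :: "real ^ 4 \<Rightarrow> real ^ 4 \<Rightarrow> real"
  proof -
    have "continuous_on D (\<lambda>x. (\<lambda>(x, z). h x z) (x, z))"
    proof (rule continuous_on_compose2[OF that(2)])
      show "(\<lambda>x. (x, z)) ` D \<subseteq> D \<times> cball 0 1" using that(1) by auto
    qed (intro continuous_intros)
    then show ?thesis by simp
  qed
  have "\<bar>LINT z:cball 0 1|lborel. LINT x:D|lborel. f x z\<bar> \<le> (LINT z:cball (0::real^4) 1|lborel. c)"
  proof (rule set_integral_abs_le)
    fix z :: "real^4" assume z: "z \<in> cball 0 1"
    have "\<bar>LINT x:D|lborel. f x z\<bar> \<le> (LINT x:D|lborel. F x z)"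
      by (intro set_integral_abs_le set_integrable_compact D cx f F z le)
    with c[OF z] show "\<bar>LINT x:D|lborel. f x z\<bar> \<le> c" by simp
  qed (intro Fubini_compact(3)[OF D compact_cball f] set_integrable_compact compact_cball continuous_intros)+
  then show ?thesis
    by (simp add: Fubini_compact(1)[OF D compact_cball f] set_integral_const_vol1)
qed

text \<open>A value \<open>u\<close> above \<mu> lies in one layer between
  \<open>16 ^ k * \<mu>\<close> and \<open>16 ^ (k + 1) * \<mu>\<close>, where one factor of the
  cube is at most the upper end. This turns weak-type information on squares into a bound for
  cubes.\<close>

lemma dyadic_tail:
  fixes u \<mu> :: real
  assumes "0 \<le> u" "0 < \<mu>" "u \<le> 16 ^ m * \<mu>"
  shows "(if \<mu> < u then u ^ 3 else 0) \<le> (\<Sum>k<m. (16 * 16 ^ k * \<mu>) * (if 16 ^ k * \<mu> < u then u\<^sup>2 else 0))"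
  using assms(3)
proof (induction m)
  case 0
  then show ?case by simp
next
  case (Suc m)
  let ?t = "\<lambda>k. (16 * 16 ^ k * \<mu>) * (if 16 ^ k * \<mu> < u then u\<^sup>2 else 0)"
  have nn: "0 \<le> ?t k" for k using assms by auto
  show ?case
  proof (cases "u \<le> 16 ^ m * \<mu>")
    case True
    from Suc.IH[OF True] nn[of m] show ?thesis unfolding sum.lessThan_Suc by linarith
  next
    case False
    have "u ^ 3 = u * u\<^sup>2" by (simp add: power2_eq_square power3_eq_cube)
    also have "\<dots> \<le> (16 * 16 ^ m * \<mu>) * u\<^sup>2"
      using Suc.prems by (intro mult_right_mono) auto
    also have "\<dots> = ?t m" using False by simp
    finally have "u ^ 3 \<le> ?t m" .
    moreover have "0 \<le> ?t m" by (rule nn)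
    moreover have "0 \<le> (\<Sum>k<m. ?t k)" by (intro sum_nonneg nn)
    moreover have "(if c then x else 0) \<le> S + T" if "x \<le> T" "0 \<le> T" "0 \<le> S" for c and x S T :: real
      using that by auto
    ultimately show ?thesis unfolding sum.lessThan_Suc by blast
  qed
qed

text \<open>Chosen for the threshold hypothesis of \<open>weak_type\<close>. The maximum with 1 lets
  the cube dominate the first power.\<close>

definition level_const :: real where "level_const = max 1 (32 / vol1)"

lemma level_const: "1 \<le> level_const" "32 \<le> vol1 * level_const ^ 3"
proof -
  show 1: "1 \<le> level_const" by (simp add: level_const_def)
  have "32 / vol1 \<le> level_const" by (simp add: level_const_def)
  also have "level_const \<le> level_const ^ 3" using 1 power_increasing[of 1 3 level_const] by simp
  finally show "32 \<le> vol1 * level_const ^ 3" using vol1_pos by (simp add: field_simps)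
qed

context NS4
begin

lemma ann_shift_scaled:
  assumes "x \<in> ann a b" "z \<in> cball 0 1" "0 \<le> r"
  shows "x - r *\<^sub>R z \<in> ann (a - r) (b + r)"
  using ann_shift[OF assms(1), of "- (r *\<^sub>R z)" r] assms(2,3) by (simp add: mult_left_le)

lemma continuous_on_shift_pair:
  assumes "0 \<le> r" "0 < a - r"
  shows "continuous_on (ann a b \<times> cball 0 1) (\<lambda>p. U (fst p - r *\<^sub>R snd p))"
    and "continuous_on (ann a b \<times> cball 0 1) (\<lambda>p. U (fst p))"
proof -
  show "continuous_on (ann a b \<times> cball 0 1) (\<lambda>p. U (fst p - r *\<^sub>R snd p))"
  proof (rule continuous_on_compose2[OF cU, where f = "\<lambda>p. fst p - r *\<^sub>R snd p"])
    show "(\<lambda>p. fst p - r *\<^sub>R snd p) ` (ann a b \<times> cball 0 1) \<subseteq> - {0}"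
      using ann_shift_scaled[OF _ _ assms(1), of _ a b] ann_nonzero[OF assms(2), of "b + r"] by force
  qed (intro continuous_intros)
  show "continuous_on (ann a b \<times> cball 0 1) (\<lambda>p. U (fst p))"
    using ann_nonzero[of a b] assms
    by (intro continuous_on_compose2[OF cU continuous_on_fst[OF continuous_on_id]]) auto
qed

lemma difference_estimate':
  assumes "z \<in> cball 0 1" "0 \<le> r" "0 < a - r"
  shows "(LINT x:ann a b|lborel. (norm (U (x - r *\<^sub>R z) - U x))\<^sup>2) \<le> r\<^sup>2 * energy (a - r) (b + r)"
  using difference_estimate[of "- (r *\<^sub>R z)" r a b] assms by (simp add: mult_left_le)

lemma U_measurable [measurable]: "U \<in> borel_measurable borel"
  by (rule borel_measurable_punctured[OF cU])

lemma set_integrable_tail: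
  assumes "0 < a"
  shows "set_integrable lborel (ann a b) (\<lambda>x. if \<mu> < norm (U x) then norm (U x) ^ k else 0)"
proof (rule set_integrable_bound)
  show "set_integrable lborel (ann a b) (\<lambda>x. norm (U x) ^ k)"
    by (intro set_integrable_ann assms continuous_intros cU)
  show "set_borel_measurable lborel (ann a b) (\<lambda>x. if \<mu> < norm (U x) then norm (U x) ^ k else 0)"
    unfolding set_borel_measurable_def by measurable
qed auto

text \<open>Average \<open>\<bar>U x\<bar>^2 \<le> 2 \<bar>U (x - r z) - U x\<bar>^2 + 2 \<bar>U (x - r z)\<bar>^2\<close> over the unit ball: the last
  term is absorbed where \<open>\<bar>U x\<bar>\<close> exceeds the threshold.\<close>

lemma weak_type:
  assumes r: "0 < r" "0 < a - r" and lev: "0 < \<mu>" "32 * cubic (a - r) (b + r) \<le> vol1 * \<mu> ^ 3 * r ^ 4"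
  shows "(LINT x:ann a b|lborel. if \<mu> < norm (U x) then (norm (U x))\<^sup>2 else 0) \<le> 4 * r\<^sup>2 * energy (a - r) (b + r)"
proof -
  have r0: "0 \<le> r" and a: "0 < a" using r by auto
  let ?d = "\<lambda>x z. (norm (U (x - r *\<^sub>R z) - U x))\<^sup>2"
  have cd: "continuous_on (ann a b \<times> cball 0 1) (\<lambda>(x, z). ?d x z)"
    unfolding case_prod_beta by (intro continuous_intros continuous_on_shift_pair[OF r0 r(2)])
  have pt: "(if \<mu> < norm (U x) then (norm (U x))\<^sup>2 else 0) \<le> (4 / vol1) * (LINT z:cball 0 1|lborel. ?d x z)"
    if x: "x \<in> ann a b" for x
  proof (cases "\<mu> < norm (U x)")
    case True
    have rx: "r < norm x" using x r by (auto simp: ann_def)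
    have cs: "continuous_on (cball 0 1) (\<lambda>z. U (x - r *\<^sub>R z))"
      by (rule continuous_on_shift[OF cU r0 rx])
    let ?I = "\<lambda>f::real^4\<Rightarrow>real. LINT z:cball 0 1|lborel. f z"
    define X where "X = ?I (?d x)"
    define Y where "Y = ?I (\<lambda>z. norm (U (x - r *\<^sub>R z)) ^ 3)"
    have i: "set_integrable lborel (cball 0 1) (?d x)" "set_integrable lborel (cball 0 1) (\<lambda>z. norm (U (x - r *\<^sub>R z)) ^ 3)"
      "set_integrable lborel (cball (0::real^4) 1) (\<lambda>z. c)" for c :: real
      by (intro set_integrable_compact compact_cball continuous_intros cs)+
    have "?I (\<lambda>z. (norm (U x))\<^sup>2) \<le> ?I (\<lambda>z. (2 * ?d x z + (8 / \<mu>) * norm (U (x - r *\<^sub>R z)) ^ 3) + \<mu>\<^sup>2 / 8)"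
    proof (intro set_integral_mono set_integrable_compact compact_cball continuous_intros cs)
      fix z
      define b where "b = norm (U (x - r *\<^sub>R z))"
      define d where "d = norm (U (x - r *\<^sub>R z) - U x)"
      have b0: "0 \<le> b" "0 \<le> d" by (auto simp: b_def d_def)
      have "norm (U x) \<le> d + b"
        using norm_triangle_ineq4[of "U (x - r *\<^sub>R z)" "U (x - r *\<^sub>R z) - U x"] by (simp add: b_def d_def)
      then have "(norm (U x))\<^sup>2 \<le> (d + b)\<^sup>2" by (intro power_mono) auto
      also have "\<dots> \<le> 2 * d\<^sup>2 + 2 * b\<^sup>2" using sum_squares_bound[of d b] by (simp add: power2_sum)
      \<comment> \<open>Split at \<mu> / 4: below it the first term dominates, above it the factor 4
        b / \<mu> exceeds 1.\<close>
      also have "b\<^sup>2 \<le> \<mu>\<^sup>2 / 16 + (4 / \<mu>) * b ^ 3"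
      proof (cases "b \<le> \<mu> / 4")
        case True
        then have "b\<^sup>2 \<le> (\<mu> / 4)\<^sup>2" using b0 by (intro power_mono) auto
        moreover have "0 \<le> (4 / \<mu>) * b ^ 3" using b0 lev by simp
        ultimately show ?thesis by (simp add: power_divide)
      next
        case False
        then have "b\<^sup>2 * 1 \<le> b\<^sup>2 * ((4 / \<mu>) * b)" using lev by (intro mult_left_mono) (auto simp: field_simps)
        then show ?thesis using lev by (simp add: power2_eq_square power3_eq_cube algebra_simps add_increasing)
      qed
      finally show "(norm (U x))\<^sup>2 \<le> (2 * ?d x z + (8 / \<mu>) * norm (U (x - r *\<^sub>R z)) ^ 3) + \<mu>\<^sup>2 / 8"
        unfolding b_def d_def by (simp add: algebra_simps)
    qed
    also have "\<dots> = 2 * X + (8 / \<mu>) * Y + \<mu>\<^sup>2 / 8 * vol1"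
      using i unfolding X_def Y_def
      by (subst set_integral_add(2) set_integral_mult_right set_integral_const_vol1;
          (intro set_integral_add(1) set_integrable_mult_right i)?)+ simp
    finally have 1: "(norm (U x))\<^sup>2 * vol1 \<le> 2 * X + (8 / \<mu>) * Y + \<mu>\<^sup>2 / 8 * vol1"
      by (simp add: set_integral_const_vol1)
    \<comment> \<open>The change of variables from the unit ball to the ball of radius
      \<open>r\<close> costs \<open>r ^ 4\<close>; the threshold hypothesis then leaves at most
      \<open>vol1 * \<mu> ^ 3 / 32\<close>.\<close>
    have "Y \<le> cubic (a - r) (b + r) / r ^ 4"
    proof -
      have "(LINT z:cball 0 1|lborel. norm (U (x + (- r) *\<^sub>R z)) ^ 3) \<le> (LINT x:ann (a - r) (b + r)|lborel. norm (U x) ^ 3) / \<bar>- r\<bar> ^ DIM(real^4)"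
        by (rule set_integral_affine_le) (use ann_shift_scaled[OF x _ r0] r in \<open>auto intro!: set_integrable_ann continuous_on_cube\<close>)
      then show ?thesis using r by (simp add: Y_def cubic_def)
    qed
    also have "\<dots> \<le> vol1 * \<mu> ^ 3 / 32" using lev r by (simp add: field_simps)
    finally have "(8 / \<mu>) * Y \<le> (8 / \<mu>) * (vol1 * \<mu> ^ 3 / 32)" using lev by (intro mult_left_mono) auto
    also have "\<dots> = \<mu>\<^sup>2 / 4 * vol1" using lev by (simp add: power2_eq_square power3_eq_cube)
    finally have 2: "(8 / \<mu>) * Y \<le> \<mu>\<^sup>2 / 4 * vol1" .
    have "\<mu>\<^sup>2 \<le> (norm (U x))\<^sup>2" using True lev by (intro power_mono) auto
    then have "\<mu>\<^sup>2 * vol1 \<le> (norm (U x))\<^sup>2 * vol1" using vol1_pos by (intro mult_right_mono) auto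
    moreover have "0 \<le> X"
      unfolding X_def set_lebesgue_integral_def by (intro Bochner_Integration.integral_nonneg) auto
    \<comment> \<open>The terms in \<open>Y\<close> and \<mu> add up to at most 1/4 + 1/8 = 3/8 of
      the left side and are absorbed, which leaves room in the constant 4.\<close>
    ultimately have "(norm (U x))\<^sup>2 * vol1 \<le> 4 * X" using 1 2 by linarith
    then show ?thesis using True vol1_pos by (simp add: X_def field_simps)
  next
    case False
    have "0 \<le> (LINT z:cball 0 1|lborel. ?d x z)"
      unfolding set_lebesgue_integral_def by (intro Bochner_Integration.integral_nonneg) auto
    then show ?thesis using False vol1_pos by simp
  qed
  have "(LINT x:ann a b|lborel. if \<mu> < norm (U x) then (norm (U x))\<^sup>2 else 0)
     \<le> (LINT x:ann a b|lborel. (4 / vol1) * (LINT z:cball 0 1|lborel. ?d x z))"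
    by (intro set_integral_mono pt set_integrable_tail a set_integrable_mult_right
        Fubini_compact(2)[OF compact_ann compact_cball cd])
  also have "\<dots> = (4 / vol1) * (LINT x:ann a b|lborel. LINT z:cball 0 1|lborel. ?d x z)" by simp
  also have "(LINT x:ann a b|lborel. LINT z:cball 0 1|lborel. ?d x z) \<le> (r\<^sup>2 * energy (a - r) (b + r)) * vol1"
    using double_integral_bound[OF compact_ann cd cd, of "r\<^sup>2 * energy (a - r) (b + r)"] difference_estimate' r0 r
    by (simp add: abs_le_iff)
  finally show ?thesis using vol1_pos by (simp add: field_simps mult_left_mono)
qed

text \<open>Apply \<open>weak_type\<close> at level \<open>16 ^ k * \<mu>\<close> with radius
  \<open>\<sigma> ^ 3 / 8 ^ k\<close>. The threshold condition persists because 16^3 = 8^4. Layer k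
  contributes 64 \<mu> \<sigma>^6 / 4^k times the energy; the geometric series gives 64 * 4/3 =
  256/3, rounded up to 86, and \<mu> \<sigma>^6 is
  \<open>level_const * n * \<sigma>\<^sup>2\<close>.\<close>

lemma cube_tail:
  assumes s: "0 < \<sigma>" "\<sigma> \<le> 1" and n: "0 < n" "cubic (a - \<sigma> ^ 3) (b + \<sigma> ^ 3) \<le> n ^ 3" and a: "0 < a - \<sigma> ^ 3"
    and lev: "\<mu> = level_const * n / \<sigma> ^ 4"
  shows "(LINT x:ann a b|lborel. if \<mu> < norm (U x) then norm (U x) ^ 3 else 0)
     \<le> 86 * level_const * n * \<sigma>\<^sup>2 * energy (a - \<sigma> ^ 3) (b + \<sigma> ^ 3)"
proof -
  have s3: "0 < \<sigma> ^ 3" using s by simp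
  have a0: "0 < a" using a s3 by linarith
  have l0: "0 < \<mu>" using lev level_const n s by simp
  let ?energy = "energy (a - \<sigma> ^ 3) (b + \<sigma> ^ 3)"
  \<comment> \<open>Continuity bounds \<open>U\<close> on the annulus, so finitely many layers
    suffice. Their number \<open>m\<close> does not enter the estimate.\<close>
  have "compact (U ` ann a b)"
    by (intro compact_continuous_image continuous_on_subset[OF cU ann_nonzero] a0 compact_ann)
  then obtain c where c: "\<And>x. x \<in> ann a b \<Longrightarrow> norm (U x) \<le> c"
    using compact_imp_bounded by (force simp: bounded_iff)
  obtain m where "c / \<mu> < 16 ^ m" using real_arch_pow[of 16 "c / \<mu>"] by auto
  then have m: "c \<le> 16 ^ m * \<mu>" using l0 by (simp add: field_simps)
  have w: "(LINT x:ann a b|lborel. if 16 ^ k * \<mu> < norm (U x) then (norm (U x))\<^sup>2 else 0) \<le> 4 * (\<sigma> ^ 3 / 8 ^ k)\<^sup>2 * ?energy" for k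
  proof -
    define r where "r = \<sigma> ^ 3 / 8 ^ k"
    have r: "0 < r" "r \<le> \<sigma> ^ 3"
      using s3 mult_left_mono[of 1 "8 ^ k :: real" "\<sigma> ^ 3"] by (auto simp: r_def field_simps)
    have "32 * cubic (a - r) (b + r) \<le> 32 * n ^ 3"
      using cubic_mono[of "a - \<sigma> ^ 3" "a - r" "b + r" "b + \<sigma> ^ 3"] n r a by auto
    also have "\<dots> \<le> vol1 * level_const ^ 3 * n ^ 3" using level_const(2) n by (intro mult_right_mono) auto
    also have "\<dots> = vol1 * (16 ^ k * \<mu>) ^ 3 * r ^ 4"
    proof -
      have "((16::real) ^ k) ^ 3 = (8 ^ k) ^ 4"
      proof -
        have "((16::real) ^ k) ^ 3 = (16 ^ 3) ^ k" by (simp only: power_mult[symmetric] mult.commute)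
        also have "\<dots> = ((8::real) ^ 4) ^ k" by simp
        finally show ?thesis by (simp only: power_mult[symmetric] mult.commute)
      qed
      then have "(16 ^ k * \<mu>) ^ 3 * r ^ 4 = (\<mu> * \<sigma> ^ 4) ^ 3"
        unfolding r_def power_mult_distrib power_divide by (simp flip: power_mult)
      also have "\<dots> = level_const ^ 3 * n ^ 3" using s by (simp add: lev power_mult_distrib)
      finally show ?thesis by simp
    qed
    finally have "(LINT x:ann a b|lborel. if 16 ^ k * \<mu> < norm (U x) then (norm (U x))\<^sup>2 else 0) \<le> 4 * r\<^sup>2 * energy (a - r) (b + r)"
      using r a l0 by (intro weak_type) auto
    also have "\<dots> \<le> 4 * r\<^sup>2 * ?energy" using r a by (intro mult_left_mono energy_mono) auto
    finally show ?thesis by (simp add: r_def)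
  qed
  have "(LINT x:ann a b|lborel. if \<mu> < norm (U x) then norm (U x) ^ 3 else 0) \<le>
     (LINT x:ann a b|lborel. \<Sum>k<m. (16 * 16 ^ k * \<mu>) * (if 16 ^ k * \<mu> < norm (U x) then (norm (U x))\<^sup>2 else 0))"
  proof (intro set_integral_mono set_integrable_tail a0)
    show "set_integrable lborel (ann a b) (\<lambda>x. \<Sum>k<m. (16 * 16 ^ k * \<mu>) * (if 16 ^ k * \<mu> < norm (U x) then (norm (U x))\<^sup>2 else 0))"
      unfolding set_integrable_def scaleR_sum_right
      using set_integrable_mult_right[OF set_integrable_tail[OF a0, of _ _ 2]]
      by (intro Bochner_Integration.integrable_sum) (auto simp: set_integrable_def)
    fix x assume "x \<in> ann a b"
    then show "(if \<mu> < norm (U x) then norm (U x) ^ 3 else 0) \<le>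
       (\<Sum>k<m. (16 * 16 ^ k * \<mu>) * (if 16 ^ k * \<mu> < norm (U x) then (norm (U x))\<^sup>2 else 0))"
      using c[of x] m l0 by (intro dyadic_tail) auto
  qed
  also have "\<dots> = (\<Sum>k<m. (16 * 16 ^ k * \<mu>) * (LINT x:ann a b|lborel. if 16 ^ k * \<mu> < norm (U x) then (norm (U x))\<^sup>2 else 0))"
    by (subst set_integral_sum) (auto intro!: set_integrable_mult_right set_integrable_tail a0)
  also have "\<dots> \<le> (\<Sum>k<m. (16 * 16 ^ k * \<mu>) * (4 * (\<sigma> ^ 3 / 8 ^ k)\<^sup>2 * ?energy))"
    using l0 by (intro sum_mono mult_left_mono w) auto
  also have "\<dots> = (\<Sum>k<m. (1 / 4) ^ k) * (64 * level_const * n * \<sigma>\<^sup>2 * ?energy)"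
  proof -
    have "(16 * 16 ^ k * \<mu>) * (4 * (\<sigma> ^ 3 / 8 ^ k)\<^sup>2 * ?energy) = (1 / 4) ^ k * (64 * level_const * n * \<sigma>\<^sup>2 * ?energy)" for k
    proof -
      have "((8::real) ^ k)\<^sup>2 = 16 ^ k * 4 ^ k"
        by (simp add: power2_eq_square flip: power_mult_distrib)
      then have "(16 * 16 ^ k * \<mu>) * (4 * (\<sigma> ^ 3 / 8 ^ k)\<^sup>2 * ?energy) = 64 * (\<mu> * (\<sigma> ^ 3)\<^sup>2) * ?energy / 4 ^ k"
        by (simp add: power_divide)
      also have "\<mu> * (\<sigma> ^ 3)\<^sup>2 = level_const * n * \<sigma>\<^sup>2"
        using s by (simp add: lev field_simps flip: power_mult power_add)
      finally show ?thesis by (simp add: power_divide)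
    qed
    then show ?thesis by (simp only: sum_distrib_right)
  qed
  also have "\<dots> \<le> (4 / 3) * (64 * level_const * n * \<sigma>\<^sup>2 * ?energy)"
  proof (intro mult_right_mono)
    have "(\<Sum>k<m. (1 / 4 :: real) ^ k) = (1 - (1 / 4) ^ m) * (4 / 3)"
      by (simp add: sum_gp_strict)
    also have "\<dots> \<le> 4 / 3" by simp
    finally show "(\<Sum>k<m. (1 / 4 :: real) ^ k) \<le> 4 / 3" .
  qed (use level_const n energy_nonneg in auto)
  also have "\<dots> = (256 / 3) * (level_const * n * \<sigma>\<^sup>2 * ?energy)" by simp
  also have "\<dots> \<le> 86 * (level_const * n * \<sigma>\<^sup>2 * ?energy)"
    using level_const n energy_nonneg by (intro mult_right_mono) auto
  finally show ?thesis by (simp add: mult.assoc)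
qed

text \<open>Instead of Hoelder's inequality, the pointwise bound of \<open>u\<^sup>2\<close> by
  \<open>n\<^sup>2 + u ^ 3 / n\<close>, obtained by comparing \<open>u\<close> with
  \<open>n\<close>.\<close>

lemma square_integral_le:
  assumes "0 < a" "b \<le> 4" "0 < n" "cubic a b \<le> n ^ 3"
  shows "(LINT x:ann a b|lborel. (norm (U x))\<^sup>2) \<le> (vol4 + 1) * n\<^sup>2"
proof -
  have ci: "set_integrable lborel (ann a b) (\<lambda>x. n\<^sup>2)"
    by (intro set_integrable_compact compact_ann continuous_intros)
  have "(LINT x:ann a b|lborel. (norm (U x))\<^sup>2) \<le> (LINT x:ann a b|lborel. n\<^sup>2 + (1 / n) * norm (U x) ^ 3)"
  proof (intro set_integral_mono set_integral_add(1) ci set_integrable_mult_right set_integrable_ann continuous_on_cube assms(1) continuous_intros cU)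
    fix x
    define u where "u = norm (U x)"
    have u: "0 \<le> u" by (simp add: u_def)
    have "u\<^sup>2 \<le> n\<^sup>2 + (1 / n) * u ^ 3"
    proof (cases "u \<le> n")
      case True
      then have "u\<^sup>2 \<le> n\<^sup>2" using u by (intro power_mono) auto
      moreover have "0 \<le> (1 / n) * u ^ 3" using u assms by simp
      ultimately show ?thesis by linarith
    next
      case False
      then have "u\<^sup>2 * 1 \<le> u\<^sup>2 * (u / n)" using assms by (intro mult_left_mono) auto
      also have "\<dots> = (1 / n) * u ^ 3" by (simp add: power2_eq_square power3_eq_cube)
      finally show ?thesis using zero_le_power2[of n] by linarith
    qed
    then show "(norm (U x))\<^sup>2 \<le> n\<^sup>2 + (1 / n) * norm (U x) ^ 3" by (simp add: u_def)
  qed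
  also have "\<dots> = (LINT x:ann a b|lborel. n\<^sup>2) + (1 / n) * cubic a b"
  proof -
    have "set_integrable lborel (ann a b) (\<lambda>x. (1 / n) * norm (U x) ^ 3)"
      by (intro set_integrable_mult_right set_integrable_ann continuous_on_cube assms(1))
    then show ?thesis by (simp only: set_integral_add(2)[OF ci] set_integral_mult_right cubic_def)
  qed
  also have "(LINT x:ann a b|lborel. n\<^sup>2) = n\<^sup>2 * measure lborel (ann a b)"
    by (simp add: set_lebesgue_integral_def)
  also have "\<dots> \<le> n\<^sup>2 * vol4" using measure_ann[OF assms(2)] by (intro mult_left_mono) auto
  also have "(1 / n) * cubic a b \<le> (1 / n) * n ^ 3" using assms by (intro mult_left_mono) auto
  finally show ?thesis using assms by (simp add: power2_eq_square power3_eq_cube algebra_simps)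
qed

section \<open>Averages of the kernel at large and at small scales\<close>

lemma continuous_on_quad_kernel_pair:
  assumes "0 \<le> s" "0 < a - s"
  shows "continuous_on (ann a b \<times> cball 0 1) (\<lambda>p. quad_kernel (snd p) (U (fst p - s *\<^sub>R snd p)))"
    and "continuous_on (ann a b \<times> cball 0 1) (\<lambda>p. quad_kernel (snd p) (U (fst p)))"
  by (intro continuous_on_quad_kernel continuous_on_shift_pair[OF assms] continuous_intros)+

lemma continuous_on_fst_factor:
  "continuous_on (ann a b) g \<Longrightarrow> continuous_on (ann a b \<times> cball 0 1) (\<lambda>p. g (fst p))"
  by (rule continuous_on_compose2[OF _ continuous_on_fst[OF continuous_on_id]]) auto

text \<open>No cancellation is used: with p and q the speeds at the two points, p q^2 is at most p^3
  + q^3, and each cube integrates to at most n^3. The constant is 7 from the kernel times 2. No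
  power of \<open>s\<close> is gained, so this serves for scales bounded below.\<close>

lemma far_estimate:
  assumes s: "0 \<le> s" "0 < a - s" and n: "cubic (a - s) (b + s) \<le> n ^ 3"
    and g: "continuous_on (ann a b) g" "\<And>x. x \<in> ann a b \<Longrightarrow> \<bar>g x\<bar> \<le> K * norm (U x)" and K: "0 \<le> K"
  shows "\<bar>LINT x:ann a b|lborel. g x * (LINT z:cball 0 1|lborel. quad_kernel z (U (x - s *\<^sub>R z)))\<bar> \<le> 14 * vol1 * K * n ^ 3"
proof -
  let ?F = "\<lambda>x z. 7 * K * (norm (U x) ^ 3 + norm (U (x - s *\<^sub>R z)) ^ 3)"
  have a0: "0 < a" using s by linarith
  have "\<bar>LINT x:ann a b|lborel. LINT z:cball 0 1|lborel. g x * quad_kernel z (U (x - s *\<^sub>R z))\<bar> \<le> (7 * K * (2 * n ^ 3)) * vol1"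
  proof (rule double_integral_bound[where F = ?F])
    show "continuous_on (ann a b \<times> cball 0 1) (\<lambda>(x, z). g x * quad_kernel z (U (x - s *\<^sub>R z)))"
      unfolding case_prod_beta by (intro continuous_intros continuous_on_quad_kernel_pair[OF s] continuous_on_fst_factor g)
    show "continuous_on (ann a b \<times> cball 0 1) (\<lambda>(x, z). ?F x z)"
      unfolding case_prod_beta by (intro continuous_intros continuous_on_shift_pair[OF s])
    fix x z :: "real^4" assume x: "x \<in> ann a b" and z: "z \<in> cball 0 1"
    define p q where "p = norm (U x)" and "q = norm (U (x - s *\<^sub>R z))"
    have pq: "0 \<le> p" "0 \<le> q" by (auto simp: p_def q_def)
    have "p * q\<^sup>2 \<le> p ^ 3 + q ^ 3"
    proof (cases "p \<le> q")
      case True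
      then have "p * q\<^sup>2 \<le> q * q\<^sup>2" by (intro mult_right_mono) auto
      then show ?thesis using pq by (simp add: power2_eq_square power3_eq_cube add_increasing)
    next
      case False
      then have "q\<^sup>2 \<le> p\<^sup>2" using pq by (intro power_mono) auto
      then have "p * q\<^sup>2 \<le> p * p\<^sup>2" using pq by (intro mult_left_mono) auto
      then show ?thesis using pq by (simp add: power2_eq_square power3_eq_cube add_increasing2)
    qed
    have "\<bar>g x * quad_kernel z (U (x - s *\<^sub>R z))\<bar> \<le> (K * p) * (7 * q\<^sup>2)"
      unfolding abs_mult p_def q_def by (intro mult_mono g(2) x quad_kernel_bound z) (auto simp: K)
    also have "\<dots> = 7 * K * (p * q\<^sup>2)" by simp
    also have "\<dots> \<le> 7 * K * (p ^ 3 + q ^ 3)" using K \<open>p * q\<^sup>2 \<le> p ^ 3 + q ^ 3\<close> by (intro mult_left_mono) auto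
    finally show "\<bar>g x * quad_kernel z (U (x - s *\<^sub>R z))\<bar> \<le> ?F x z" by (simp add: p_def q_def)
  next
    fix z :: "real^4" assume z: "z \<in> cball 0 1"
    have "(LINT x:ann a b|lborel. norm (U (x + - (s *\<^sub>R z))) ^ 3) \<le> cubic (a - s) (b + s)"
      and i: "set_integrable lborel (ann a b) (\<lambda>x. norm (U (x + - (s *\<^sub>R z))) ^ 3)"
      unfolding cubic_def using ann_shift_scaled[OF _ z s(1)] s
      by (intro set_integral_translate_le[of _ "ann (a - s) (b + s)"] set_integrable_ann continuous_on_cube; simp)+
    then have 1: "(LINT x:ann a b|lborel. norm (U (x - s *\<^sub>R z)) ^ 3) \<le> n ^ 3"
      and i: "set_integrable lborel (ann a b) (\<lambda>x. norm (U (x - s *\<^sub>R z)) ^ 3)" using n by simp_all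
    have 2: "(LINT x:ann a b|lborel. norm (U x) ^ 3) \<le> n ^ 3"
      using cubic_mono[of "a - s" a b "b + s"] n s by (simp add: cubic_def)
    have "(LINT x:ann a b|lborel. ?F x z) = 7 * K * ((LINT x:ann a b|lborel. norm (U x) ^ 3) + (LINT x:ann a b|lborel. norm (U (x - s *\<^sub>R z)) ^ 3))"
      by (simp add: set_integral_add(2)[OF set_integrable_ann[OF continuous_on_cube a0] i])
    also have "\<dots> \<le> 7 * K * (2 * n ^ 3)" using 1 2 K by (intro mult_left_mono) auto
    finally show "(LINT x:ann a b|lborel. ?F x z) \<le> 7 * K * (2 * n ^ 3)" .
  qed simp
  then show ?thesis by (simp add: algebra_simps)
qed

text \<open>The kernel has mean zero, so only \<open>U (x - s z) - U x\<close> matters. With \<open>s = \<sigma> ^ 5\<close> and truncation at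
  height \<open>level_const * n / \<sigma> ^ 4\<close> both parts gain a factor \<open>\<sigma>\<close>, which cancels the \<open>1 / \<sigma>\<close> in
  \<open>s^-1 ds = 5 \<sigma>^-1 d\<sigma>\<close>.\<close>

lemma near_estimate:
  assumes \<sigma>: "0 < \<sigma>" "\<sigma> \<le> 1" and a: "0 < a - 2 * \<sigma> ^ 3" and b: "b + 2 * \<sigma> ^ 3 \<le> 4"
    and n: "0 < n" "cubic (a - 2 * \<sigma> ^ 3) (b + 2 * \<sigma> ^ 3) \<le> n ^ 3"
    and g: "continuous_on (ann a b) g" "\<And>x. x \<in> ann a b \<Longrightarrow> \<bar>g x\<bar> \<le> K * norm (U x)" and K: "0 \<le> K"
  shows "\<bar>LINT x:ann a b|lborel. g x * (LINT z:cball 0 1|lborel. quad_kernel z (U (x - \<sigma> ^ 5 *\<^sub>R z)))\<bar>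
    \<le> 7 * vol1 * level_const * (vol4 + 690) * K * n * \<sigma> * (energy (a - 2 * \<sigma> ^ 3) (b + 2 * \<sigma> ^ 3) + n\<^sup>2)"
proof -
  define s where "s = \<sigma> ^ 5"
  let ?energy = "energy (a - 2 * \<sigma> ^ 3) (b + 2 * \<sigma> ^ 3)"
  define \<mu> where "\<mu> = level_const * n / \<sigma> ^ 4"
  have s3: "0 < \<sigma> ^ 3" and ss: "s \<le> \<sigma> ^ 3" and s0: "0 < s"
    using \<sigma> power_decreasing[of 3 5 \<sigma>] by (auto simp: s_def)
  have as: "0 < a - s" and a0: "0 < a" and s2: "s \<le> 2 * \<sigma> ^ 3" using a ss s3 by linarith+
  have s0': "0 \<le> s" using s0 by simp
  have mu: "0 < \<mu>" using level_const n \<sigma> by (simp add: \<mu>_def)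
  have E0: "0 \<le> ?energy" by (rule energy_nonneg)
  have c: "0 \<le> 86 * level_const * n * \<sigma>\<^sup>2" using level_const n by simp
  let ?d = "\<lambda>x z. norm (U (x - s *\<^sub>R z) - U x)"
  let ?F = "\<lambda>x z. 7 * K * (norm (U x) * (?d x z * (norm (U (x - s *\<^sub>R z)) + norm (U x))))"
  let ?f = "\<lambda>x z. g x * (quad_kernel z (U (x - s *\<^sub>R z)) - quad_kernel z (U x))"
  let ?T = "\<lambda>x. if \<mu> < norm (U x) then norm (U x) ^ 3 else 0"
  have "\<bar>LINT x:ann a b|lborel. LINT z:cball 0 1|lborel. ?f x z\<bar> \<le> (7 * K * (level_const * (vol4 + 690) * n * \<sigma> * (?energy + n\<^sup>2))) * vol1"
  proof (rule double_integral_bound[where F = ?F])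
    show "continuous_on (ann a b \<times> cball 0 1) (\<lambda>(x, z). ?f x z)"
      unfolding case_prod_beta by (intro continuous_intros continuous_on_quad_kernel_pair[OF s0' as] continuous_on_fst_factor g)
    show "continuous_on (ann a b \<times> cball 0 1) (\<lambda>(x, z). ?F x z)"
      unfolding case_prod_beta by (intro continuous_intros continuous_on_shift_pair[OF s0' as])
    fix x z :: "real^4" assume x: "x \<in> ann a b" and z: "z \<in> cball 0 1"
    have "\<bar>?f x z\<bar> \<le> (K * norm (U x)) * (7 * (?d x z * (norm (U (x - s *\<^sub>R z)) + norm (U x))))"
      unfolding abs_mult by (intro mult_mono g(2) x quad_kernel_bound z) (auto simp: K)
    then show "\<bar>?f x z\<bar> \<le> ?F x z" by (simp add: mult_ac)
  next
    fix z :: "real^4" assume z: "z \<in> cball 0 1"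
    have cs: "continuous_on (ann a b) (\<lambda>x. U (x - s *\<^sub>R z))" and c1: "continuous_on (ann a b) U"
    proof -
      have "continuous_on (ann a b) (\<lambda>x. (\<lambda>p. U (fst p - s *\<^sub>R snd p)) (x, z))"
        by (rule continuous_on_compose2[OF continuous_on_shift_pair(1)[OF s0' as, of b]]) (use z in \<open>auto intro!: continuous_intros\<close>)
      then show "continuous_on (ann a b) (\<lambda>x. U (x - s *\<^sub>R z))" by simp
      show "continuous_on (ann a b) U" by (rule continuous_on_subset[OF cU ann_nonzero[OF a0]])
    qed
    have iT: "set_integrable lborel (ann a b) ?T" by (rule set_integrable_tail[OF a0])
    have T2: "(LINT x:ann a b|lborel. ?T (x + - (s *\<^sub>R z))) \<le> (LINT x:ann (a - s) (b + s)|lborel. ?T x)"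
      and iT2: "set_integrable lborel (ann a b) (\<lambda>x. ?T (x + - (s *\<^sub>R z)))"
      using ann_shift_scaled[OF _ z s0']
      by (intro set_integral_translate_le[of _ "ann (a - s) (b + s)"] set_integrable_tail as; simp)+
    have i1: "set_integrable lborel (ann a b) (\<lambda>x. (?d x z)\<^sup>2)" and i2: "set_integrable lborel (ann a b) (\<lambda>x. (norm (U x))\<^sup>2)"
      by (intro set_integrable_compact compact_ann continuous_intros cs c1)+
    let ?R = "\<lambda>x. ((\<mu> / s) * (?d x z)\<^sup>2 + (\<mu> * s) * (norm (U x))\<^sup>2) + (4 * ?T x + 4 * ?T (x + - (s *\<^sub>R z)))"
    have "(LINT x:ann a b|lborel. norm (U x) * (?d x z * (norm (U (x - s *\<^sub>R z)) + norm (U x)))) \<le> (LINT x:ann a b|lborel. ?R x)"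
    proof (intro set_integral_mono set_integral_add(1) set_integrable_mult_right i1 i2 iT iT2)
      show "set_integrable lborel (ann a b) (\<lambda>x. norm (U x) * (?d x z * (norm (U (x - s *\<^sub>R z)) + norm (U x))))"
        by (intro set_integrable_compact compact_ann continuous_intros cs c1)
      fix x assume "x \<in> ann a b"
      define p q d where "p = norm (U x)" and "q = norm (U (x - s *\<^sub>R z))" and "d = ?d x z"
      have pq: "0 \<le> p" "0 \<le> q" "0 \<le> d" by (auto simp: p_def q_def d_def)
      have dpq: "d \<le> q + p" unfolding p_def q_def d_def by (rule norm_triangle_ineq4)
      let ?tp = "if \<mu> < p then p ^ 3 else 0" and ?tq = "if \<mu> < q then q ^ 3 else 0"
      have t0: "0 \<le> ?tp" "0 \<le> ?tq" using pq by auto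
      have "p * (d * (q + p)) \<le> ((\<mu> / s) * d\<^sup>2 + (\<mu> * s) * p\<^sup>2) + (4 * ?tp + 4 * ?tq)"
      proof (cases "p \<le> \<mu> \<and> q \<le> \<mu>")
        case True
        \<comment> \<open>Young's inequality weighted by \<open>s\<close>: since d^2 integrates to
          at most \<open>s\<^sup>2\<close> times the energy, both terms end up with the coefficient
          \<open>\<mu> * s\<close>.\<close>
        have "2 * (d * p) \<le> d\<^sup>2 / s + s * p\<^sup>2"
        proof -
          have "0 \<le> (d - s * p)\<^sup>2 / s" using s0 by simp
          also have "\<dots> = d\<^sup>2 / s + s * p\<^sup>2 - 2 * (d * p)" using s0 by (simp add: power2_eq_square field_simps)
          finally show ?thesis by simp
        qed
        then have "\<mu> * (2 * (d * p)) \<le> \<mu> * (d\<^sup>2 / s + s * p\<^sup>2)" using mu by (intro mult_left_mono) auto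
        moreover have "(p * d) * (q + p) \<le> (p * d) * (2 * \<mu>)" using True pq by (intro mult_left_mono) auto
        ultimately have "p * (d * (q + p)) \<le> (\<mu> / s) * d\<^sup>2 + (\<mu> * s) * p\<^sup>2" by (simp add: algebra_simps)
        then show ?thesis using t0 by linarith
      next
        case False
        \<comment> \<open>With one speed above the level, the three factors are at most t, 2 t and 2
          t, and t is the larger speed, so its cube is one of the two tail terms.\<close>
        define t where "t = max p q"
        have t: "\<mu> < t" "p \<le> t" "q \<le> t" "0 \<le> t" using False pq by (auto simp: t_def)
        have "p * (d * (q + p)) \<le> t * ((2 * t) * (2 * t))"
          using t pq dpq by (intro mult_mono) auto
        also have "\<dots> = 4 * t ^ 3" by (simp add: power3_eq_cube)
        also have "\<dots> \<le> 4 * ?tp + 4 * ?tq"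
        proof (cases "p \<le> q")
          case True
          then have "t = q" by (simp add: t_def)
          then have "?tq = t ^ 3" using t by simp
          then show ?thesis using t0 by linarith
        next
          case False
          then have "t = p" by (simp add: t_def)
          then have "?tp = t ^ 3" using t by simp
          then show ?thesis using t0 by linarith
        qed
        finally have "p * (d * (q + p)) \<le> 4 * ?tp + 4 * ?tq" .
        moreover have "0 \<le> (\<mu> / s) * d\<^sup>2" "0 \<le> (\<mu> * s) * p\<^sup>2" using mu s0 by auto
        ultimately show ?thesis by linarith
      qed
      then show "norm (U x) * (?d x z * (norm (U (x - s *\<^sub>R z)) + norm (U x))) \<le> ?R x"
        unfolding p_def q_def d_def by (simp only: add_uminus_conv_diff)
    qed
    also have "\<dots> = ((\<mu> / s) * (LINT x:ann a b|lborel. (?d x z)\<^sup>2) + (\<mu> * s) * (LINT x:ann a b|lborel. (norm (U x))\<^sup>2))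
       + (4 * (LINT x:ann a b|lborel. ?T x) + 4 * (LINT x:ann a b|lborel. ?T (x + - (s *\<^sub>R z))))"
      using i1 i2 iT iT2 by (simp only: set_integral_add set_integral_mult_right set_integrable_mult_right)
    also have "\<dots> \<le> ((\<mu> / s) * (s\<^sup>2 * ?energy) + (\<mu> * s) * ((vol4 + 1) * n\<^sup>2))
       + (4 * (86 * level_const * n * \<sigma>\<^sup>2 * ?energy) + 4 * (86 * level_const * n * \<sigma>\<^sup>2 * ?energy))"
    proof (intro add_mono mult_left_mono)
      have "(LINT x:ann a b|lborel. (?d x z)\<^sup>2) \<le> s\<^sup>2 * energy (a - s) (b + s)"
        by (rule difference_estimate'[OF z s0' as])
      also have "\<dots> \<le> s\<^sup>2 * ?energy" using a s2 zero_le_power2[of s] by (intro mult_left_mono energy_mono; linarith)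
      finally show "(LINT x:ann a b|lborel. (?d x z)\<^sup>2) \<le> s\<^sup>2 * ?energy" .
      show "(LINT x:ann a b|lborel. (norm (U x))\<^sup>2) \<le> (vol4 + 1) * n\<^sup>2"
        using a b s3 n cubic_mono[of "a - 2 * \<sigma> ^ 3" a b "b + 2 * \<sigma> ^ 3"] by (intro square_integral_le; linarith)
      have "(LINT x:ann a b|lborel. ?T x) \<le> 86 * level_const * n * \<sigma>\<^sup>2 * energy (a - \<sigma> ^ 3) (b + \<sigma> ^ 3)"
        using a s3 n cubic_mono[of "a - 2 * \<sigma> ^ 3" "a - \<sigma> ^ 3" "b + \<sigma> ^ 3" "b + 2 * \<sigma> ^ 3"]
        by (intro cube_tail \<sigma> \<mu>_def; linarith)
      also have "\<dots> \<le> 86 * level_const * n * \<sigma>\<^sup>2 * ?energy" using a s3 c by (intro mult_left_mono energy_mono; linarith)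
      finally show "(LINT x:ann a b|lborel. ?T x) \<le> 86 * level_const * n * \<sigma>\<^sup>2 * ?energy" .
      \<comment> \<open>The translate enlarges the annulus by \<open>s\<close>, which is at most
        \<open>\<sigma> ^ 3\<close>, and \<open>cube_tail\<close> enlarges it by another
        \<open>\<sigma> ^ 3\<close>. Hence the margin \<open>2 * \<sigma> ^ 3\<close> in the
        statement.\<close>
      have "(LINT x:ann a b|lborel. ?T (x + - (s *\<^sub>R z))) \<le> 86 * level_const * n * \<sigma>\<^sup>2 * energy (a - s - \<sigma> ^ 3) (b + s + \<sigma> ^ 3)"
        using a s3 ss n cubic_mono[of "a - 2 * \<sigma> ^ 3" "a - s - \<sigma> ^ 3" "b + s + \<sigma> ^ 3" "b + 2 * \<sigma> ^ 3"]
        by (intro order_trans[OF T2] cube_tail \<sigma> \<mu>_def; linarith)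
      also have "\<dots> \<le> 86 * level_const * n * \<sigma>\<^sup>2 * ?energy" using a s3 ss c by (intro mult_left_mono energy_mono; linarith)
      finally show "(LINT x:ann a b|lborel. ?T (x + - (s *\<^sub>R z))) \<le> 86 * level_const * n * \<sigma>\<^sup>2 * ?energy" .
    qed (use mu s0 in auto)
    also have "\<dots> = level_const * n * \<sigma> * (?energy + (vol4 + 1) * n\<^sup>2 + 688 * \<sigma> * ?energy)"
    proof -
      have "\<mu> * s = level_const * n * \<sigma>" using \<sigma> by (simp add: \<mu>_def s_def field_simps power_eq_if)
      moreover have "(\<mu> / s) * (s\<^sup>2 * ?energy) = \<mu> * s * ?energy" using s0 by (simp add: power2_eq_square)
      ultimately show ?thesis by (simp add: power2_eq_square algebra_simps)
    qed
    \<comment> \<open>688 = 8 * 86 comes from the two tails; one more unit of energy from the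
      differences and \<open>vol4 + 1\<close> from the squares fit into
      \<open>vol4 + 690\<close>.\<close>
    also have "\<dots> \<le> level_const * n * \<sigma> * ((vol4 + 690) * (?energy + n\<^sup>2))"
    proof (intro mult_left_mono)
      have gen: "e + (vol4 + 1) * m + t \<le> (vol4 + 690) * (e + m)" if "t \<le> 688 * e" "0 \<le> e" "0 \<le> m" for e m t :: real
      proof -
        have "0 \<le> vol4 * e" using that vol4_nonneg by simp
        then show ?thesis using that unfolding distrib_left distrib_right by linarith
      qed
      have "688 * \<sigma> * ?energy \<le> 688 * 1 * ?energy" using \<sigma> E0 by (intro mult_right_mono) auto
      then show "?energy + (vol4 + 1) * n\<^sup>2 + 688 * \<sigma> * ?energy \<le> (vol4 + 690) * (?energy + n\<^sup>2)"
        using E0 by (intro gen) auto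
    qed (use level_const n \<sigma> in auto)
    finally have "(LINT x:ann a b|lborel. norm (U x) * (?d x z * (norm (U (x - s *\<^sub>R z)) + norm (U x)))) \<le> level_const * (vol4 + 690) * n * \<sigma> * (?energy + n\<^sup>2)"
      by (simp add: mult_ac)
    then have "7 * K * (LINT x:ann a b|lborel. norm (U x) * (?d x z * (norm (U (x - s *\<^sub>R z)) + norm (U x)))) \<le> 7 * K * (level_const * (vol4 + 690) * n * \<sigma> * (?energy + n\<^sup>2))"
      using K by (intro mult_left_mono) auto
    then show "(LINT x:ann a b|lborel. ?F x z) \<le> 7 * K * (level_const * (vol4 + 690) * n * \<sigma> * (?energy + n\<^sup>2))"
      by simp
  qed simp
  \<comment> \<open>Subtracting the kernel at the fixed value \<open>U x\<close> changes nothing by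
    \<open>integral_quad_kernel\<close>.\<close>
  moreover have "(LINT x:ann a b|lborel. LINT z:cball 0 1|lborel. ?f x z) = (LINT x:ann a b|lborel. g x * (LINT z:cball 0 1|lborel. quad_kernel z (U (x - s *\<^sub>R z))))"
  proof (intro set_lebesgue_integral_cong allI impI)
    fix x assume x: "x \<in> ann a b"
    then have sx: "s < norm x" using as by (auto simp: ann_def)
    have "set_integrable lborel (cball 0 1) (\<lambda>z. quad_kernel z (U (x - s *\<^sub>R z)))" "set_integrable lborel (cball 0 1) (\<lambda>z. quad_kernel z (U x))"
      by (intro set_integrable_compact compact_cball continuous_on_quad_kernel continuous_on_shift[OF cU s0' sx] continuous_intros)+
    then show "(LINT z:cball 0 1|lborel. ?f x z) = g x * (LINT z:cball 0 1|lborel. quad_kernel z (U (x - s *\<^sub>R z)))"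
      by (simp add: integral_quad_kernel set_integral_diff(2))
  qed simp
  ultimately show ?thesis by (simp only: s_def mult_ac)
qed

end

section \<open>The pressure flux\<close>

lemma Fubini_compact_pair:
  fixes f :: "'a::euclidean_space \<Rightarrow> 'b::euclidean_space \<Rightarrow> real"
  assumes K: "compact K" and L: "compact L" and f: "continuous_on (K \<times> L) (\<lambda>(x, y). f x y)"
  shows "(LINT p:(K \<times> L)|lborel. f (fst p) (snd p)) = (LINT x:K|lborel. LINT y:L|lborel. f x y)"
proof -
  let ?F = "\<lambda>x y. indicator K x *\<^sub>R (indicator L y *\<^sub>R f x y)"
  have eq: "(\<lambda>p. indicator (K \<times> L) p *\<^sub>R (case p of (x, y) \<Rightarrow> f x y)) = (\<lambda>(x, y). ?F x y)"
    by (auto simp: fun_eq_iff indicator_def)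
  have int: "integrable (lborel \<Otimes>\<^sub>M lborel) (\<lambda>(x, y). ?F x y)"
    using borel_integrable_compact[OF compact_Times[OF K L] f] unfolding lborel_prod eq .
  have "(LINT p:(K \<times> L)|lborel. f (fst p) (snd p)) = integral\<^sup>L lborel (\<lambda>(x, y). ?F x y)"
    unfolding set_lebesgue_integral_def eq[symmetric] by (simp add: case_prod_beta)
  also have "\<dots> = integral\<^sup>L (lborel \<Otimes>\<^sub>M lborel) (\<lambda>(x, y). ?F x y)"
    by (simp add: lborel_prod)
  also have "\<dots> = (LINT x|lborel. LINT y|lborel. ?F x y)"
    using lborel_pair.integral_fst[OF int] by simp
  finally show ?thesis by (simp add: set_lebesgue_integral_def)
qed

lemma set_integral_split_bound:
  fixes \<Psi> :: "real \<Rightarrow> real"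
  assumes i: "set_integrable lborel {0..b} \<Psi>" and d: "0 \<le> d" "d \<le> b" and c: "0 \<le> c1" "0 \<le> c2"
    and b1: "\<And>\<sigma>. 0 \<le> \<sigma> \<Longrightarrow> \<sigma> \<le> d \<Longrightarrow> \<bar>\<Psi> \<sigma>\<bar> \<le> c1" and b2: "\<And>\<sigma>. d < \<sigma> \<Longrightarrow> \<sigma> \<le> b \<Longrightarrow> \<bar>\<Psi> \<sigma>\<bar> \<le> c2"
  shows "\<bar>LINT \<sigma>:{0..b}|lborel. \<Psi> \<sigma>\<bar> \<le> c1 * d + c2 * b"
proof -
  have i1: "set_integrable lborel {0..b} (\<lambda>\<sigma>. c1 * indicator {0..d} \<sigma>)"
    unfolding set_integrable_def by (intro integrable_mult_indicator integrable_mult_right) (use d in \<open>auto intro!: integrable_real_indicator\<close>)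
  have i2: "set_integrable lborel {0..b} (\<lambda>\<sigma>. c2)"
    by (intro set_integrable_compact compact_Icc continuous_intros)
  have "\<bar>LINT \<sigma>:{0..b}|lborel. \<Psi> \<sigma>\<bar> \<le> (LINT \<sigma>:{0..b}|lborel. c1 * indicator {0..d} \<sigma> + c2)"
  proof (rule set_integral_abs_le[OF i set_integral_add(1)[OF i1 i2]])
    fix \<sigma> assume "\<sigma> \<in> {0..b}"
    then show "\<bar>\<Psi> \<sigma>\<bar> \<le> c1 * indicator {0..d} \<sigma> + c2"
      using b1[of \<sigma>] b2[of \<sigma>] c by (cases "\<sigma> \<le> d") (auto simp: indicator_def)
  qed
  also have "\<dots> = (LINT \<sigma>:{0..b}|lborel. c1 * indicator {0..d} \<sigma>) + (LINT \<sigma>:{0..b}|lborel. c2)"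
    by (rule set_integral_add(2)[OF i1 i2])
  also have "(LINT \<sigma>:{0..b}|lborel. c1 * indicator {0..d} \<sigma>) = c1 * (LINT \<sigma>|lborel. indicator {0..d} \<sigma>)"
  proof -
    have "(LINT \<sigma>:{0..b}|lborel. indicator {0..d} \<sigma> :: real) = (LINT \<sigma>|lborel. indicator {0..d} \<sigma>)"
      unfolding set_lebesgue_integral_def by (rule Bochner_Integration.integral_cong) (use d in \<open>auto simp: indicator_def\<close>)
    then show ?thesis by simp
  qed
  finally show ?thesis using d by (simp add: set_lebesgue_integral_def mult.commute)
qed

section \<open>The mollified pressure has bounded oscillation\<close>

lemma card_4_UNIV: "of_nat (card (UNIV :: 4 set)) = (4 :: real)"
  by simp

text \<open>Two points of an annulus are joined inside a slightly larger one through a unit vector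
  orthogonal to both.\<close>

lemma orthogonal_unit:
  fixes x y :: "real ^ 4"
  obtains e where "norm e = 1" "e \<bullet> x = 0" "e \<bullet> y = 0"
proof -
  have "dim {x, y} \<le> card {x, y}" by (intro dim_le_card' finite.intros)
  also have "\<dots> \<le> 2" by (simp add: card_insert_if)
  finally have "dim {x, y} < DIM(real ^ 4)" by simp
  then obtain a where a: "a \<noteq> 0" "\<And>w. w \<in> span {x, y} \<Longrightarrow> orthogonal a w"
    by (rule orthogonal_to_subspace_exists) blast
  have "norm (a /\<^sub>R norm a) = 1" using a by simp
  moreover have "(a /\<^sub>R norm a) \<bullet> x = 0" "(a /\<^sub>R norm a) \<bullet> y = 0"
    using a(2)[OF span_base, of x] a(2)[OF span_base, of y] by (simp_all add: orthogonal_def)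
  ultimately show ?thesis by (rule that)
qed

text \<open>Orthogonality gives the squared norm (1 - t)^2 + t^2 |x|^2. With |x| at least 1/2 this
  is at least 1/5 + (5/4) (t - 4/5)^2, well above the required 1/16.\<close>

lemma segment_norm:
  fixes x e :: "real ^ 4"
  assumes e: "norm e = 1" "e \<bullet> x = 0" and x: "1 / 2 \<le> norm x" "norm x \<le> 5 / 2" and t: "t \<in> {0..1}"
  shows "e + t *\<^sub>R (x - e) \<in> ann (1 / 4) (5 / 2)"
proof -
  have "(norm (e + t *\<^sub>R (x - e)))\<^sup>2 = (1 - t)\<^sup>2 + t\<^sup>2 * (norm x)\<^sup>2"
  proof -
    have "e + t *\<^sub>R (x - e) = (1 - t) *\<^sub>R e + t *\<^sub>R x" by (simp add: algebra_simps)
    then have "(norm (e + t *\<^sub>R (x - e)))\<^sup>2 = ((1 - t) *\<^sub>R e + t *\<^sub>R x) \<bullet> ((1 - t) *\<^sub>R e + t *\<^sub>R x)"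
      by (simp add: power2_norm_eq_inner)
    also have "\<dots> = (1 - t)\<^sup>2 * (e \<bullet> e) + 2 * t * (1 - t) * (e \<bullet> x) + t\<^sup>2 * (x \<bullet> x)"
      by (simp add: inner_simps inner_commute power2_eq_square algebra_simps)
    finally show ?thesis using e by (simp add: dot_square_norm)
  qed
  moreover have "(1 / 4)\<^sup>2 \<le> (1 - t)\<^sup>2 + t\<^sup>2 * (norm x)\<^sup>2"
  proof -
    have "t\<^sup>2 * (1 / 2)\<^sup>2 \<le> t\<^sup>2 * (norm x)\<^sup>2" using x by (intro mult_left_mono power_mono) auto
    moreover have "0 \<le> 5 / 4 * (t - 4 / 5)\<^sup>2" by simp
    then have "(1 / 4)\<^sup>2 \<le> (1 - t)\<^sup>2 + t\<^sup>2 * (1 / 2)\<^sup>2" by (simp add: power2_eq_square algebra_simps)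
    ultimately show ?thesis by linarith
  qed
  ultimately have "(1 / 4)\<^sup>2 \<le> (norm (e + t *\<^sub>R (x - e)))\<^sup>2" by simp
  then have "1 / 4 \<le> norm (e + t *\<^sub>R (x - e))" by (rule power2_le_imp_le) simp
  moreover have "norm (e + t *\<^sub>R (x - e)) \<le> 5 / 2"
  proof -
    have "e + t *\<^sub>R (x - e) = (1 - t) *\<^sub>R e + t *\<^sub>R x" by (simp add: algebra_simps)
    also have "norm \<dots> \<le> (1 - t) * 1 + t * (5 / 2)"
      using norm_triangle_ineq[of "(1 - t) *\<^sub>R e" "t *\<^sub>R x"] e t x mult_left_mono[of "norm x" "5 / 2" t] by simp
    also have "\<dots> \<le> 5 / 2" using t by simp
    finally show ?thesis .
  qed
  ultimately show ?thesis by (simp add: ann_def)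
qed

text \<open>The mollifier is left unnormalized; its mass is divided out in
  \<open>flux_const\<close>.\<close>

definition bump_mass :: real where "bump_mass = (LINT z:cball (0::real^4) 1|lborel. bump z ^ 3)"

lemma bump_mass_pos: "0 < bump_mass"
proof -
  have c: "set_integrable lborel (cball (0::real^4) 1) (\<lambda>z. bump z ^ 3)"
    "set_integrable lborel (cball (0::real^4) (1/2)) (\<lambda>z. bump z ^ 3)"
    "set_integrable lborel (cball (0::real^4) (1/2)) (\<lambda>z. (3 / 4 :: real) ^ 3)"
    by (intro set_integrable_compact compact_cball continuous_intros)+
  have "0 < (3 / 4 :: real) ^ 3 * measure lborel (cball (0::real^4) (1 / 2))"
    by (simp add: content_cball_pos)
  also have "\<dots> = (LINT z:cball (0::real^4) (1 / 2)|lborel. (3 / 4) ^ 3)"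
    by (simp add: set_lebesgue_integral_def)
  also have "\<dots> \<le> (LINT z:cball (0::real^4) (1 / 2)|lborel. bump z ^ 3)"
  proof (intro set_integral_mono c power_mono)
    fix z :: "real^4" assume "z \<in> cball 0 (1/2)"
    then have "(norm z)\<^sup>2 \<le> (1 / 2)\<^sup>2" by (intro power_mono) auto
    then show "3 / 4 \<le> bump z" by (simp add: bump_def dot_square_norm power_divide)
  qed simp
  also have "\<dots> \<le> bump_mass"
    unfolding bump_mass_def by (intro set_integral_mono_set c) (auto simp: bump_nonneg)
  finally show ?thesis .
qed

context NS4
begin

text \<open>The same device as in \<open>square_integral_le\<close>, now with \<open>u\<close> at
  most \<open>n + u ^ 3 / n\<^sup>2\<close>.\<close>

lemma first_integral_le:
  assumes "0 < a" "b \<le> 4" "0 < n" "cubic a b \<le> n ^ 3"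
  shows "(LINT x:ann a b|lborel. norm (U x)) \<le> (vol4 + 1) * n"
proof -
  have ci: "set_integrable lborel (ann a b) (\<lambda>x. n)"
    and i3: "set_integrable lborel (ann a b) (\<lambda>x. (1 / n\<^sup>2) * norm (U x) ^ 3)"
    by (intro set_integrable_compact compact_ann continuous_intros set_integrable_mult_right set_integrable_ann continuous_on_cube assms(1))+
  have "(LINT x:ann a b|lborel. norm (U x)) \<le> (LINT x:ann a b|lborel. n + (1 / n\<^sup>2) * norm (U x) ^ 3)"
  proof (intro set_integral_mono set_integral_add(1) ci i3 set_integrable_ann assms(1) continuous_intros cU)
    fix x
    define u where "u = norm (U x)"
    have u: "0 \<le> u" by (simp add: u_def)
    have "u \<le> n + (1 / n\<^sup>2) * u ^ 3"
    proof (cases "u \<le> n")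
      case True
      moreover have "0 \<le> (1 / n\<^sup>2) * u ^ 3" using u assms by simp
      ultimately show ?thesis by linarith
    next
      case False
      then have "n\<^sup>2 \<le> u\<^sup>2" using assms by (intro power_mono) auto
      then have "u * 1 \<le> u * (u\<^sup>2 / n\<^sup>2)" using assms u by (intro mult_left_mono) auto
      also have "\<dots> = (1 / n\<^sup>2) * u ^ 3" by (simp add: power2_eq_square power3_eq_cube)
      finally show ?thesis using assms by linarith
    qed
    then show "norm (U x) \<le> n + (1 / n\<^sup>2) * norm (U x) ^ 3" by (simp add: u_def)
  qed
  also have "\<dots> = (LINT x:ann a b|lborel. n) + (1 / n\<^sup>2) * cubic a b"
    by (simp only: set_integral_add(2)[OF ci i3] set_integral_mult_right cubic_def)
  also have "(LINT x:ann a b|lborel. n) = n * measure lborel (ann a b)"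
    by (simp add: set_lebesgue_integral_def)
  also have "\<dots> \<le> n * vol4" using assms measure_ann[OF assms(2)] by (intro mult_left_mono) auto
  also have "(1 / n\<^sup>2) * cubic a b \<le> (1 / n\<^sup>2) * n ^ 3" using assms by (intro mult_left_mono) auto
  finally show ?thesis using assms by (simp add: power2_eq_square power3_eq_cube algebra_simps)
qed

lemma unit_scale_shift:
  assumes "0 < r" "r < 1 / 8"
  shows "y \<in> ann (1 / 4) (5 / 2) \<Longrightarrow> z \<in> cball 0 1 \<Longrightarrow> y - r *\<^sub>R z \<in> ann (1 / 8) 4"
  using ann_shift_scaled[of y "1 / 4" "5 / 2" z r] ann_mono[of "1 / 8" "1 / 4 - r" "5 / 2 + r" 4] assms by auto

text \<open>At the fixed scale 1/32 all derivatives can be put on the mollifier: two for the viscous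
  term, which leaves the first power of \<open>U\<close>, and one for the stress, which leaves the
  second. Each derivative costs 32 and the change of variables 32^4, hence 32^6 and 32^5.\<close>

lemma mollified_gradient:
  assumes n: "0 < n" "cubic (1 / 8) 4 \<le> n ^ 3" and y: "y \<in> ann (1 / 4) (5 / 2)"
  shows "\<bar>LINT z:cball 0 1|lborel. bump z ^ 3 * G (y - (1 / 32) *\<^sub>R z) $ i\<bar> \<le> 120 * 32 ^ 6 * (vol4 + 1) * (n + n\<^sup>2)"
proof -
  define s :: real where "s = 1 / 32"
  have s: "0 < s" "s < norm y" using y by (auto simp: s_def ann_def)
  have s0: "0 \<le> s" using s by simp
  let ?I = "\<lambda>f::real^4\<Rightarrow>real. LINT z:cball 0 1|lborel. f z"
  let ?y = "\<lambda>z. y - s *\<^sub>R z"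
  have yz: "?y z \<in> ann (1 / 8) 4" if "z \<in> cball 0 1" for z
    using unit_scale_shift[of s y z] y that by (auto simp: s_def)
  then have nz: "?y z \<noteq> 0" if "z \<in> cball 0 1" for z
    using yz[OF that] ann_nonzero[of "1/8" 4] by auto
  note sh = continuous_on_shift[OF _ s0 s(2)]
  define \<rho> where "\<rho> z = (- 6 * bump z ^ 2) *\<^sub>R z" for z :: "real^4"
  define d\<rho> where "d\<rho> j z = (- 6 * bump z ^ 2) *\<^sub>R axis j 1 + (24 * bump z * z $ j) *\<^sub>R z" for j and z :: "real^4"
  have g\<rho>: "GDERIV (\<lambda>z. \<rho> z $ j) z :> d\<rho> j z" for j z
  proof -
    have "GDERIV (\<lambda>z. (- 6) * (bump z ^ 2 * z $ j)) z :> (- 6) *\<^sub>R (bump z ^ 2 *\<^sub>R axis j 1 + z $ j *\<^sub>R ((- 4 * bump z) *\<^sub>R z))"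
      by (intro GDERIV_cmult GDERIV_mult GDERIV_bump2 GDERIV_component)
    then show ?thesis unfolding \<rho>_def vector_scaleR_component real_scaleR_def mult.assoc
      by (rule GDERIV_subst) (simp add: d\<rho>_def algebra_simps)
  qed
  have c\<rho>: "continuous_on S \<rho>" "continuous_on S (d\<rho> j)" for S j
    unfolding \<rho>_def[abs_def] d\<rho>_def[abs_def] by (intro continuous_intros)+
  have z0: "bump z ^ 3 = 0" "\<rho> z $ j = 0" if "z \<notin> cball 0 1" for z j
    using bump_eq_0[OF that] by (auto simp: \<rho>_def)
  have \<rho>3: "GDERIV (\<lambda>z. bump z ^ 3) z :> \<rho> z" for z unfolding \<rho>_def by (rule GDERIV_bump3)
  have e1: "?I (\<lambda>z. bump z ^ 3 * B i j (?y z) $ j) = (1 / s) * ?I (\<lambda>z. \<rho> z $ j * A i (?y z) $ j)" for j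
    using convolution_by_parts[OF \<rho>3 c\<rho>(1) z0(1) dA cB s, where v = "axis j 1"] by (simp add: inner_axis)
  have e2: "?I (\<lambda>z. \<rho> z $ j * A i (?y z) $ j) = (1 / s) * ?I (\<lambda>z. d\<rho> j z $ j * U (?y z) $ i)" for j
    using convolution_by_parts[OF g\<rho> c\<rho>(2) z0(2) dU cA s, where v = "axis j 1"] by (simp add: inner_axis)
  have e3: "?I (\<lambda>z. bump z ^ 3 * stress_grad i j (?y z) $ j) = (1 / s) * ?I (\<lambda>z. \<rho> z $ j * (U (?y z) $ j * U (?y z) $ i))" for j
    using convolution_by_parts[OF \<rho>3 c\<rho>(1) z0(1) GDERIV_stress continuous_on_stress_grad s, where v = "axis j 1"]
    by (simp add: inner_axis)
  note int = set_integrable_compact[OF compact_cball]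
  have cUy: "continuous_on (cball 0 1) (\<lambda>z. U (?y z))" and cBy: "\<And>i j. continuous_on (cball 0 1) (\<lambda>z. B i j (?y z))"
    and cFy: "\<And>i j. continuous_on (cball 0 1) (\<lambda>z. stress_grad i j (?y z))"
    by (intro sh cU cB continuous_on_stress_grad)+
  note ci = continuous_intros cUy cBy cFy c\<rho>
  have "?I (\<lambda>z. bump z ^ 3 * G (?y z) $ i) = ?I (\<lambda>z. \<Sum>j\<in>UNIV. bump z ^ 3 * B i j (?y z) $ j - bump z ^ 3 * stress_grad i j (?y z) $ j)"
  proof (intro set_lebesgue_integral_cong allI impI)
    fix z :: "real^4" assume z: "z \<in> cball 0 1"
    have "bump z ^ 3 * G (?y z) $ i = bump z ^ 3 * ((\<Sum>j\<in>UNIV. B i j (?y z) $ j) - (\<Sum>j\<in>UNIV. stress_grad i j (?y z) $ j))"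
      by (simp only: momentum[OF nz[OF z]] sum_stress_grad[OF nz[OF z]])
    then show "bump z ^ 3 * G (?y z) $ i = (\<Sum>j\<in>UNIV. bump z ^ 3 * B i j (?y z) $ j - bump z ^ 3 * stress_grad i j (?y z) $ j)"
      by (simp add: sum_subtractf sum_distrib_left right_diff_distrib)
  qed simp
  also have "\<dots> = (\<Sum>j\<in>UNIV. ?I (\<lambda>z. bump z ^ 3 * B i j (?y z) $ j) - ?I (\<lambda>z. bump z ^ 3 * stress_grad i j (?y z) $ j))"
    by (subst set_integral_sum set_integral_diff(2), (intro int ci)+)+ simp
  also have "\<dots> = (\<Sum>j\<in>UNIV. (1 / s) * ((1 / s) * ?I (\<lambda>z. d\<rho> j z $ j * U (?y z) $ i)) - (1 / s) * ?I (\<lambda>z. \<rho> z $ j * (U (?y z) $ j * U (?y z) $ i)))"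
    by (simp only: e1 e2 e3)
  finally have eq: "?I (\<lambda>z. bump z ^ 3 * G (?y z) $ i) = (\<Sum>j\<in>UNIV. (1 / s) * ((1 / s) * ?I (\<lambda>z. d\<rho> j z $ j * U (?y z) $ i)) - (1 / s) * ?I (\<lambda>z. \<rho> z $ j * (U (?y z) $ j * U (?y z) $ i)))" .
  have "\<bar>?I (\<lambda>z. bump z ^ 3 * G (?y z) $ i)\<bar> \<le> (\<Sum>j\<in>(UNIV::4 set). (1 / s) * ((1 / s) * (30 * ((vol4 + 1) * n / s ^ 4))) + (1 / s) * (6 * ((vol4 + 1) * n\<^sup>2 / s ^ 4)))"
    unfolding eq
  proof (intro order_trans[OF sum_abs] sum_mono)
    fix j
    have b: "0 \<le> bump z" "bump z \<le> 1" "0 \<le> bump z ^ 2" "bump z ^ 2 \<le> 1" for z :: "real^4"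
      by (auto intro!: power_le_one simp: bump_nonneg bump_le_1)
    have zc: "\<bar>z $ j\<bar> \<le> 1" if "z \<in> cball 0 1" for z :: "real^4"
      using component_le_norm_cart[of z j] that by simp
    have Uc: "\<bar>U x $ i\<bar> \<le> norm (U x)" for x i by (rule component_le_norm_cart)
    have s4: "(LINT z:cball 0 1|lborel. f (?y z)) \<le> c / s ^ 4"
      if "continuous_on (- {0}) f" "\<And>x. 0 \<le> f x" "(LINT x:ann (1/8) 4|lborel. f x) \<le> c" for f :: "real^4 \<Rightarrow> real" and c
    proof -
      have "(LINT z:cball 0 1|lborel. f (y + (- s) *\<^sub>R z)) \<le> (LINT x:ann (1/8) 4|lborel. f x) / \<bar>- s\<bar> ^ DIM(real^4)"
        by (rule set_integral_affine_le) (use yz s that in \<open>auto intro!: set_integrable_ann\<close>)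
      also have "\<dots> \<le> c / s ^ 4" using that(3) s by (simp add: divide_right_mono)
      finally show ?thesis by simp
    qed
    have "\<bar>?I (\<lambda>z. d\<rho> j z $ j * U (?y z) $ i)\<bar> \<le> ?I (\<lambda>z. 30 * norm (U (?y z)))"
    proof (intro set_integral_abs_le int ci)
      fix z :: "real^4" assume z: "z \<in> cball 0 1"
      have "\<bar>d\<rho> j z $ j\<bar> \<le> 6 + 24"
      proof -
        have "d\<rho> j z $ j = - (6 * bump z ^ 2) + 24 * (bump z * (z $ j * z $ j))" by (simp add: d\<rho>_def)
        moreover have "\<bar>bump z * (z $ j * z $ j)\<bar> \<le> 1 * (1 * 1)"
          unfolding abs_mult using zc[OF z] b[of z] by (intro mult_mono) auto
        ultimately show ?thesis using b[of z] by linarith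
      qed
      then show "\<bar>d\<rho> j z $ j * U (?y z) $ i\<bar> \<le> 30 * norm (U (?y z))"
        unfolding abs_mult using Uc by (intro mult_mono) auto
    qed
    also have "\<dots> = 30 * ?I (\<lambda>z. norm (U (?y z)))" by simp
    also have "\<dots> \<le> 30 * ((vol4 + 1) * n / s ^ 4)"
      by (intro mult_left_mono s4 first_integral_le n continuous_intros cU) auto
    finally have 1: "\<bar>?I (\<lambda>z. d\<rho> j z $ j * U (?y z) $ i)\<bar> \<le> 30 * ((vol4 + 1) * n / s ^ 4)" .
    have "\<bar>?I (\<lambda>z. \<rho> z $ j * (U (?y z) $ j * U (?y z) $ i))\<bar> \<le> ?I (\<lambda>z. 6 * (norm (U (?y z)))\<^sup>2)"
    proof (intro set_integral_abs_le int ci)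
      fix z :: "real^4" assume z: "z \<in> cball 0 1"
      have "\<bar>bump z ^ 2 * z $ j\<bar> \<le> 1 * 1"
        unfolding abs_mult using zc[OF z] b[of z] by (intro mult_mono) auto
      then have "\<bar>\<rho> z $ j\<bar> \<le> 6" by (simp add: \<rho>_def abs_mult)
      then show "\<bar>\<rho> z $ j * (U (?y z) $ j * U (?y z) $ i)\<bar> \<le> 6 * (norm (U (?y z)))\<^sup>2"
        unfolding abs_mult power2_eq_square using Uc by (intro mult_mono) auto
    qed
    also have "\<dots> = 6 * ?I (\<lambda>z. (norm (U (?y z)))\<^sup>2)" by simp
    also have "\<dots> \<le> 6 * ((vol4 + 1) * n\<^sup>2 / s ^ 4)"
      by (intro mult_left_mono s4 square_integral_le n continuous_intros cU) auto
    finally have 2: "\<bar>?I (\<lambda>z. \<rho> z $ j * (U (?y z) $ j * U (?y z) $ i))\<bar> \<le> 6 * ((vol4 + 1) * n\<^sup>2 / s ^ 4)" .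
    have gen: "\<bar>(1 / s) * ((1 / s) * p) - (1 / s) * q\<bar> \<le> (1 / s) * ((1 / s) * p') + (1 / s) * q'"
      if "\<bar>p\<bar> \<le> p'" "\<bar>q\<bar> \<le> q'" for p q p' q'
    proof -
      have "\<bar>(1 / s) * ((1 / s) * p)\<bar> \<le> (1 / s) * ((1 / s) * p')" "\<bar>(1 / s) * q\<bar> \<le> (1 / s) * q'"
        using that s by (simp_all add: abs_mult divide_right_mono)
      then show ?thesis by linarith
    qed
    show "\<bar>(1 / s) * ((1 / s) * ?I (\<lambda>z. d\<rho> j z $ j * U (?y z) $ i)) - (1 / s) * ?I (\<lambda>z. \<rho> z $ j * (U (?y z) $ j * U (?y z) $ i))\<bar>
       \<le> (1 / s) * ((1 / s) * (30 * ((vol4 + 1) * n / s ^ 4))) + (1 / s) * (6 * ((vol4 + 1) * n\<^sup>2 / s ^ 4))"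
      by (rule gen[OF 1 2])
  qed
  also have "\<dots> = 120 * 32 ^ 6 * ((vol4 + 1) * n) + 24 * 32 ^ 5 * ((vol4 + 1) * n\<^sup>2)"
  proof -
    \<comment> \<open>The literals are 30 * 32^6 and 6 * 32^5. Summing over four components turns 30
      into 120 and 6 into 24.\<close>
    have n1: "(1 / s) * ((1 / s) * (30 * (p / s ^ 4))) = 32212254720 * p" for p by (simp add: s_def power_divide)
    have n2: "(1 / s) * (6 * (q / s ^ 4)) = 201326592 * q" for q by (simp add: s_def power_divide)
    show ?thesis unfolding n1 n2 sum_constant card_4_UNIV by simp
  qed
  also have "\<dots> \<le> 120 * 32 ^ 6 * ((vol4 + 1) * n) + 120 * 32 ^ 6 * ((vol4 + 1) * n\<^sup>2)"
    using vol4_nonneg n by (intro add_mono mult_right_mono) auto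
  also have "\<dots> = 120 * 32 ^ 6 * (vol4 + 1) * (n + n\<^sup>2)"
    by (subst distrib_left) (simp only: mult.assoc)
  finally show ?thesis unfolding s_def .
qed

end

text \<open>The constants of small scales, large scales and mollified remainder, over the mass of
  the mollifier. The 5 in ds / s = 5 d\<sigma> / \<sigma> yields 5 * 7 = 35 from
  \<open>near_estimate\<close> and 5 * 14 / 2 = 35 from \<open>far_estimate\<close> on an interval
  of length 1/2.\<close>

definition flux_const :: real where
  "flux_const = (35 * vol1 * level_const * (vol4 + 690) + 35 * vol1 + 3360 * 32 ^ 6 * (vol4 + 1) * (vol4 + 1)) / bump_mass"

context NS4
begin

definition mollified_P :: "real ^ 4 \<Rightarrow> real" where
  "mollified_P x = (LINT z:cball 0 1|lborel. bump z ^ 3 * P (x - (1 / 32) *\<^sub>R z))"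

text \<open>Integrate the mollified gradient along the segment; adding the four components turns 120
  into 480.\<close>

lemma mollified_P_segment:
  assumes n: "0 < n" "cubic (1 / 8) 4 \<le> n ^ 3"
    and seg: "\<And>t. t \<in> {0..1} \<Longrightarrow> y + t *\<^sub>R w \<in> ann (1 / 4) (5 / 2)"
  shows "\<bar>mollified_P (y + w) - mollified_P y\<bar> \<le> 480 * 32 ^ 6 * (vol4 + 1) * (n + n\<^sup>2) * norm w"
proof -
  define s :: real where "s = 1 / 32"
  have s0: "0 \<le> s" "0 < s" "s < 1 / 8" by (auto simp: s_def)
  let ?C = "120 * 32 ^ 6 * (vol4 + 1) * (n + n\<^sup>2)"
  have C0: "0 \<le> ?C" using n vol4_nonneg by simp
  have nz: "y + t *\<^sub>R w - s *\<^sub>R z \<noteq> 0" if "t \<in> {0..1}" "z \<in> cball 0 1" for t z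
    using unit_scale_shift[OF s0(2,3) seg[OF that(1)] that(2)] ann_nonzero[of "1/8" 4] by auto
  have cGt: "continuous_on (cball 0 1 \<times> {0..1}) (\<lambda>p. G (y + snd p *\<^sub>R w - s *\<^sub>R fst p))"
  proof (rule continuous_on_compose2[OF cG, where f = "\<lambda>p. y + snd p *\<^sub>R w - s *\<^sub>R fst p"])
    show "(\<lambda>p. y + snd p *\<^sub>R w - s *\<^sub>R fst p) ` (cball 0 1 \<times> {0..1}) \<subseteq> - {0}" using nz by force
  qed (intro continuous_intros)
  have cc: "continuous_on (cball 0 1 \<times> {0..1}) (\<lambda>(z, t). bump z ^ 3 * (G (y + t *\<^sub>R w - s *\<^sub>R z) \<bullet> w))"
    unfolding case_prod_beta bump_def by (intro continuous_intros cGt)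
  have ends: "s < norm (y + w)" "s < norm y"
    using seg[of 1] seg[of 0] s0 by (auto simp: ann_def)
  have i: "set_integrable lborel (cball 0 1) (\<lambda>z. bump z ^ 3 * P (y + w - s *\<^sub>R z))"
    "set_integrable lborel (cball 0 1) (\<lambda>z. bump z ^ 3 * P (y - s *\<^sub>R z))"
    by (intro set_integrable_compact compact_cball continuous_intros continuous_on_shift[OF cP s0(1)] ends)+
  have "mollified_P (y + w) - mollified_P y = (LINT z:cball 0 1|lborel. LINT t:{0..1}|lborel. bump z ^ 3 * (G (y + t *\<^sub>R w - s *\<^sub>R z) \<bullet> w))"
    unfolding mollified_P_def s_def[symmetric] set_integral_diff(2)[OF i, symmetric]
  proof (intro set_lebesgue_integral_cong allI impI)
    fix z :: "real^4" assume z: "z \<in> cball 0 1"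
    have "(LINT t:{0..1}|lborel. G (y - s *\<^sub>R z + t *\<^sub>R w) \<bullet> w) = P (y - s *\<^sub>R z + w) - P (y - s *\<^sub>R z)"
    proof (rule integral_segment)
      have e: "y - s *\<^sub>R z + t *\<^sub>R w = y + t *\<^sub>R w - s *\<^sub>R z" for t by simp
      show "GDERIV P (y - s *\<^sub>R z + t *\<^sub>R w) :> G (y - s *\<^sub>R z + t *\<^sub>R w)" if "t \<in> {0..1}" for t
        unfolding e using nz[OF that z] by (rule dP)
      have "continuous_on {0..1} (\<lambda>t. (\<lambda>p. G (y + snd p *\<^sub>R w - s *\<^sub>R fst p)) (z, t))"
        by (rule continuous_on_compose2[OF cGt]) (use z in \<open>auto intro!: continuous_intros\<close>)
      then show "continuous_on {0..1} (\<lambda>t. G (y - s *\<^sub>R z + t *\<^sub>R w))" unfolding e by simp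
    qed
    then have "(LINT t:{0..1}|lborel. G (y + t *\<^sub>R w - s *\<^sub>R z) \<bullet> w) = P (y + w - s *\<^sub>R z) - P (y - s *\<^sub>R z)"
      by (simp add: algebra_simps)
    then show "bump z ^ 3 * P (y + w - s *\<^sub>R z) - bump z ^ 3 * P (y - s *\<^sub>R z) =
      (LINT t:{0..1}|lborel. bump z ^ 3 * (G (y + t *\<^sub>R w - s *\<^sub>R z) \<bullet> w))"
      by (simp only: set_integral_mult_right right_diff_distrib)
  qed simp
  also have "\<dots> = (LINT t:{0..1}|lborel. LINT z:cball 0 1|lborel. bump z ^ 3 * (G (y + t *\<^sub>R w - s *\<^sub>R z) \<bullet> w))"
    by (rule Fubini_compact(1)[OF compact_cball compact_Icc cc])
  finally have eq: "mollified_P (y + w) - mollified_P y = (LINT t:{0..1}|lborel. LINT z:cball 0 1|lborel. bump z ^ 3 * (G (y + t *\<^sub>R w - s *\<^sub>R z) \<bullet> w))" .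
  have "\<bar>mollified_P (y + w) - mollified_P y\<bar> \<le> (LINT t:{0..1::real}|lborel. 4 * ?C * norm w)"
    unfolding eq
  proof (rule set_integral_abs_le)
    show "set_integrable lborel {0..1} (\<lambda>t. LINT z:cball 0 1|lborel. bump z ^ 3 * (G (y + t *\<^sub>R w - s *\<^sub>R z) \<bullet> w))"
      by (rule Fubini_compact(3)[OF compact_cball compact_Icc cc])
    show "set_integrable lborel {0..1::real} (\<lambda>t. 4 * ?C * norm w)"
      by (intro set_integrable_compact compact_Icc continuous_intros)
    fix t :: real assume t: "t \<in> {0..1}"
    have st: "s < norm (y + t *\<^sub>R w)" using seg[OF t] s0 by (auto simp: ann_def)
    have "(LINT z:cball 0 1|lborel. bump z ^ 3 * (G (y + t *\<^sub>R w - s *\<^sub>R z) \<bullet> w)) =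
        (LINT z:cball 0 1|lborel. \<Sum>i\<in>UNIV. w $ i * (bump z ^ 3 * G (y + t *\<^sub>R w - s *\<^sub>R z) $ i))"
      by (simp add: inner_vec_def sum_distrib_left mult_ac)
    also have "\<dots> = (\<Sum>i\<in>UNIV. w $ i * (LINT z:cball 0 1|lborel. bump z ^ 3 * G (y + t *\<^sub>R w - s *\<^sub>R z) $ i))"
      by (subst set_integral_sum)
        (auto intro!: set_integrable_compact continuous_intros continuous_on_shift[OF cG s0(1) st])
    finally have eq2: "(LINT z:cball 0 1|lborel. bump z ^ 3 * (G (y + t *\<^sub>R w - s *\<^sub>R z) \<bullet> w)) =
      (\<Sum>i\<in>UNIV. w $ i * (LINT z:cball 0 1|lborel. bump z ^ 3 * G (y + t *\<^sub>R w - s *\<^sub>R z) $ i))" .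
    have "\<bar>LINT z:cball 0 1|lborel. bump z ^ 3 * (G (y + t *\<^sub>R w - s *\<^sub>R z) \<bullet> w)\<bar> \<le> (\<Sum>i\<in>(UNIV::4 set). norm w * ?C)"
      unfolding eq2
    proof (intro order_trans[OF sum_abs] sum_mono)
      fix i :: 4
      show "\<bar>w $ i * (LINT z:cball 0 1|lborel. bump z ^ 3 * G (y + t *\<^sub>R w - s *\<^sub>R z) $ i)\<bar> \<le> norm w * ?C"
        unfolding abs_mult s_def
        by (intro mult_mono component_le_norm_cart mollified_gradient n seg t) auto
    qed
    then show "\<bar>LINT z:cball 0 1|lborel. bump z ^ 3 * (G (y + t *\<^sub>R w - s *\<^sub>R z) \<bullet> w)\<bar> \<le> 4 * ?C * norm w"
      by (simp add: mult_ac)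
  qed
  also have "\<dots> = 4 * ?C * norm w" by (simp add: set_lebesgue_integral_def)
  finally show ?thesis by (simp add: algebra_simps)
qed

text \<open>Both points are joined to a common unit vector orthogonal to them. Each leg has length
  at most 5/2 + 1 = 7/2, and 2 * 480 * 7/2 = 3360.\<close>

lemma mollified_P_oscillation:
  assumes n: "0 < n" "cubic (1 / 8) 4 \<le> n ^ 3" and x: "x \<in> ann (1 / 2) (5 / 2)" "y \<in> ann (1 / 2) (5 / 2)"
  shows "\<bar>mollified_P x - mollified_P y\<bar> \<le> 3360 * 32 ^ 6 * (vol4 + 1) * (n + n\<^sup>2)"
proof -
  obtain e where e: "norm e = 1" "e \<bullet> x = 0" "e \<bullet> y = 0" by (rule orthogonal_unit)
  have C: "0 \<le> 480 * 32 ^ 6 * (vol4 + 1) * (n + n\<^sup>2)" using n vol4_nonneg by simp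
  have b: "\<bar>mollified_P u - mollified_P e\<bar> \<le> 480 * 32 ^ 6 * (vol4 + 1) * (n + n\<^sup>2) * (7 / 2)" if u: "u \<in> ann (1 / 2) (5 / 2)" "e \<bullet> u = 0" for u
  proof -
    have "\<bar>mollified_P (e + (u - e)) - mollified_P e\<bar> \<le> 480 * 32 ^ 6 * (vol4 + 1) * (n + n\<^sup>2) * norm (u - e)"
      by (intro mollified_P_segment n segment_norm e) (use u in \<open>auto simp: ann_def\<close>)
    also have "\<dots> \<le> 480 * 32 ^ 6 * (vol4 + 1) * (n + n\<^sup>2) * (7 / 2)"
      using norm_triangle_ineq4[of u e] u e C by (intro mult_left_mono) (auto simp: ann_def)
    finally show ?thesis by simp
  qed
  have "3360 * 32 ^ 6 * (vol4 + 1) * (n + n\<^sup>2) = 2 * (480 * 32 ^ 6 * (vol4 + 1) * (n + n\<^sup>2) * (7 / 2))"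
    by simp
  then show ?thesis
    using b[OF x(1) e(2)] b[OF x(2) e(3)] abs_triangle_ineq4[of "mollified_P x - mollified_P e" "mollified_P y - mollified_P e"] by linarith
qed

text \<open>The fundamental theorem for the path \<open>x - s *\<^sub>R z\<close> from s = 0 to s =
  1/32, written in the variable \<sigma> with s = \<sigma>^5. The upper limit 1/2 corresponds to the
  scale of \<open>mollified_P\<close>.\<close>

lemma pressure_difference:
  assumes x: "1 / 32 < norm x" and z: "z \<in> cball 0 1"
  shows "P x - P (x - (1 / 32) *\<^sub>R z) = (LINT \<sigma>:{0..1/2}|lborel. 5 * \<sigma> ^ 4 * (z \<bullet> G (x - \<sigma> ^ 5 *\<^sub>R z)))"
proof -
  have nz: "x - \<sigma> ^ 5 *\<^sub>R z \<noteq> 0" if "\<sigma> \<in> {0..1/2}" for \<sigma> :: real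
  proof
    assume "x - \<sigma> ^ 5 *\<^sub>R z = 0"
    then have "norm x = \<sigma> ^ 5 * norm z" using that by simp
    also have "\<dots> \<le> (1 / 2) ^ 5 * 1" using that z by (intro mult_mono power_mono) auto
    finally show False using x by (simp add: power_divide)
  qed
  have cG': "continuous_on {0..1/2} (\<lambda>\<sigma>. G (x - \<sigma> ^ 5 *\<^sub>R z))"
    by (rule continuous_on_compose2[OF cG, where f = "\<lambda>\<sigma>. x - \<sigma> ^ 5 *\<^sub>R z"]) (use nz in \<open>force intro!: continuous_intros\<close>)+
  have "((\<lambda>\<sigma>. - P (x - \<sigma> ^ 5 *\<^sub>R z)) has_vector_derivative (5 * \<sigma> ^ 4 * (z \<bullet> G (x - \<sigma> ^ 5 *\<^sub>R z)))) (at \<sigma> within {0..1/2})"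
    if s: "0 \<le> \<sigma>" "\<sigma> \<le> 1 / 2" for \<sigma> :: real
  proof -
    have 1: "((\<lambda>\<sigma>. x - \<sigma> ^ 5 *\<^sub>R z) has_derivative (\<lambda>h. - (h * (5 * \<sigma> ^ 4)) *\<^sub>R z)) (at \<sigma> within {0..1/2})"
      by (auto intro!: derivative_eq_intros)
    have "(P has_derivative (\<lambda>h. h \<bullet> G (x - \<sigma> ^ 5 *\<^sub>R z))) (at (x - \<sigma> ^ 5 *\<^sub>R z))"
      using dP[OF nz] s by (simp add: gderiv_def)
    from has_derivative_minus[OF has_derivative_compose[OF 1 this]]
    show ?thesis by (simp add: has_vector_derivative_def mult_ac)
  qed
  from integral_FTC_atLeastAtMost[OF _ this] cG'
  show ?thesis by (simp add: set_lebesgue_integral_def continuous_intros power_divide)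
qed

text \<open>Averaging \<open>pressure_difference\<close> against the mollifier writes
  \<open>bump_mass\<close> times \<open>P\<close> as \<open>mollified_P\<close> plus an integral
  over \<sigma>, whose integrand \<open>pressure_average\<close> expresses through \<open>U\<close>
  alone. Paired with \<open>g\<close>, it is bounded by \<open>near_estimate\<close> for \<sigma> up
  to \<open>d\<close> and by \<open>far_estimate\<close> beyond. The free parameter \<open>d\<close>
  makes the coefficient of the energy as small as desired. The remainder is controlled by its
  oscillation because \<open>g\<close> has mean zero.\<close>

lemma pressure_flux:
  assumes ab: "1 / 2 \<le> a" "b \<le> 5 / 2" and d: "0 < d" "d \<le> 1 / 4" and n: "0 < n" "cubic (1 / 8) 4 \<le> n ^ 3"
    and g: "continuous_on (ann a b) g" "\<And>x. x \<in> ann a b \<Longrightarrow> \<bar>g x\<bar> \<le> K * norm (U x)" and K: "0 \<le> K"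
    and mean: "(LINT x:ann a b|lborel. g x) = 0"
  shows "\<bar>LINT x:ann a b|lborel. g x * P x\<bar> \<le>
    flux_const * K * (d * n * (energy (a - 2 * d ^ 3) (b + 2 * d ^ 3) + n\<^sup>2) + n ^ 3 / d + n\<^sup>2 + n ^ 3)"
proof -
  let ?D = "ann a b" and ?C = "cball (0 :: real ^ 4) 1"
  let ?energy = "energy (a - 2 * d ^ 3) (b + 2 * d ^ 3)"
  have a0: "0 < a" using ab by simp
  have d3: "0 < d ^ 3" "2 * d ^ 3 \<le> 1 / 32"
    using d power_mono[of d "1/4" 3] by (auto simp: power_divide)
  have E0: "0 \<le> ?energy" by (rule energy_nonneg)
  have xD: "1 / 32 < norm x" if "x \<in> ?D" for x using that ab by (auto simp: ann_def)
  define h where "h p \<sigma> = g (fst p) * (bump (snd p) ^ 3 * (5 * \<sigma> ^ 4 * (snd p \<bullet> G (fst p - \<sigma> ^ 5 *\<^sub>R snd p))))"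
    for p :: "(real^4) \<times> (real^4)" and \<sigma> :: real
  have s5: "\<sigma> ^ 5 \<le> 1 / 32" "0 \<le> \<sigma> ^ 5" if "\<sigma> \<in> {0..1/2}" for \<sigma> :: real
    using that power_mono[of \<sigma> "1/2" 5] by (auto simp: power_divide)
  have cGp: "continuous_on ((?D \<times> ?C) \<times> {0..1/2}) (\<lambda>q. G (fst (fst q) - snd q ^ 5 *\<^sub>R snd (fst q)))"
  proof (rule continuous_on_compose2[OF cG, where f = "\<lambda>q. fst (fst q) - snd q ^ 5 *\<^sub>R snd (fst q)"])
    have "x - \<sigma> ^ 5 *\<^sub>R z \<noteq> 0" if "x \<in> ?D" "z \<in> ?C" "\<sigma> \<in> {0..1/2}" for x z \<sigma>
      using ann_shift_scaled[OF that(1,2) s5(2)[OF that(3)]] s5[OF that(3)] ab by (auto simp: ann_def)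
    then show "(\<lambda>q. fst (fst q) - snd q ^ 5 *\<^sub>R snd (fst q)) ` ((?D \<times> ?C) \<times> {0..1/2}) \<subseteq> - {0}" by force
  qed (intro continuous_intros)
  have cgp: "continuous_on ((?D \<times> ?C) \<times> {0..1/2}) (\<lambda>q. g (fst (fst q)))"
    by (rule continuous_on_compose2[OF g(1)]) (auto intro!: continuous_intros)
  have ch: "continuous_on ((?D \<times> ?C) \<times> {0..1/2}) (\<lambda>(p, \<sigma>). h p \<sigma>)"
    unfolding h_def case_prod_beta bump_def by (intro continuous_intros cGp cgp)
  have ch\<sigma>: "continuous_on (?D \<times> ?C) (\<lambda>(x, z). h (x, z) \<sigma>)" if "\<sigma> \<in> {0..1/2}" for \<sigma>
  proof -
    have "continuous_on (?D \<times> ?C) (\<lambda>p. (\<lambda>(p, \<sigma>). h p \<sigma>) (p, \<sigma>))"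
      by (rule continuous_on_compose2[OF ch]) (use that in \<open>auto intro!: continuous_intros\<close>)
    then show ?thesis by (simp add: case_prod_beta)
  qed
  define k where "k x z = g x * (bump z ^ 3 * (P x - P (x - (1 / 32) *\<^sub>R z)))" for x z
  have kh: "k x z = (LINT \<sigma>:{0..1/2}|lborel. h (x, z) \<sigma>)" if "x \<in> ?D" "z \<in> ?C" for x z
    unfolding k_def h_def by (simp add: pressure_difference[OF xD[OF that(1)] that(2)])
  have cPp: "continuous_on (?D \<times> ?C) (\<lambda>p. P (fst p - (1 / 32) *\<^sub>R snd p))" "continuous_on (?D \<times> ?C) (\<lambda>p. P (fst p))"
  proof -
    show "continuous_on (?D \<times> ?C) (\<lambda>p. P (fst p - (1 / 32) *\<^sub>R snd p))"
    proof (rule continuous_on_compose2[OF cP, where f = "\<lambda>p. fst p - (1 / 32) *\<^sub>R snd p"])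
      have "x - (1 / 32) *\<^sub>R z \<noteq> 0" if "x \<in> ?D" "z \<in> ?C" for x z :: "real^4"
        using ann_shift_scaled[OF that, of "1/32"] ab by (auto simp: ann_def)
      then show "(\<lambda>p. fst p - (1 / 32) *\<^sub>R snd p) ` (?D \<times> ?C) \<subseteq> - {0}" by force
    qed (intro continuous_intros)
    show "continuous_on (?D \<times> ?C) (\<lambda>p. P (fst p))"
      by (intro continuous_on_fst_factor continuous_on_subset[OF cP ann_nonzero[OF a0]])
  qed
  have ck: "continuous_on (?D \<times> ?C) (\<lambda>(x, z). k x z)"
    unfolding k_def case_prod_beta bump_def by (intro continuous_intros cPp continuous_on_fst_factor g)
  have cDC: "compact (?D \<times> ?C)" by (intro compact_Times compact_ann compact_cball)
  define \<Psi> where "\<Psi> \<sigma> = (LINT p:(?D \<times> ?C)|lborel. h p \<sigma>)" for \<sigma>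
  have "(LINT x:?D|lborel. LINT z:?C|lborel. k x z) = (LINT p:(?D \<times> ?C)|lborel. k (fst p) (snd p))"
    by (rule Fubini_compact_pair[OF compact_ann compact_cball ck, symmetric])
  also have "\<dots> = (LINT p:(?D \<times> ?C)|lborel. LINT \<sigma>:{0..1/2}|lborel. h p \<sigma>)"
    by (intro set_lebesgue_integral_cong) (use cDC in \<open>auto simp: kh intro: borel_compact\<close>)
  also have "\<dots> = (LINT \<sigma>:{0..1/2}|lborel. \<Psi> \<sigma>)"
    unfolding \<Psi>_def by (rule Fubini_compact(1)[OF cDC compact_Icc ch])
  finally have 1: "(LINT x:?D|lborel. LINT z:?C|lborel. k x z) = (LINT \<sigma>:{0..1/2}|lborel. \<Psi> \<sigma>)" .
  have \<Psi>i: "set_integrable lborel {0..1/2} \<Psi>"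
    unfolding \<Psi>_def by (rule Fubini_compact(3)[OF cDC compact_Icc ch])
  let ?Q = "\<lambda>\<sigma>. LINT x:?D|lborel. g x * (LINT z:?C|lborel. quad_kernel z (U (x - \<sigma> ^ 5 *\<^sub>R z)))"
  \<comment> \<open>The factor 5 \<sigma>^4 of the substitution meets 1 / \<sigma>^5 from
    \<open>pressure_average\<close>. The remaining 1 / \<sigma> is what the gain in
    \<open>near_estimate\<close> cancels.\<close>
  have \<Psi>: "\<Psi> \<sigma> = - (5 / \<sigma>) * ?Q \<sigma>" if s: "\<sigma> \<in> {0..1/2}" "0 < \<sigma>" for \<sigma>
  proof -
    have "\<Psi> \<sigma> = (LINT x:?D|lborel. LINT z:?C|lborel. h (x, z) \<sigma>)"
      using Fubini_compact_pair[OF compact_ann compact_cball ch\<sigma>[OF s(1)]] by (simp add: \<Psi>_def)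
    also have "\<dots> = (LINT x:?D|lborel. - (5 / \<sigma>) * (g x * (LINT z:?C|lborel. quad_kernel z (U (x - \<sigma> ^ 5 *\<^sub>R z)))))"
    proof (intro set_lebesgue_integral_cong allI impI)
      fix x assume x: "x \<in> ?D"
      have "(LINT z:?C|lborel. h (x, z) \<sigma>) = g x * (5 * \<sigma> ^ 4) * (LINT z:?C|lborel. bump z ^ 3 * (z \<bullet> G (x - \<sigma> ^ 5 *\<^sub>R z)))"
        unfolding set_integral_mult_right[symmetric] by (simp add: h_def mult_ac)
      also have "\<dots> = g x * (5 * \<sigma> ^ 4) * (- (1 / \<sigma> ^ 5) * (LINT z:?C|lborel. quad_kernel z (U (x - \<sigma> ^ 5 *\<^sub>R z))))"
        using s5[OF s(1)] xD[OF x] s by (subst pressure_average) auto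
      also have "\<dots> = - (5 / \<sigma>) * (g x * (LINT z:?C|lborel. quad_kernel z (U (x - \<sigma> ^ 5 *\<^sub>R z))))"
        using s by (simp add: field_simps power_eq_if)
      finally show "(LINT z:?C|lborel. h (x, z) \<sigma>) = - (5 / \<sigma>) * (g x * (LINT z:?C|lborel. quad_kernel z (U (x - \<sigma> ^ 5 *\<^sub>R z))))" .
    qed simp
    finally show ?thesis by (simp only: set_integral_mult_right)
  qed
  define c1 where "c1 = 35 * vol1 * level_const * (vol4 + 690) * K * n * (?energy + n\<^sup>2)"
  define c2 where "c2 = 70 * vol1 * K * n ^ 3 / d"
  have c0': "0 \<le> level_const" using level_const by simp
  have V1': "0 \<le> vol1" using vol1_pos by simp
  have c12: "0 \<le> c1" "0 \<le> c2" unfolding c1_def c2_def using c0' V1' K n d E0 vol4_nonneg by auto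
  have "\<bar>LINT \<sigma>:{0..1/2}|lborel. \<Psi> \<sigma>\<bar> \<le> c1 * d + c2 * (1 / 2)"
  proof (rule set_integral_split_bound[OF \<Psi>i _ _ c12])
    fix \<sigma> :: real assume s: "0 \<le> \<sigma>" "\<sigma> \<le> d"
    show "\<bar>\<Psi> \<sigma>\<bar> \<le> c1"
    proof (cases "\<sigma> = 0")
      case True
      then have "\<Psi> \<sigma> = 0" by (simp add: \<Psi>_def h_def)
      then show ?thesis using c12 by simp
    next
      case False
      then have sp: "0 < \<sigma>" using s by simp
      have s3: "2 * \<sigma> ^ 3 \<le> 2 * d ^ 3" using s by (simp add: power_mono)
      have N: "cubic (a - 2 * \<sigma> ^ 3) (b + 2 * \<sigma> ^ 3) \<le> n ^ 3"
        by (rule order_trans[OF cubic_mono n(2)]) (use ab s3 d3 in linarith)+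
      have "\<bar>?Q \<sigma>\<bar> \<le> 7 * vol1 * level_const * (vol4 + 690) * K * n * \<sigma> * (energy (a - 2 * \<sigma> ^ 3) (b + 2 * \<sigma> ^ 3) + n\<^sup>2)"
        by (rule near_estimate[OF sp _ _ _ n(1) N g K]) (use ab s3 d3 d s in linarith)+
      also have "\<dots> \<le> 7 * vol1 * level_const * (vol4 + 690) * K * n * \<sigma> * (?energy + n\<^sup>2)"
      proof -
        have "energy (a - 2 * \<sigma> ^ 3) (b + 2 * \<sigma> ^ 3) \<le> ?energy"
          by (rule energy_mono) (use ab d3 s3 in linarith)+
        then show ?thesis
          using c0' V1' K n vol4_nonneg sp by (intro mult_left_mono add_mono) auto
      qed
      finally have "(5 / \<sigma>) * \<bar>?Q \<sigma>\<bar> \<le> (5 / \<sigma>) * (7 * vol1 * level_const * (vol4 + 690) * K * n * \<sigma> * (?energy + n\<^sup>2))"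
        using sp by (intro mult_left_mono) auto
      also have "\<dots> = c1" using sp by (simp add: c1_def)
      finally show ?thesis using \<Psi>[of \<sigma>] s sp d by (simp add: abs_mult)
    qed
  next
    fix \<sigma> :: real assume s: "d < \<sigma>" "\<sigma> \<le> 1 / 2"
    then have sp: "0 < \<sigma>" using d by simp
    have ss: "\<sigma> ^ 5 \<le> 1 / 32" "0 \<le> \<sigma> ^ 5" using s5[of \<sigma>] s sp by auto
    have "cubic (a - \<sigma> ^ 5) (b + \<sigma> ^ 5) \<le> n ^ 3"
      by (rule order_trans[OF cubic_mono n(2)]) (use ab ss in linarith)+
    then have "\<bar>?Q \<sigma>\<bar> \<le> 14 * vol1 * K * n ^ 3"
      using ab ss by (intro far_estimate g K; linarith)
    then have "(5 / \<sigma>) * \<bar>?Q \<sigma>\<bar> \<le> (5 / \<sigma>) * (14 * vol1 * K * n ^ 3)" using sp by (intro mult_left_mono) auto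
    also have "\<dots> \<le> (5 / d) * (14 * vol1 * K * n ^ 3)"
      using s d V1' K n by (intro mult_right_mono divide_left_mono) auto
    also have "\<dots> = c2" by (simp add: c2_def)
    finally show "\<bar>\<Psi> \<sigma>\<bar> \<le> c2" using \<Psi>[of \<sigma>] s sp by (simp add: abs_mult)
  qed (use d in auto)
  with 1 have 2: "\<bar>LINT x:?D|lborel. LINT z:?C|lborel. k x z\<bar> \<le> c1 * d + c2 / 2" by simp
  have cPd: "(LINT z:?C|lborel. k x z) = bump_mass * (g x * P x) - g x * mollified_P x" if x: "x \<in> ?D" for x
  proof -
    have i: "set_integrable lborel ?C (\<lambda>z. g x * P x * bump z ^ 3)"
      "set_integrable lborel ?C (\<lambda>z. g x * (bump z ^ 3 * P (x - (1 / 32) *\<^sub>R z)))"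
      by (intro set_integrable_compact compact_cball continuous_intros continuous_on_shift[OF cP] xD[OF x]; simp)+
    have "(LINT z:?C|lborel. k x z) = (LINT z:?C|lborel. g x * P x * bump z ^ 3 - g x * (bump z ^ 3 * P (x - (1 / 32) *\<^sub>R z)))"
      by (simp add: k_def algebra_simps)
    also have "\<dots> = bump_mass * (g x * P x) - g x * mollified_P x"
      by (simp only: set_integral_diff(2)[OF i] set_integral_mult_right) (simp add: bump_mass_def mollified_P_def)
    finally show ?thesis .
  qed
  have igP: "set_integrable lborel ?D (\<lambda>x. g x * P x)" and ig: "set_integrable lborel ?D g"
    by (intro set_integrable_compact compact_ann continuous_intros g continuous_on_subset[OF cP ann_nonzero[OF a0]])+
  have igPd: "set_integrable lborel ?D (\<lambda>x. g x * mollified_P x)"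
  proof -
    have "set_integrable lborel ?D (\<lambda>x. bump_mass * (g x * P x) - (LINT z:?C|lborel. k x z))"
      by (intro set_integral_diff(1) set_integrable_mult_right igP Fubini_compact(2)[OF compact_ann compact_cball ck])
    then show ?thesis by (rule set_integrable_cong[THEN iffD1, rotated -1]) (auto simp: cPd)
  qed
  \<comment> \<open>An arbitrary reference point: by the mean-zero condition the value of
    \<open>mollified_P\<close> there can be subtracted.\<close>
  define x0 :: "real^4" where "x0 = axis 1 1"
  have x0: "x0 \<in> ann (1/2) (5/2)" by (simp add: x0_def ann_def)
  let ?o = "3360 * 32 ^ 6 * (vol4 + 1) * (n + n\<^sup>2)"
  have o0: "0 \<le> ?o" using vol4_nonneg n by simp
  have 3: "\<bar>LINT x:?D|lborel. g x * mollified_P x\<bar> \<le> ?o * K * ((vol4 + 1) * n)"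
  proof -
    have eq: "(LINT x:?D|lborel. g x * mollified_P x) = (LINT x:?D|lborel. g x * mollified_P x - g x * mollified_P x0)"
      using mean by (simp add: set_integral_diff(2)[OF igPd set_integrable_mult_left[OF ig]])
    have "\<bar>LINT x:?D|lborel. g x * mollified_P x\<bar> \<le> (LINT x:?D|lborel. ?o * K * norm (U x))"
      unfolding eq
    proof (rule set_integral_abs_le)
      show "set_integrable lborel ?D (\<lambda>x. g x * mollified_P x - g x * mollified_P x0)"
        by (intro set_integral_diff(1) igPd set_integrable_mult_left ig)
      show "set_integrable lborel ?D (\<lambda>x. ?o * K * norm (U x))"
        by (intro set_integrable_mult_right set_integrable_ann a0 continuous_intros cU)
      fix x assume x: "x \<in> ?D"
      then have "\<bar>mollified_P x - mollified_P x0\<bar> \<le> ?o"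
        using ann_mono[OF ab] by (intro mollified_P_oscillation n x0) auto
      then have "\<bar>g x\<bar> * \<bar>mollified_P x - mollified_P x0\<bar> \<le> (K * norm (U x)) * ?o"
        using g(2)[OF x] K by (intro mult_mono) auto
      then show "\<bar>g x * mollified_P x - g x * mollified_P x0\<bar> \<le> ?o * K * norm (U x)"
        by (simp add: abs_mult mult_ac flip: right_diff_distrib)
    qed
    also have "\<dots> = ?o * K * (LINT x:?D|lborel. norm (U x))" by simp
    also have "\<dots> \<le> ?o * K * ((vol4 + 1) * n)"
    proof (intro mult_left_mono first_integral_le a0 n(1))
      show "cubic a b \<le> n ^ 3" by (rule order_trans[OF cubic_mono n(2)]) (use ab in auto)
    qed (use ab o0 K in auto)
    finally show ?thesis .
  qed
  have "bump_mass * (LINT x:?D|lborel. g x * P x) = (LINT x:?D|lborel. LINT z:?C|lborel. k x z) + (LINT x:?D|lborel. g x * mollified_P x)"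
  proof -
    have "(LINT x:?D|lborel. LINT z:?C|lborel. k x z) = (LINT x:?D|lborel. bump_mass * (g x * P x) - g x * mollified_P x)"
      by (intro set_lebesgue_integral_cong) (auto simp: cPd)
    also have "\<dots> = bump_mass * (LINT x:?D|lborel. g x * P x) - (LINT x:?D|lborel. g x * mollified_P x)"
      by (simp only: set_integral_diff(2)[OF set_integrable_mult_right[OF igP] igPd] set_integral_mult_right)
    finally show ?thesis by simp
  qed
  then have "bump_mass * \<bar>LINT x:?D|lborel. g x * P x\<bar> = \<bar>(LINT x:?D|lborel. LINT z:?C|lborel. k x z) + (LINT x:?D|lborel. g x * mollified_P x)\<bar>"
    using bump_mass_pos by (metis abs_mult abs_of_pos)
  also have "\<dots> \<le> c1 * d + c2 / 2 + ?o * K * ((vol4 + 1) * n)" using 2 3 by linarith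
  also have "\<dots> = K * ((35 * vol1 * level_const * (vol4 + 690)) * (d * n * (?energy + n\<^sup>2)) + (35 * vol1) * (n ^ 3 / d)
       + (3360 * 32 ^ 6 * (vol4 + 1) * (vol4 + 1)) * (n\<^sup>2 + n ^ 3))"
    by (simp add: c1_def c2_def power2_eq_square power3_eq_cube algebra_simps)
  also have "\<dots> \<le> K * ((flux_const * bump_mass) * (d * n * (?energy + n\<^sup>2)) + (flux_const * bump_mass) * (n ^ 3 / d) + (flux_const * bump_mass) * (n\<^sup>2 + n ^ 3))"
  proof -
    have f: "flux_const * bump_mass = 35 * vol1 * level_const * (vol4 + 690) + 35 * vol1 + 3360 * 32 ^ 6 * (vol4 + 1) * (vol4 + 1)"
      using bump_mass_pos by (simp add: flux_const_def)
    have nn: "0 \<le> 35 * vol1 * level_const * (vol4 + 690)" "0 \<le> 35 * vol1" "0 \<le> 3360 * 32 ^ 6 * (vol4 + 1) * (vol4 + 1)"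
      using V1' c0' vol4_nonneg by auto
    show ?thesis unfolding f
      by (intro mult_left_mono add_mono mult_right_mono) (use nn n d E0 K in auto)
  qed
  finally have "bump_mass * \<bar>LINT x:?D|lborel. g x * P x\<bar> \<le> bump_mass * (flux_const * K * (d * n * (?energy + n\<^sup>2) + n ^ 3 / d + n\<^sup>2 + n ^ 3))"
    by (simp add: algebra_simps)
  then show ?thesis using bump_mass_pos by simp
qed

end

section \<open>Energy and Hardy identities with radial cutoffs\<close>

lemma GDERIV_sum:
  assumes "\<And>i. i \<in> I \<Longrightarrow> GDERIV (f i) x :> D i"
  shows "GDERIV (\<lambda>x. \<Sum>i\<in>I. f i x) x :> (\<Sum>i\<in>I. D i)"
  using has_derivative_sum[of I f "\<lambda>i h. h \<bullet> D i" "at x"] assms by (simp add: gderiv_def inner_sum_right)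

lemma GDERIV_radial:
  assumes "DERIV \<Theta> (x \<bullet> x) :> d"
  shows "GDERIV (\<lambda>x. \<Theta> (x \<bullet> x)) x :> (2 * d) *\<^sub>R x"
  by (rule GDERIV_subst[OF GDERIV_DERIV_compose[OF GDERIV_inner_self assms]]) simp

text \<open>Cutoffs are functions of the squared norm, so that they are differentiated without
  square roots. The interval from \<alpha>^2 to \<beta>^2 therefore corresponds to the annulus with
  radii \<alpha> and \<beta>.\<close>

locale radial_cutoff =
  fixes \<Theta> \<Theta>' \<Theta>'' :: "real \<Rightarrow> real" and \<alpha> \<beta> :: real
  assumes d1: "\<And>r. DERIV \<Theta> r :> \<Theta>' r" and d2: "\<And>r. DERIV \<Theta>' r :> \<Theta>'' r" and c2: "continuous_on UNIV \<Theta>''"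
    and \<alpha>: "0 < \<alpha>" and supp: "\<And>r. r \<notin> {\<alpha>\<^sup>2..\<beta>\<^sup>2} \<Longrightarrow> \<Theta> r = 0" and supp': "\<And>r. r \<notin> {\<alpha>\<^sup>2..\<beta>\<^sup>2} \<Longrightarrow> \<Theta>' r = 0"
    and \<beta>: "0 \<le> \<beta>"
begin

lemma continuous_cutoff: "continuous_on S \<Theta>" and continuous_cutoff_deriv: "continuous_on S \<Theta>'"
  using d1 d2 by (auto intro!: continuous_at_imp_continuous_on DERIV_isCont)

lemma radial_continuous:
  "continuous_on S (\<lambda>x::'a::real_inner. \<Theta> (x \<bullet> x))" "continuous_on S (\<lambda>x::'a. \<Theta>' (x \<bullet> x))" "continuous_on S (\<lambda>x::'a. \<Theta>'' (x \<bullet> x))"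
  by (auto intro!: continuous_on_compose2[OF continuous_cutoff[of UNIV]] continuous_on_compose2[OF continuous_cutoff_deriv[of UNIV]] continuous_on_compose2[OF c2] continuous_intros)

lemma outside: "x \<notin> ann \<alpha> \<beta> \<Longrightarrow> \<Theta> (x \<bullet> x) = 0 \<and> \<Theta>' (x \<bullet> x) = 0"
proof -
  assume "x \<notin> ann \<alpha> \<beta>"
  then have "x \<bullet> x \<notin> {\<alpha>\<^sup>2..\<beta>\<^sup>2}"
    using \<alpha> \<beta> by (auto simp: ann_def dot_square_norm power_mono_iff abs_le_square_iff[symmetric])
  then show ?thesis using supp supp' by blast
qed

end

locale NS4_cutoff = NS4 + radial_cutoff
begin

text \<open>\<open>W\<close> is the gradient of the kinetic energy \<open>q\<close>, and
  \<open>g\<close> is \<open>U\<close> paired with the gradient of the cutoff.\<close>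

abbreviation "D \<equiv> ann \<alpha> \<beta>"
abbreviation "q x \<equiv> (U x \<bullet> U x) / 2"
abbreviation "e x \<equiv> (\<Sum>i\<in>UNIV. A i x \<bullet> A i x)"
abbreviation "W x \<equiv> (\<Sum>i\<in>UNIV. U x $ i *\<^sub>R A i x)"
abbreviation "g x \<equiv> 2 * \<Theta>' (x \<bullet> x) * (x \<bullet> U x)"

lemma GDERIV_q: "x \<noteq> 0 \<Longrightarrow> GDERIV (\<lambda>x. q x) x :> W x"
proof -
  assume x: "x \<noteq> 0"
  have "GDERIV (\<lambda>x. (1 / 2) * (\<Sum>i\<in>UNIV. U x $ i * U x $ i)) x :> (1 / 2) *\<^sub>R (\<Sum>i\<in>UNIV. U x $ i *\<^sub>R A i x + U x $ i *\<^sub>R A i x)"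
    by (intro GDERIV_cmult GDERIV_sum GDERIV_mult dU x)
  then show ?thesis
    by (simp add: inner_vec_def scaleR_sum_right flip: scaleR_2)
qed

lemma GDERIV_W: "x \<noteq> 0 \<Longrightarrow> GDERIV (\<lambda>x. W x $ j) x :> (\<Sum>i\<in>UNIV. U x $ i *\<^sub>R B i j x + A i x $ j *\<^sub>R A i x)"
  unfolding sum_component vector_scaleR_component real_scaleR_def
  by (intro GDERIV_sum GDERIV_mult dU dA)

lemma divergence_theorem:
  assumes V: "\<And>j x. x \<noteq> 0 \<Longrightarrow> GDERIV (V j) x :> dV j x" and c: "\<And>j. continuous_on (- {0}) (dV j)"
    and z: "\<And>j x. x \<notin> D \<Longrightarrow> V j x = 0"
  shows "(LINT x:D|lborel. \<Sum>j\<in>UNIV. dV j x $ j) = 0"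
proof -
  have "(LINT x:D|lborel. \<Sum>j\<in>UNIV. dV j x $ j) = (\<Sum>j\<in>UNIV. LINT x:D|lborel. dV j x $ j)"
    by (intro set_integral_sum set_integrable_ann \<alpha> continuous_intros c)
  also have "\<dots> = (\<Sum>j\<in>UNIV. LINT x:D|lborel. dV j x \<bullet> axis j 1)"
    by (simp add: inner_axis)
  also have "\<dots> = 0"
  proof (intro sum.neutral ballI)
    fix j :: 4
    show "(LINT x:D|lborel. dV j x \<bullet> axis j 1) = 0"
      by (rule integral_gderiv_zero[OF compact_ann _ ann_nonzero[OF \<alpha>] V c z]) auto
  qed
  finally show ?thesis .
qed

text \<open>\<open>g\<close> is the divergence of the cutoff times \<open>U\<close>, since div U =
  0. This is the mean-zero condition of \<open>pressure_flux\<close>.\<close>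

lemma flux_zero: "(LINT x:D|lborel. g x) = 0"
proof -
  let ?dV = "\<lambda>j x. \<Theta> (x \<bullet> x) *\<^sub>R A j x + U x $ j *\<^sub>R ((2 * \<Theta>' (x \<bullet> x)) *\<^sub>R x)"
  have "(LINT x:D|lborel. \<Sum>j\<in>UNIV. ?dV j x $ j) = 0"
  proof (rule divergence_theorem)
    show "GDERIV (\<lambda>x. \<Theta> (x \<bullet> x) * U x $ j) x :> ?dV j x" if "x \<noteq> 0" for j x
      by (intro GDERIV_mult dU GDERIV_radial d1 that)
    show "continuous_on (- {0}) (?dV j)" for j
      by (intro continuous_intros radial_continuous cU cA)
  qed (use outside in auto)
  also have "(LINT x:D|lborel. \<Sum>j\<in>UNIV. ?dV j x $ j) = (LINT x:D|lborel. g x)"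
  proof (intro set_lebesgue_integral_cong allI impI)
    fix x assume "x \<in> D"
    then have "(\<Sum>j\<in>UNIV. A j x $ j) = 0" using ann_nonzero[OF \<alpha>] by (intro incompressible) auto
    have "(\<Sum>j\<in>UNIV. ?dV j x $ j) = (\<Sum>j\<in>UNIV. \<Theta> (x \<bullet> x) * A j x $ j + (2 * \<Theta>' (x \<bullet> x)) * (x $ j * U x $ j))"
      by (intro sum.cong) simp_all
    also have "\<dots> = \<Theta> (x \<bullet> x) * (\<Sum>j\<in>UNIV. A j x $ j) + (2 * \<Theta>' (x \<bullet> x)) * (\<Sum>j\<in>UNIV. x $ j * U x $ j)"
      by (simp only: sum.distrib sum_distrib_left[symmetric])
    finally show "(\<Sum>j\<in>UNIV. ?dV j x $ j) = g x"
      by (simp only: \<open>(\<Sum>j\<in>UNIV. A j x $ j) = 0\<close>) (simp add: inner_vec_def[of x "U x"])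
  qed simp
  finally show ?thesis .
qed

text \<open>With \<theta> the cutoff as a function of x, take the divergence of \<theta> \<nabla>q -
  q \<nabla>\<theta> - \<theta> (q + P) U. The factor of q is the Laplacian of \<theta>, in which 8
  is twice the dimension.\<close>

lemma energy_identity:
  "(LINT x:D|lborel. \<Theta> (x \<bullet> x) * e x) =
   (LINT x:D|lborel. q x * (8 * \<Theta>' (x \<bullet> x) + 4 * (\<Theta>'' (x \<bullet> x) * (x \<bullet> x)))) + (LINT x:D|lborel. g x * q x) + (LINT x:D|lborel. g x * P x)"
proof -
  let ?\<psi> = "\<lambda>x. 2 * \<Theta>' (x \<bullet> x)"
  let ?d\<psi> = "\<lambda>x. (2 * (2 * \<Theta>'' (x \<bullet> x))) *\<^sub>R x"
  let ?S = "\<lambda>j x. \<Sum>i\<in>UNIV. U x $ i *\<^sub>R B i j x + A i x $ j *\<^sub>R A i x"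
  let ?V = "\<lambda>j x. \<Theta> (x \<bullet> x) * W x $ j - q x * (?\<psi> x * x $ j) - \<Theta> (x \<bullet> x) * (U x $ j * (q x + P x))"
  let ?dV = "\<lambda>j x. (\<Theta> (x \<bullet> x) *\<^sub>R ?S j x + W x $ j *\<^sub>R (?\<psi> x *\<^sub>R x))
     - (q x *\<^sub>R (?\<psi> x *\<^sub>R axis j 1 + x $ j *\<^sub>R ?d\<psi> x) + (?\<psi> x * x $ j) *\<^sub>R W x)
     - (\<Theta> (x \<bullet> x) *\<^sub>R (U x $ j *\<^sub>R (W x + G x) + (q x + P x) *\<^sub>R A j x) + (U x $ j * (q x + P x)) *\<^sub>R (?\<psi> x *\<^sub>R x))"
  have "(LINT x:D|lborel. \<Sum>j\<in>UNIV. ?dV j x $ j) = 0"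
  proof (rule divergence_theorem)
    show "GDERIV (?V j) x :> ?dV j x" if x: "x \<noteq> 0" for j x
    proof -
      have 1: "GDERIV (\<lambda>x. \<Theta> (x \<bullet> x)) x :> ?\<psi> x *\<^sub>R x" by (rule GDERIV_radial[OF d1])
      have 2: "GDERIV ?\<psi> x :> ?d\<psi> x"
        by (rule GDERIV_subst[OF GDERIV_cmult[OF GDERIV_radial[OF d2]]]) simp
      show ?thesis
        by (intro GDERIV_diff GDERIV_mult GDERIV_add GDERIV_q GDERIV_W 1 2 GDERIV_component dU dP x)
    qed
    show "continuous_on (- {0}) (?dV j)" for j
      by (intro continuous_intros radial_continuous cU cA cB cG cP) auto
  qed (use outside in auto)
  also have "(LINT x:D|lborel. \<Sum>j\<in>UNIV. ?dV j x $ j) =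
     (LINT x:D|lborel. \<Theta> (x \<bullet> x) * e x - (q x * (8 * \<Theta>' (x \<bullet> x) + 4 * (\<Theta>'' (x \<bullet> x) * (x \<bullet> x))) + g x * q x + g x * P x))"
  proof (intro set_lebesgue_integral_cong allI impI)
    fix x assume "x \<in> D"
    then have x: "x \<noteq> 0" using ann_nonzero[OF \<alpha>] by auto
    let ?\<theta> = "\<Theta> (x \<bullet> x)" and ?w = "W x"
    have d: "(\<Sum>j\<in>UNIV. A j x $ j) = 0" by (rule incompressible[OF x])
    have s1: "(\<Sum>j\<in>UNIV. ?S j x $ j) = (\<Sum>i\<in>UNIV. U x $ i * (\<Sum>j\<in>UNIV. B i j x $ j)) + e x"
    proof -
      have "(\<Sum>j\<in>UNIV. ?S j x $ j) = (\<Sum>i\<in>UNIV. \<Sum>j\<in>UNIV. U x $ i * B i j x $ j + A i x $ j * A i x $ j)"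
        by (subst sum.swap) simp
      then show ?thesis by (simp add: sum.distrib inner_vec_def sum_distrib_left)
    qed
    \<comment> \<open>The momentum equation paired with \<open>U\<close>: transport of
      \<open>q\<close> and pressure work together equal \<open>U\<close> paired with its Laplacian,
      which cancels the same term in \<open>s1\<close>.\<close>
    have s2: "(\<Sum>j\<in>UNIV. U x $ j * (?w + G x) $ j) = (\<Sum>i\<in>UNIV. U x $ i * (\<Sum>j\<in>UNIV. B i j x $ j))"
    proof -
      have "(\<Sum>j\<in>UNIV. U x $ j * ?w $ j) = (\<Sum>i\<in>UNIV. U x $ i * (\<Sum>j\<in>UNIV. U x $ j * A i x $ j))"
        unfolding sum_component vector_scaleR_component real_scaleR_def sum_distrib_left
        by (subst sum.swap) (simp add: mult_ac)
      then show ?thesis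
        by (simp add: momentum[OF x] distrib_left right_diff_distrib sum.distrib sum_subtractf)
    qed
    have a4: "(\<Sum>j\<in>(UNIV::4 set). c) = 4 * c" for c :: real by simp
    have xx: "(\<Sum>j\<in>UNIV. x $ j * x $ j) = x \<bullet> x" and xU: "(\<Sum>j\<in>UNIV. U x $ j * x $ j) = x \<bullet> U x"
      by (simp_all add: inner_vec_def mult.commute)
    have "(\<Sum>j\<in>UNIV. ?dV j x $ j) =
      (\<Sum>j\<in>UNIV. ?\<theta> * ?S j x $ j - q x * ?\<psi> x - (q x * (4 * \<Theta>'' (x \<bullet> x))) * (x $ j * x $ j)
        - ?\<theta> * (U x $ j * (?w + G x) $ j) - (?\<theta> * (q x + P x)) * A j x $ j - ((q x + P x) * ?\<psi> x) * (U x $ j * x $ j))"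
      by (intro sum.cong) (simp_all add: algebra_simps axis_def)
    also have "\<dots> = ?\<theta> * (\<Sum>j\<in>UNIV. ?S j x $ j) - 4 * (q x * ?\<psi> x) - (q x * (4 * \<Theta>'' (x \<bullet> x))) * (x \<bullet> x)
        - ?\<theta> * (\<Sum>j\<in>UNIV. U x $ j * (?w + G x) $ j) - (?\<theta> * (q x + P x)) * (\<Sum>j\<in>UNIV. A j x $ j) - ((q x + P x) * ?\<psi> x) * (x \<bullet> U x)"
      by (simp only: sum_subtractf sum_distrib_left[symmetric] a4 xx xU)
    also have "\<dots> = ?\<theta> * e x - (q x * (8 * \<Theta>' (x \<bullet> x) + 4 * (\<Theta>'' (x \<bullet> x) * (x \<bullet> x))) + g x * q x + g x * P x)"
      unfolding s1 s2 d by (simp add: algebra_simps)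
    finally show "(\<Sum>j\<in>UNIV. ?dV j x $ j) = ?\<theta> * e x - (q x * (8 * \<Theta>' (x \<bullet> x) + 4 * (\<Theta>'' (x \<bullet> x) * (x \<bullet> x))) + g x * q x + g x * P x)" .
  qed simp
  finally have 0: "(LINT x:D|lborel. \<Theta> (x \<bullet> x) * e x - (q x * (8 * \<Theta>' (x \<bullet> x) + 4 * (\<Theta>'' (x \<bullet> x) * (x \<bullet> x))) + g x * q x + g x * P x)) = 0" .
  have i: "set_integrable lborel D (\<lambda>x. \<Theta> (x \<bullet> x) * e x)"
    "set_integrable lborel D (\<lambda>x. q x * (8 * \<Theta>' (x \<bullet> x) + 4 * (\<Theta>'' (x \<bullet> x) * (x \<bullet> x))))"
    "set_integrable lborel D (\<lambda>x. g x * q x)" "set_integrable lborel D (\<lambda>x. g x * P x)"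
    by (intro set_integrable_ann \<alpha> continuous_intros radial_continuous cU cA cP; simp)+
  show ?thesis
    using 0 by (simp only: right_minus_eq set_integral_diff(2)[OF i(1) set_integral_add(1)[OF set_integral_add(1)[OF i(2,3)] i(4)]]
        set_integral_add(2)[OF set_integral_add(1)[OF i(2,3)] i(4)] set_integral_add(2)[OF i(2,3)])
qed

text \<open>Take the divergence of the cutoff times q x / |x|^2. In dimension four div (x / |x|^2) =
  2 / |x|^2, which produces the left side. Young's inequality on the cross term returns half of it,
  and absorbing that half doubles the boundary term.\<close>

lemma hardy:
  assumes nn: "\<And>r. 0 \<le> \<Theta> r"
  shows "(LINT x:D|lborel. \<Theta> (x \<bullet> x) * (U x \<bullet> U x) / (x \<bullet> x)) \<le>
    2 * (LINT x:D|lborel. \<bar>\<Theta>' (x \<bullet> x)\<bar> * (U x \<bullet> U x)) + (LINT x:D|lborel. \<Theta> (x \<bullet> x) * e x)"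
proof -
  let ?w = "\<lambda>x::real^4. inverse (x \<bullet> x)"
  let ?dw = "\<lambda>x::real^4. - (inverse (x \<bullet> x))\<^sup>2 *\<^sub>R (2 *\<^sub>R x)"
  let ?V = "\<lambda>j x. \<Theta> (x \<bullet> x) * (?w x * (q x * x $ j))"
  let ?dV = "\<lambda>j x. \<Theta> (x \<bullet> x) *\<^sub>R (?w x *\<^sub>R (q x *\<^sub>R axis j 1 + x $ j *\<^sub>R W x) + (q x * x $ j) *\<^sub>R ?dw x)
       + (?w x * (q x * x $ j)) *\<^sub>R ((2 * \<Theta>' (x \<bullet> x)) *\<^sub>R x)"
  have "(LINT x:D|lborel. \<Sum>j\<in>UNIV. ?dV j x $ j) = 0"
  proof (rule divergence_theorem)
    show "GDERIV (?V j) x :> ?dV j x" if x: "x \<noteq> 0" for j x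
      by (intro GDERIV_mult GDERIV_q GDERIV_component GDERIV_radial d1 GDERIV_inverse GDERIV_inner_self x) (simp add: x)
    show "continuous_on (- {0}) (?dV j)" for j
      by (intro continuous_intros radial_continuous cU cA) auto
  qed (use outside in auto)
  also have "(LINT x:D|lborel. \<Sum>j\<in>UNIV. ?dV j x $ j) =
     (LINT x:D|lborel. \<Theta> (x \<bullet> x) * (U x \<bullet> U x) / (x \<bullet> x) + \<Theta> (x \<bullet> x) * ((x \<bullet> W x) / (x \<bullet> x)) + \<Theta>' (x \<bullet> x) * (U x \<bullet> U x))"
  proof (intro set_lebesgue_integral_cong allI impI)
    fix x assume "x \<in> D"
    then have x: "x \<bullet> x \<noteq> 0" using ann_nonzero[OF \<alpha>] by auto
    have a4: "(\<Sum>j\<in>(UNIV::4 set). c) = 4 * c" for c :: real by simp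
    have xx: "(\<Sum>j\<in>UNIV. x $ j * x $ j) = x \<bullet> x" and xW: "(\<Sum>j\<in>UNIV. x $ j * W x $ j) = x \<bullet> W x"
      by (simp_all add: inner_vec_def)
    have "(\<Sum>j\<in>UNIV. ?dV j x $ j) = (\<Sum>j\<in>UNIV. \<Theta> (x \<bullet> x) * ?w x * q x + (\<Theta> (x \<bullet> x) * ?w x) * (x $ j * W x $ j)
      - (\<Theta> (x \<bullet> x) * q x * 2 * (?w x)\<^sup>2) * (x $ j * x $ j) + (?w x * q x * 2 * \<Theta>' (x \<bullet> x)) * (x $ j * x $ j))"
      by (intro sum.cong) (simp_all add: algebra_simps axis_def)
    also have "\<dots> = 4 * (\<Theta> (x \<bullet> x) * ?w x * q x) + (\<Theta> (x \<bullet> x) * ?w x) * (x \<bullet> W x)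
      - (\<Theta> (x \<bullet> x) * q x * 2 * (?w x)\<^sup>2) * (x \<bullet> x) + (?w x * q x * 2 * \<Theta>' (x \<bullet> x)) * (x \<bullet> x)"
      by (simp only: sum_subtractf sum.distrib sum_distrib_left[symmetric] a4 xx xW)
    also have "\<dots> = \<Theta> (x \<bullet> x) * (U x \<bullet> U x) / (x \<bullet> x) + \<Theta> (x \<bullet> x) * ((x \<bullet> W x) / (x \<bullet> x)) + \<Theta>' (x \<bullet> x) * (U x \<bullet> U x)"
      using x by (simp add: field_simps power2_eq_square)
    finally show "(\<Sum>j\<in>UNIV. ?dV j x $ j) = \<Theta> (x \<bullet> x) * (U x \<bullet> U x) / (x \<bullet> x) + \<Theta> (x \<bullet> x) * ((x \<bullet> W x) / (x \<bullet> x)) + \<Theta>' (x \<bullet> x) * (U x \<bullet> U x)" .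
  qed simp
  finally have 0: "(LINT x:D|lborel. \<Theta> (x \<bullet> x) * (U x \<bullet> U x) / (x \<bullet> x) + \<Theta> (x \<bullet> x) * ((x \<bullet> W x) / (x \<bullet> x)) + \<Theta>' (x \<bullet> x) * (U x \<bullet> U x)) = 0" .
  have i: "set_integrable lborel D (\<lambda>x. \<Theta> (x \<bullet> x) * (U x \<bullet> U x) / (x \<bullet> x))"
    "set_integrable lborel D (\<lambda>x. \<Theta> (x \<bullet> x) * ((x \<bullet> W x) / (x \<bullet> x)) + \<Theta>' (x \<bullet> x) * (U x \<bullet> U x))"
    "set_integrable lborel D (\<lambda>x. \<Theta> (x \<bullet> x) * e x)" "set_integrable lborel D (\<lambda>x. \<bar>\<Theta>' (x \<bullet> x)\<bar> * (U x \<bullet> U x))"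
    by (intro set_integrable_ann \<alpha> continuous_intros radial_continuous cU cA; auto)+
  let ?X = "LINT x:D|lborel. \<Theta> (x \<bullet> x) * (U x \<bullet> U x) / (x \<bullet> x)"
  have "(LINT x:D|lborel. \<Theta> (x \<bullet> x) * (U x \<bullet> U x) / (x \<bullet> x) + \<Theta> (x \<bullet> x) * ((x \<bullet> W x) / (x \<bullet> x)) + \<Theta>' (x \<bullet> x) * (U x \<bullet> U x))
     = ?X + (LINT x:D|lborel. \<Theta> (x \<bullet> x) * ((x \<bullet> W x) / (x \<bullet> x)) + \<Theta>' (x \<bullet> x) * (U x \<bullet> U x))"
    by (simp only: add.assoc set_integral_add(2)[OF i(1,2)])
  with 0 have "?X = - (LINT x:D|lborel. \<Theta> (x \<bullet> x) * ((x \<bullet> W x) / (x \<bullet> x)) + \<Theta>' (x \<bullet> x) * (U x \<bullet> U x))" by simp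
  also have "\<dots> \<le> (LINT x:D|lborel. (1 / 2) * (\<Theta> (x \<bullet> x) * (U x \<bullet> U x) / (x \<bullet> x)) + (1 / 2) * (\<Theta> (x \<bullet> x) * e x) + \<bar>\<Theta>' (x \<bullet> x)\<bar> * (U x \<bullet> U x))"
    unfolding set_integral_uminus[OF i(2), symmetric]
  proof (intro set_integral_mono set_integral_add(1) set_integrable_mult_right i)
    show "set_integrable lborel D (\<lambda>x. - (\<Theta> (x \<bullet> x) * ((x \<bullet> W x) / (x \<bullet> x)) + \<Theta>' (x \<bullet> x) * (U x \<bullet> U x)))"
      using set_integrable_mult_right[of "-1", OF i(2)] by simp
    fix x assume "x \<in> D"
    then have x: "0 < x \<bullet> x" using ann_nonzero[OF \<alpha>] by auto
    \<comment> \<open>Componentwise, from the square of \<open>U x $ i + x \<bullet> A i x\<close>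
      and Cauchy-Schwarz.\<close>
    have "- 2 * (x \<bullet> W x) \<le> (U x \<bullet> U x) + (x \<bullet> x) * e x"
    proof -
      have "- 2 * (x \<bullet> W x) = (\<Sum>i\<in>UNIV. - 2 * (U x $ i * (x \<bullet> A i x)))"
        by (simp add: inner_sum_right sum_distrib_left)
      also have "\<dots> \<le> (\<Sum>i\<in>UNIV. U x $ i * U x $ i + (x \<bullet> x) * (A i x \<bullet> A i x))"
      proof (rule sum_mono)
        fix i
        have "0 \<le> (U x $ i + x \<bullet> A i x)\<^sup>2" by simp
        then show "- 2 * (U x $ i * (x \<bullet> A i x)) \<le> U x $ i * U x $ i + (x \<bullet> x) * (A i x \<bullet> A i x)"
          using Cauchy_Schwarz_ineq[of x "A i x"] by (simp add: power2_eq_square algebra_simps)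
      qed
      finally show ?thesis by (simp add: sum.distrib inner_vec_def[of "U x"] sum_distrib_left)
    qed
    then have "- ((x \<bullet> W x) / (x \<bullet> x)) \<le> (1 / 2) * ((U x \<bullet> U x) / (x \<bullet> x)) + (1 / 2) * e x"
      using x by (simp add: field_simps)
    then have "\<Theta> (x \<bullet> x) * (- ((x \<bullet> W x) / (x \<bullet> x))) \<le> \<Theta> (x \<bullet> x) * ((1 / 2) * ((U x \<bullet> U x) / (x \<bullet> x)) + (1 / 2) * e x)"
      by (intro mult_left_mono nn)
    moreover have "- (\<Theta>' (x \<bullet> x) * (U x \<bullet> U x)) \<le> \<bar>\<Theta>' (x \<bullet> x)\<bar> * (U x \<bullet> U x)"
      using mult_right_mono[of "- \<Theta>' (x \<bullet> x)" "\<bar>\<Theta>' (x \<bullet> x)\<bar>" "U x \<bullet> U x"] by simp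
    ultimately show "- (\<Theta> (x \<bullet> x) * ((x \<bullet> W x) / (x \<bullet> x)) + \<Theta>' (x \<bullet> x) * (U x \<bullet> U x))
       \<le> (1 / 2) * (\<Theta> (x \<bullet> x) * (U x \<bullet> U x) / (x \<bullet> x)) + (1 / 2) * (\<Theta> (x \<bullet> x) * e x) + \<bar>\<Theta>' (x \<bullet> x)\<bar> * (U x \<bullet> U x)"
      by (simp add: algebra_simps)
  qed
  also have "\<dots> = (1 / 2) * ?X + (1 / 2) * (LINT x:D|lborel. \<Theta> (x \<bullet> x) * e x) + (LINT x:D|lborel. \<bar>\<Theta>' (x \<bullet> x)\<bar> * (U x \<bullet> U x))"
    using i by (simp only: set_integral_add set_integrable_mult_right set_integral_mult_right)
  finally show ?thesis by simp
qed

end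

section \<open>Uniform local energy bound\<close>

text \<open>Weight \<open>f\<close> by (1/2 - t)^p and let S be the supremum. One step from t to
  \<tau> loses (1 - \<kappa>)^-p, at most 4/3 by Bernoulli, against the factor 1/2, so S is at most
  (2/3) S + C (4p)^p. The bound \<open>B\<close> only ensures that S is finite and does not enter
  the conclusion.\<close>

lemma absorption:
  fixes f :: "real \<Rightarrow> real"
  assumes p: "1 \<le> p" and C: "0 \<le> C" and B: "\<And>t. 0 \<le> t \<Longrightarrow> t \<le> 1 / 2 \<Longrightarrow> f t \<le> B" and nn: "\<And>t. 0 \<le> f t"
    and step: "\<And>t \<tau>. 0 \<le> t \<Longrightarrow> t < \<tau> \<Longrightarrow> \<tau> \<le> 1 / 2 \<Longrightarrow> f t \<le> f \<tau> / 2 + C / (\<tau> - t) ^ p"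
  shows "f 0 \<le> 3 * C * (8 * real p) ^ p"
proof -
  define h where "h t = (1 / 2 - t) ^ p * f t" for t
  define S where "S = (SUP t\<in>{0..<1/2}. h t)"
  \<comment> \<open>Bernoulli gives 1 - p \<kappa> = 3/4 for this choice, which keeps the
    contraction factor at 2/3.\<close>
  define \<kappa> where "\<kappa> = 1 / (4 * real p)"
  have k: "0 < \<kappa>" "\<kappa> < 1" using p by (auto simp: \<kappa>_def field_simps)
  have kp: "3 / 4 \<le> (1 - \<kappa>) ^ p"
  proof -
    have "1 + real p * (- \<kappa>) \<le> (1 + (- \<kappa>)) ^ p" using k by (intro Bernoulli_inequality) auto
    then show ?thesis using p by (simp add: \<kappa>_def field_simps)
  qed
  have hB: "h t \<le> B" if "t \<in> {0..<1/2}" for t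
  proof -
    have "(1 / 2 - t) ^ p \<le> 1" using that by (intro power_le_one) auto
    then have "h t \<le> 1 * f t" unfolding h_def using nn by (intro mult_right_mono) auto
    then show ?thesis using B[of t] that by simp
  qed
  have bdd: "bdd_above (h ` {0..<1/2})" by (rule bdd_aboveI2[of _ _ B]) (rule hB)
  have hS: "h t \<le> S" if "t \<in> {0..<1/2}" for t unfolding S_def using bdd that by (intro cSUP_upper)
  have S0: "0 \<le> S" using hS[of 0] nn[of 0] by (auto simp: h_def intro: order_trans[rotated])
  have "h t \<le> 2 / 3 * S + C * (4 * real p) ^ p" if t: "t \<in> {0..<1/2}" for t
  proof -
    define \<tau> where "\<tau> = t + \<kappa> * (1 / 2 - t)"
    have d: "0 < 1 / 2 - t" using t by simp
    have \<tau>: "t < \<tau>" "\<tau> < 1 / 2"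
    proof -
      define y where "y = \<kappa> * (1 / 2 - t)"
      have "y < 1 * (1 / 2 - t)" unfolding y_def using d k by (intro mult_strict_right_mono) auto
      moreover have "0 < y" unfolding y_def using d k by simp
      moreover have "\<tau> = t + y" by (simp add: \<tau>_def y_def)
      ultimately have "t < \<tau> \<and> \<tau> < 1 / 2" by simp
      then show "t < \<tau>" "\<tau> < 1 / 2" by auto
    qed
    have e: "1 / 2 - \<tau> = (1 - \<kappa>) * (1 / 2 - t)" by (simp add: \<tau>_def field_simps)
    have "h t \<le> (1 / 2 - t) ^ p * (f \<tau> / 2 + C / (\<tau> - t) ^ p)"
      unfolding h_def using d t \<tau> by (intro mult_left_mono step) auto
    also have "\<dots> = (1 / 2 - t) ^ p * f \<tau> / 2 + C * (4 * real p) ^ p"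
    proof -
      have "(1 / 2 - t) ^ p * (C / (\<tau> - t) ^ p) = C * (1 / \<kappa>) ^ p"
        using d k by (simp add: \<tau>_def power_mult_distrib power_divide)
      then show ?thesis by (simp add: \<kappa>_def algebra_simps)
    qed
    also have "(1 / 2 - t) ^ p * f \<tau> \<le> 4 / 3 * S"
    proof -
      have "3 / 4 * ((1 / 2 - t) ^ p * f \<tau>) \<le> (1 - \<kappa>) ^ p * ((1 / 2 - t) ^ p * f \<tau>)"
        using kp nn d by (intro mult_right_mono) auto
      also have "\<dots> = h \<tau>" by (simp add: h_def e power_mult_distrib)
      also have "\<dots> \<le> S" using t \<tau> by (intro hS) auto
      finally show ?thesis by simp
    qed
    finally show ?thesis by simp
  qed
  then have "S \<le> 2 / 3 * S + C * (4 * real p) ^ p"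
    unfolding S_def by (intro cSUP_least) auto
  then have "S \<le> 3 * C * (4 * real p) ^ p" by simp
  moreover have "f 0 = 2 ^ p * h 0" by (simp add: h_def power_divide)
  moreover have "h 0 \<le> S" by (rule hS) simp
  ultimately have "f 0 \<le> 2 ^ p * (3 * C * (4 * real p) ^ p)" by simp
  also have "\<dots> = 3 * C * (8 * real p) ^ p"
  proof -
    have "(8 * real p) ^ p = (2 * (4 * real p)) ^ p" by simp
    also have "\<dots> = 2 ^ p * (4 * real p) ^ p" by (rule power_mult_distrib)
    finally show ?thesis by (simp only: mult.left_commute)
  qed
  finally show ?thesis .
qed

context NS4
begin

text \<open>The right side of \<open>energy_identity\<close> with abstract weights: \<open>g\<close>
  for the flux and \<open>l\<close> for the Laplacian of the cutoff. In this form it serves both the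
  nested annuli and the cutoffs at the two ends.\<close>

lemma boundary_estimate:
  assumes ab: "1 / 2 \<le> a" "b \<le> 5 / 2" and d: "0 < d" "d \<le> 1 / 4" and n: "0 < n" "cubic (1 / 8) 4 \<le> n ^ 3"
    and K: "0 \<le> K" and g: "continuous_on (- {0}) g" "\<And>x. x \<in> ann a b \<Longrightarrow> \<bar>g x\<bar> \<le> K * norm (U x)"
    and l: "continuous_on (- {0}) l" "\<And>x. x \<in> ann a b \<Longrightarrow> \<bar>l x\<bar> \<le> K"
    and mean: "(LINT x:ann a b|lborel. g x) = 0"
  shows "\<bar>(LINT x:ann a b|lborel. (U x \<bullet> U x) / 2 * l x) + (LINT x:ann a b|lborel. g x * ((U x \<bullet> U x) / 2)) + (LINT x:ann a b|lborel. g x * P x)\<bar>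
    \<le> K * ((vol4 + 1) * n\<^sup>2 + n ^ 3 + flux_const * (d * n * (energy (a - 2 * d ^ 3) (b + 2 * d ^ 3) + n\<^sup>2) + n ^ 3 / d + n\<^sup>2 + n ^ 3))"
proof -
  let ?D = "ann a b" and ?q = "\<lambda>x. (U x \<bullet> U x) / 2"
  have a0: "0 < a" using ab by simp
  have N: "cubic a b \<le> n ^ 3" by (rule order_trans[OF cubic_mono n(2)]) (use ab in auto)
  have sq: "U x \<bullet> U x = (norm (U x))\<^sup>2" for x by (simp add: dot_square_norm)
  have cl: "continuous_on (- {0}) (\<lambda>x. ?q x * l x)"
    by (intro continuous_intros l cU) auto
  have cq: "continuous_on (- {0}) (\<lambda>x. g x * ?q x)" by (intro continuous_intros g cU) auto
  have "\<bar>LINT x:?D|lborel. ?q x * l x\<bar> \<le> (LINT x:?D|lborel. K * (norm (U x))\<^sup>2)"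
  proof (intro set_integral_abs_le set_integrable_ann a0 cl)
    show "continuous_on (- {0}) (\<lambda>x. K * (norm (U x))\<^sup>2)" by (intro continuous_intros cU)
    fix x assume x: "x \<in> ?D"
    have "\<bar>?q x * l x\<bar> \<le> (norm (U x))\<^sup>2 * K"
      unfolding abs_mult by (intro mult_mono l x) (auto simp: sq)
    then show "\<bar>?q x * l x\<bar> \<le> K * (norm (U x))\<^sup>2" by (simp add: mult.commute)
  qed
  also have "\<dots> = K * (LINT x:?D|lborel. (norm (U x))\<^sup>2)" by simp
  also have "\<dots> \<le> K * ((vol4 + 1) * n\<^sup>2)" using ab by (intro mult_left_mono square_integral_le n N K) auto
  finally have 1: "\<bar>LINT x:?D|lborel. ?q x * l x\<bar> \<le> K * ((vol4 + 1) * n\<^sup>2)" .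
  have "\<bar>LINT x:?D|lborel. g x * ?q x\<bar> \<le> (LINT x:?D|lborel. K * norm (U x) ^ 3)"
  proof (intro set_integral_abs_le set_integrable_ann a0 cq)
    show "continuous_on (- {0}) (\<lambda>x. K * norm (U x) ^ 3)" by (intro continuous_intros cU)
    fix x assume x: "x \<in> ?D"
    have "\<bar>g x * ?q x\<bar> \<le> (K * norm (U x)) * (norm (U x))\<^sup>2"
      unfolding abs_mult[of "g x"] by (intro mult_mono g x) (auto simp: sq K)
    then show "\<bar>g x * ?q x\<bar> \<le> K * norm (U x) ^ 3" by (simp add: power2_eq_square power3_eq_cube)
  qed
  also have "\<dots> = K * cubic a b" by (simp add: cubic_def)
  also have "\<dots> \<le> K * n ^ 3" by (intro mult_left_mono N K)
  finally have 2: "\<bar>LINT x:?D|lborel. g x * ?q x\<bar> \<le> K * n ^ 3" .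
  have 3: "\<bar>LINT x:?D|lborel. g x * P x\<bar> \<le> flux_const * K * (d * n * (energy (a - 2 * d ^ 3) (b + 2 * d ^ 3) + n\<^sup>2) + n ^ 3 / d + n\<^sup>2 + n ^ 3)"
    by (intro pressure_flux ab d n g K mean continuous_on_subset[OF g(1) ann_nonzero[OF a0]])
  have "\<bar>(LINT x:?D|lborel. ?q x * l x) + (LINT x:?D|lborel. g x * ?q x) + (LINT x:?D|lborel. g x * P x)\<bar>
     \<le> K * ((vol4 + 1) * n\<^sup>2) + K * n ^ 3 + flux_const * K * (d * n * (energy (a - 2 * d ^ 3) (b + 2 * d ^ 3) + n\<^sup>2) + n ^ 3 / d + n\<^sup>2 + n ^ 3)"
    using 1 2 3 by linarith
  then show ?thesis
    by (simp only: distrib_left[of K] mult.assoc mult.left_commute[of K flux_const])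
qed

end

text \<open>What remains in \<open>nested_step\<close> after absorption, with 4 (1 + 2 * 10^6
  \<open>flux_const\<close> n) the denominator in the choice of \<open>d\<close> made there.\<close>

definition nested_const :: "real \<Rightarrow> real" where
  "nested_const n = 2 * 10 ^ 6 * ((vol4 + 1) * n\<^sup>2 + n ^ 3 + n\<^sup>2 +
     flux_const * (n ^ 3 * (4 * (1 + 2 * 10 ^ 6 * flux_const * n)) + n\<^sup>2 + n ^ 3))"

lemma flux_const_nonneg: "0 \<le> flux_const"
  unfolding flux_const_def using vol1_pos bump_mass_pos vol4_nonneg level_const
  by (intro divide_nonneg_pos add_nonneg_nonneg mult_nonneg_nonneg) auto

context NS4
begin

text \<open>The cutoff has derivatives of size w^-6, where w is half the gap. Choosing
  \<open>d\<close> proportional to w^7 makes the energy term of \<open>pressure_flux\<close>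
  absorbable, while its term n^3 / d grows to w^-13; this fixes the exponent 13.\<close>

lemma nested_step:
  assumes n: "0 < n" "cubic (1 / 8) 4 \<le> n ^ 3" and t: "0 \<le> t" "t < \<tau>" "\<tau> \<le> 1 / 2"
  shows "energy (1 - t) (2 + t) \<le> energy (1 - \<tau>) (2 + \<tau>) / 2 + nested_const n * 2 ^ 13 / (\<tau> - t) ^ 13"
proof -
  \<comment> \<open>Half of the gap is for the cutoff to rise, half for the enlargement of the
    annulus by \<open>2 * d ^ 3\<close>.\<close>
  define w where "w = (\<tau> - t) / 2"
  define \<alpha> where "\<alpha> = 1 - t - w"
  define \<beta> where "\<beta> = 2 + t + w"
  have w: "0 < w" "w \<le> 1 / 4" using t by (auto simp: w_def)
  have tw: "t + 2 * w = \<tau>" by (simp add: w_def field_simps)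
  have ab: "1 / 2 \<le> \<alpha>" "\<beta> \<le> 5 / 2" "0 < \<alpha>" "0 \<le> \<beta>" "\<alpha> \<le> 1"
    using t w tw unfolding \<alpha>_def \<beta>_def by linarith+
  define Q where "Q r = (r - \<alpha>\<^sup>2) * (\<beta>\<^sup>2 - r)" for r
  define Q' where "Q' r = \<alpha>\<^sup>2 + \<beta>\<^sup>2 - 2 * r" for r
  \<comment> \<open>This cutoff is not bounded by 1. It suffices that it is nonnegative and at least
    1 on the inner annulus, where \<open>Q\<close> is at least w^2.\<close>
  define \<Theta> where "\<Theta> r = (max 0 (Q r)) ^ 3 / w ^ 6" for r
  define \<Theta>' where "\<Theta>' r = 3 * (max 0 (Q r)) ^ 2 * Q' r / w ^ 6" for r
  define \<Theta>'' where "\<Theta>'' r = (6 * max 0 (Q r) * (Q' r)\<^sup>2 - 6 * (max 0 (Q r)) ^ 2) / w ^ 6" for r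
  have w6: "0 < w ^ 6" using w by simp
  have dQ: "DERIV Q r :> Q' r" for r
    unfolding Q_def[abs_def] Q'_def by (auto intro!: derivative_eq_intros simp: algebra_simps)
  have dQ': "DERIV Q' r :> - 2" for r
    unfolding Q'_def[abs_def] by (auto intro!: derivative_eq_intros)
  have p3: "DERIV (\<lambda>r. (max 0 (Q r)) ^ 3) r :> 3 * (max 0 (Q r)) ^ 2 * Q' r" for r
    using DERIV_chain2[OF DERIV_pos_power[of 1 "Q r"] dQ] by (simp add: numeral_eq_Suc)
  have p2: "DERIV (\<lambda>r. (max 0 (Q r)) ^ 2) r :> 2 * max 0 (Q r) * Q' r" for r
    using DERIV_chain2[OF DERIV_pos_power[of 0 "Q r"] dQ] by (simp add: numeral_eq_Suc)
  have Qneg: "Q r \<le> 0" if "r \<notin> {\<alpha>\<^sup>2..\<beta>\<^sup>2}" for r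
  proof -
    have "\<alpha>\<^sup>2 \<le> \<beta>\<^sup>2" using ab t w by (intro power_mono) (auto simp: \<alpha>_def \<beta>_def)
    then show ?thesis using that by (auto simp: Q_def mult_le_0_iff)
  qed
  interpret NS4_cutoff U A B P G M \<Theta> \<Theta>' \<Theta>'' \<alpha> \<beta>
  proof unfold_locales
    show "DERIV \<Theta> r :> \<Theta>' r" for r
      unfolding \<Theta>_def[abs_def] \<Theta>'_def by (rule DERIV_cdivide[OF p3])
    show "DERIV \<Theta>' r :> \<Theta>'' r" for r
    proof -
      have "DERIV (\<lambda>r. 3 * ((max 0 (Q r)) ^ 2 * Q' r) / w ^ 6) r :> 3 * ((max 0 (Q r)) ^ 2 * - 2 + (2 * max 0 (Q r) * Q' r) * Q' r) / w ^ 6"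
        by (intro DERIV_cdivide DERIV_cmult DERIV_cong[OF DERIV_mult[OF p2 dQ']]) simp
      then show ?thesis
        unfolding \<Theta>'_def[abs_def] \<Theta>''_def by (simp add: power2_eq_square algebra_simps)
    qed
    show "continuous_on UNIV \<Theta>''"
      unfolding \<Theta>''_def[abs_def] Q_def Q'_def using w by (intro continuous_intros) auto
    show "\<Theta> r = 0" "\<Theta>' r = 0" if "r \<notin> {\<alpha>\<^sup>2..\<beta>\<^sup>2}" for r
      using Qneg[OF that] by (simp_all add: \<Theta>_def \<Theta>'_def)
  qed (use ab in auto)
  \<comment> \<open>Rounded up from the two bounds below, 312000 for the flux weight and 1753200 for
    the Laplacian.\<close>
  define K where "K = 2 * 10 ^ 6 / w ^ 6"
  have K0: "0 \<le> K" using w by (simp add: K_def)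
  have xD: "1 / 4 \<le> x \<bullet> x" "x \<bullet> x \<le> 25 / 4" "norm x \<le> 5 / 2" if "x \<in> D" for x :: "real^4"
  proof -
    have x: "1 / 2 \<le> norm x" "norm x \<le> 5 / 2" using that ab by (auto simp: ann_def)
    have "(1 / 2)\<^sup>2 \<le> (norm x)\<^sup>2" "(norm x)\<^sup>2 \<le> (5 / 2)\<^sup>2" using x by (intro power_mono; simp)+
    then show "1 / 4 \<le> x \<bullet> x" "x \<bullet> x \<le> 25 / 4" "norm x \<le> 5 / 2" using x by (simp_all add: dot_square_norm power_divide)
  qed
  have ab2: "\<alpha>\<^sup>2 \<le> 1" "0 \<le> \<alpha>\<^sup>2" "\<beta>\<^sup>2 \<le> 25 / 4" "0 \<le> \<beta>\<^sup>2"
    using power_mono[of \<alpha> 1 2] power_mono[of \<beta> "5/2" 2] ab by (auto simp: power_divide)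
  have bQ: "0 \<le> max 0 (Q r)" "max 0 (Q r) \<le> 40" and bQ': "\<bar>Q' r\<bar> \<le> 13" if r: "1 / 4 \<le> r" "r \<le> 25 / 4" for r
  proof -
    show "0 \<le> max 0 (Q r)" by simp
    have "\<bar>Q r\<bar> \<le> (25 / 4) * (25 / 4)"
      unfolding Q_def abs_mult
    proof (intro mult_mono)
      show "\<bar>r - \<alpha>\<^sup>2\<bar> \<le> 25 / 4" "\<bar>\<beta>\<^sup>2 - r\<bar> \<le> 25 / 4" using ab2 r by linarith+
    qed auto
    then show "max 0 (Q r) \<le> 40" by simp
    show "\<bar>Q' r\<bar> \<le> 13" unfolding Q'_def using ab2 r by linarith
  qed
  have b1: "\<bar>\<Theta>' r\<bar> \<le> 62400 / w ^ 6" and b2: "\<bar>\<Theta>'' r\<bar> \<le> 50160 / w ^ 6" if r: "1 / 4 \<le> r" "r \<le> 25 / 4" for r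
  proof -
    note b = bQ[OF r] bQ'[OF r]
    have m2: "(max 0 (Q r))\<^sup>2 \<le> 1600" "0 \<le> (max 0 (Q r))\<^sup>2" using power_mono[OF b(2,1), of 2] by auto
    have q2: "(Q' r)\<^sup>2 \<le> 169" "0 \<le> (Q' r)\<^sup>2" using b(3) abs_le_square_iff[of "Q' r" 13] by auto
    have "\<bar>(max 0 (Q r))\<^sup>2 * Q' r\<bar> \<le> 1600 * 13" unfolding abs_mult using m2 b by (intro mult_mono) auto
    then have "\<bar>3 * (max 0 (Q r))\<^sup>2 * Q' r\<bar> \<le> 62400" by (simp add: abs_mult mult.commute)
    then show "\<bar>\<Theta>' r\<bar> \<le> 62400 / w ^ 6" unfolding \<Theta>'_def abs_divide using w6 by (simp add: divide_right_mono)
    have "0 \<le> max 0 (Q r) * (Q' r)\<^sup>2" by simp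
    moreover have "max 0 (Q r) * (Q' r)\<^sup>2 \<le> 40 * 169" using b(1,2) q2 by (intro mult_mono) auto
    ultimately have "\<bar>6 * max 0 (Q r) * (Q' r)\<^sup>2 - 6 * (max 0 (Q r)) ^ 2\<bar> \<le> 50160" using m2 unfolding mult.assoc by linarith
    then show "\<bar>\<Theta>'' r\<bar> \<le> 50160 / w ^ 6" unfolding \<Theta>''_def abs_divide using w6 by (simp add: divide_right_mono)
  qed
  have g: "\<bar>g x\<bar> \<le> K * norm (U x)" if x: "x \<in> D" for x
  proof -
    have "\<bar>x \<bullet> U x\<bar> \<le> (5 / 2) * norm (U x)"
      using Cauchy_Schwarz_ineq2[of x "U x"] mult_right_mono[OF xD(3)[OF x], of "norm (U x)"] by simp
    then have "\<bar>2 * \<Theta>' (x \<bullet> x) * (x \<bullet> U x)\<bar> \<le> 2 * (62400 / w ^ 6) * ((5 / 2) * norm (U x))"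
      unfolding abs_mult using b1[OF xD(1)[OF x] xD(2)[OF x]] by (intro mult_mono) auto
    also have "\<dots> = 312000 / w ^ 6 * norm (U x)" by simp
    also have "\<dots> \<le> K * norm (U x)" unfolding K_def using w by (intro mult_right_mono divide_right_mono) auto
    finally show ?thesis .
  qed
  have L: "\<bar>8 * \<Theta>' (x \<bullet> x) + 4 * (\<Theta>'' (x \<bullet> x) * (x \<bullet> x))\<bar> \<le> K" if x: "x \<in> D" for x :: "real^4"
  proof -
    have "\<bar>\<Theta>'' (x \<bullet> x) * (x \<bullet> x)\<bar> \<le> (50160 / w ^ 6) * (25 / 4)"
      unfolding abs_mult using b2[OF xD(1)[OF x] xD(2)[OF x]] xD[OF x] w by (intro mult_mono) auto
    moreover have "\<bar>8 * u + 4 * v\<bar> \<le> 8 * p + 4 * r" if "\<bar>u\<bar> \<le> p" "\<bar>v\<bar> \<le> r" for u v p r :: real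
      using that by linarith
    ultimately have "\<bar>8 * \<Theta>' (x \<bullet> x) + 4 * (\<Theta>'' (x \<bullet> x) * (x \<bullet> x))\<bar> \<le> 8 * (62400 / w ^ 6) + 4 * ((50160 / w ^ 6) * (25 / 4))"
      using b1[OF xD(1)[OF x] xD(2)[OF x]] by blast
    also have "\<dots> = 1753200 / w ^ 6" by simp
    also have "\<dots> \<le> K" unfolding K_def using w by (simp add: divide_right_mono)
    finally show ?thesis .
  qed
  have cgD: "continuous_on (- {0}) (\<lambda>x. g x)" by (intro continuous_intros radial_continuous cU)
  have clD: "continuous_on (- {0}) (\<lambda>x::real^4. 8 * \<Theta>' (x \<bullet> x) + 4 * (\<Theta>'' (x \<bullet> x) * (x \<bullet> x)))"
    by (intro continuous_intros radial_continuous)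
  define c where "c = 4 * (1 + 2 * 10 ^ 6 * flux_const * n)"
  \<comment> \<open>With this choice \<open>K * flux_const * n * d\<close> is at most 1/4; dividing
    by \<open>c\<close>, which is at least 4, also keeps \<open>2 * d ^ 3\<close> below w.\<close>
  define d where "d = w ^ 7 / c"
  have cn: "0 \<le> 2 * 10 ^ 6 * flux_const * n" using flux_const_nonneg n by simp
  then have c4: "4 \<le> c" unfolding c_def by simp
  have w7: "0 < w ^ 7" "w ^ 7 \<le> w" using w power_decreasing[of 1 7 w] by auto
  have d0: "0 < d" using w7 c4 by (simp add: d_def)
  have "d \<le> w / 4" unfolding d_def using w7 c4 by (intro frac_le) auto
  then have d1: "d \<le> 1 / 4" "2 * d ^ 3 \<le> w"
  proof -
    assume dw: "d \<le> w / 4"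
    then show "d \<le> 1 / 4" using w by linarith
    then have "d ^ 3 \<le> d" using d0 power_decreasing[of 1 3 d] by simp
    then show "2 * d ^ 3 \<le> w" using dw w by linarith
  qed
  let ?F = "energy (1 - \<tau>) (2 + \<tau>)"
  have F0: "0 \<le> ?F" by (rule energy_nonneg)
  have EF: "energy (\<alpha> - 2 * d ^ 3) (\<beta> + 2 * d ^ 3) \<le> ?F"
    by (rule energy_mono) (use t tw d1(2) in \<open>simp_all add: \<alpha>_def \<beta>_def\<close>)
  have Th0: "0 \<le> \<Theta> r" for r using w by (simp add: \<Theta>_def)
  have Th1: "1 \<le> \<Theta> (x \<bullet> x)" if x: "x \<in> ann (1 - t) (2 + t)" for x :: "real^4"
  proof -
    define \<rho> where "\<rho> = norm x"
    have \<rho>: "w \<le> \<rho> - \<alpha>" "w \<le> \<beta> - \<rho>" "1 \<le> \<rho> + \<alpha>" "1 \<le> \<beta> + \<rho>"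
      using x t w tw unfolding \<rho>_def \<alpha>_def \<beta>_def ann_def by auto
    have "Q (x \<bullet> x) = ((\<rho> - \<alpha>) * (\<rho> + \<alpha>)) * ((\<beta> - \<rho>) * (\<beta> + \<rho>))"
      by (simp add: Q_def \<rho>_def dot_square_norm power2_eq_square algebra_simps)
    also have "\<dots> \<ge> (w * 1) * (w * 1)"
      using \<rho> w by (intro mult_mono) auto
    finally have "w\<^sup>2 \<le> max 0 (Q (x \<bullet> x))" by (simp add: power2_eq_square)
    then have "(w\<^sup>2) ^ 3 \<le> (max 0 (Q (x \<bullet> x))) ^ 3" by (intro power_mono) auto
    then show ?thesis unfolding \<Theta>_def using w6 by (simp add: field_simps flip: power_mult)
  qed
  have cTe: "continuous_on (- {0}) (\<lambda>x. \<Theta> (x \<bullet> x) * e x)" by (intro continuous_intros radial_continuous cA)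
  have "energy (1 - t) (2 + t) \<le> (LINT x:ann (1 - t) (2 + t)|lborel. \<Theta> (x \<bullet> x) * e x)"
    unfolding energy_def
  proof (intro set_integral_mono set_integrable_ann continuous_on_energy_density cTe)
    fix x assume "x \<in> ann (1 - t) (2 + t)"
    then show "e x \<le> \<Theta> (x \<bullet> x) * e x" using Th1[of x] energy_density_nonneg[of x] mult_right_mono[of 1 "\<Theta> (x \<bullet> x)" "e x"] by simp
  qed (use t in auto)
  also have "\<dots> \<le> (LINT x:D|lborel. \<Theta> (x \<bullet> x) * e x)"
    by (intro set_integral_mono_set set_integrable_ann ab cTe ann_mono mult_nonneg_nonneg Th0 energy_density_nonneg)
      (use w in \<open>auto simp: \<alpha>_def \<beta>_def\<close>)
  also have "\<dots> \<le> K * ((vol4 + 1) * n\<^sup>2 + n ^ 3 + flux_const * (d * n * (energy (\<alpha> - 2 * d ^ 3) (\<beta> + 2 * d ^ 3) + n\<^sup>2) + n ^ 3 / d + n\<^sup>2 + n ^ 3))"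
    unfolding energy_identity
    by (rule order_trans[OF abs_ge_self boundary_estimate[OF ab(1,2) d0 d1(1) n K0 cgD g clD L flux_zero]])
  also have "\<dots> \<le> K * ((vol4 + 1) * n\<^sup>2 + n ^ 3 + flux_const * (d * n * (?F + n\<^sup>2) + n ^ 3 / d + n\<^sup>2 + n ^ 3))"
    using EF d0 n flux_const_nonneg K0 vol4_nonneg by (intro mult_left_mono add_mono) auto
  also have "\<dots> = (K * flux_const * n * d) * (?F + n\<^sup>2) + K * ((vol4 + 1) * n\<^sup>2 + n ^ 3 + flux_const * (n\<^sup>2 + n ^ 3)) + K * (flux_const * (n ^ 3 / d))"
    by (simp add: algebra_simps)
  also have "\<dots> \<le> (1 / 2) * (?F + n\<^sup>2) + (2 * 10 ^ 6 / w ^ 13) * ((vol4 + 1) * n\<^sup>2 + n ^ 3 + flux_const * (n\<^sup>2 + n ^ 3)) + (2 * 10 ^ 6 / w ^ 13) * (flux_const * (n ^ 3 * c))"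
  proof (intro add_mono mult_right_mono)
    have "K * flux_const * n * d = w * ((2 * 10 ^ 6 * flux_const * n) / c)"
      using w by (simp add: K_def d_def power_eq_if)
    also have "\<dots> \<le> (1 / 4) * 1"
      using w cn c4 by (intro mult_mono) (auto simp: c_def)
    finally show "K * flux_const * n * d \<le> 1 / 2" by simp
    show "K \<le> 2 * 10 ^ 6 / w ^ 13"
      unfolding K_def using w power_decreasing[of 6 13 w] by (intro divide_left_mono) auto
    have "K * (flux_const * (n ^ 3 / d)) = (2 * 10 ^ 6 / w ^ 13) * (flux_const * (n ^ 3 * c))"
      using w by (simp add: K_def d_def flip: power_add)
    then show "K * (flux_const * (n ^ 3 / d)) \<le> (2 * 10 ^ 6 / w ^ 13) * (flux_const * (n ^ 3 * c))" by simp
    show "0 \<le> (vol4 + 1) * n\<^sup>2 + n ^ 3 + flux_const * (n\<^sup>2 + n ^ 3)"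
      using vol4_nonneg n flux_const_nonneg by simp
  qed (use F0 in auto)
  also have "\<dots> \<le> ?F / 2 + (2 * 10 ^ 6 / w ^ 13) * ((vol4 + 1) * n\<^sup>2 + n ^ 3 + n\<^sup>2 + flux_const * (n ^ 3 * c + n\<^sup>2 + n ^ 3))"
  proof -
    have "w ^ 13 \<le> 1" "0 < w ^ 13" using w by (auto intro: power_le_one)
    then have "1 / 2 \<le> 2 * 10 ^ 6 / w ^ 13" by (simp add: field_simps)
    then have "(1 / 2) * n\<^sup>2 \<le> (2 * 10 ^ 6 / w ^ 13) * n\<^sup>2" by (intro mult_right_mono) auto
    moreover have "(2 * 10 ^ 6 / w ^ 13) * ((vol4 + 1) * n\<^sup>2 + n ^ 3 + n\<^sup>2 + flux_const * (n ^ 3 * c + n\<^sup>2 + n ^ 3)) =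
      (2 * 10 ^ 6 / w ^ 13) * ((vol4 + 1) * n\<^sup>2 + n ^ 3 + flux_const * (n\<^sup>2 + n ^ 3)) + (2 * 10 ^ 6 / w ^ 13) * (flux_const * (n ^ 3 * c)) + (2 * 10 ^ 6 / w ^ 13) * n\<^sup>2"
      by (simp add: distrib_left add_ac)
    moreover have "(1 / 2) * (F + m) + X + Y \<le> F / 2 + Z" if "(1 / 2) * m \<le> W" "Z = X + Y + W" for F m X Y Z W :: real
      using that by simp
    ultimately show ?thesis by blast
  qed
  also have "(2 * 10 ^ 6 / w ^ 13) * ((vol4 + 1) * n\<^sup>2 + n ^ 3 + n\<^sup>2 + flux_const * (n ^ 3 * c + n\<^sup>2 + n ^ 3)) = nested_const n * 2 ^ 13 / (\<tau> - t) ^ 13"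
    by (simp add: nested_const_def c_def w_def power_divide)
  finally show ?thesis .
qed

text \<open>The a priori bound that \<open>absorption\<close> wants is the finite energy of the
  largest annulus, which is compact and off the origin. The result depends on \<open>n\<close>
  alone.\<close>

lemma energy_bound:
  assumes n: "0 < n" "cubic (1 / 8) 4 \<le> n ^ 3"
  shows "energy 1 2 \<le> 3 * (nested_const n * 2 ^ 13) * (8 * 13) ^ 13"
proof -
  have "0 \<le> nested_const n"
    unfolding nested_const_def using n vol4_nonneg flux_const_nonneg by simp
  moreover have "energy (1 - t) (2 + t) \<le> energy (1 / 2) (5 / 2)" if "0 \<le> t" "t \<le> 1 / 2" for t
    using that by (intro energy_mono) auto
  ultimately have "energy (1 - 0) (2 + 0) \<le> 3 * (nested_const n * 2 ^ 13) * (8 * real 13) ^ 13"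
    by (intro absorption[where f = "\<lambda>t. energy (1 - t) (2 + t)" and p = 13] nested_step n energy_nonneg) auto
  then show ?thesis by simp
qed

end

section \<open>Rescaling and the two ends\<close>

lemma GDERIV_scale:
  fixes f :: "'a::real_inner \<Rightarrow> real"
  assumes "GDERIV f (R *\<^sub>R x) :> D"
  shows "GDERIV (\<lambda>x. c * f (R *\<^sub>R x)) x :> (c * R) *\<^sub>R D"
proof -
  have 1: "((\<lambda>x. R *\<^sub>R x) has_derivative (\<lambda>h. R *\<^sub>R h)) (at x)"
    by (auto intro!: derivative_eq_intros)
  have "(f has_derivative (\<lambda>h. h \<bullet> D)) (at (R *\<^sub>R x))" using assms by (simp add: gderiv_def)
  from has_derivative_mult_right[OF has_derivative_compose[OF 1 this], of c]
  show ?thesis by (simp add: gderiv_def mult_ac)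
qed

lemma set_integral_ann_scale:
  assumes R: "0 < R" and a: "0 < a" and f: "continuous_on (- {0}) f"
  shows "(LINT x:ann (R * a) (R * b)|lborel. f x) = R ^ 4 * (LINT y:ann a b|lborel. f (R *\<^sub>R y))"
proof -
  let ?g = "\<lambda>x. indicator (ann (R * a) (R * b)) x *\<^sub>R f x"
  have g: "integrable lborel ?g"
    using set_integrable_ann[OF f, of "R * a" "R * b"] R a by (simp add: set_integrable_def)
  have "(LINT x|lborel. ?g x) = \<bar>R\<bar> ^ DIM(real^4) * (LINT y|lborel. ?g (0 + R *\<^sub>R y))"
    using R by (intro lborel_integral_affine g) simp
  also have "(\<lambda>y. ?g (0 + R *\<^sub>R y)) = (\<lambda>y. indicator (ann a b) y *\<^sub>R f (R *\<^sub>R y))"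
    using R by (auto simp: fun_eq_iff indicator_def ann_def)
  finally show ?thesis using R by (simp add: set_lebesgue_integral_def)
qed

lemma set_integral_restrict:
  fixes f :: "'a::euclidean_space \<Rightarrow> real"
  assumes "D' \<subseteq> D" "\<And>x. x \<in> D - D' \<Longrightarrow> f x = 0"
  shows "(LINT x:D|lborel. f x) = (LINT x:D'|lborel. f x)"
  unfolding set_lebesgue_integral_def
  by (rule Bochner_Integration.integral_cong) (use assms in \<open>auto simp: indicator_def\<close>)

text \<open>A nondecreasing C^2 step from 0 to 1 across the unit interval. Composing two truncated
  cubes makes both ends flat enough and leaves all derivatives to
  \<open>DERIV_pos_power\<close>.\<close>

definition ramp :: "real \<Rightarrow> real" where
  "ramp s = 1 - (max 0 (1 - (max 0 s) ^ 3)) ^ 3"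

definition ramp' :: "real \<Rightarrow> real" where
  "ramp' s = 9 * ((max 0 (1 - (max 0 s) ^ 3))\<^sup>2 * (max 0 s)\<^sup>2)"

definition ramp'' :: "real \<Rightarrow> real" where
  "ramp'' s = 9 * ((max 0 (1 - (max 0 s) ^ 3))\<^sup>2 * (2 * max 0 s) - 6 * max 0 (1 - (max 0 s) ^ 3) * (max 0 s)\<^sup>2 * (max 0 s)\<^sup>2)"

lemma DERIV_ramp: "DERIV ramp s :> ramp' s" and DERIV_ramp': "DERIV ramp' s :> ramp'' s"
proof -
  have p3: "DERIV (\<lambda>s. (max 0 s) ^ 3) s :> 3 * (max 0 s)\<^sup>2" for s :: real
    using DERIV_pos_power[of 1 s] by (simp add: numeral_eq_Suc)
  have p2: "DERIV (\<lambda>s. (max 0 s)\<^sup>2) s :> 2 * max 0 s" for s :: real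
    using DERIV_pos_power[of 0 s] by (simp add: numeral_eq_Suc)
  have y: "DERIV (\<lambda>s. 1 - (max 0 s) ^ 3) s :> - (3 * (max 0 s)\<^sup>2)"
    by (rule DERIV_cong[OF DERIV_diff[OF DERIV_const p3]]) simp
  have u3: "DERIV (\<lambda>s. (max 0 (1 - (max 0 s) ^ 3)) ^ 3) s :> 3 * (max 0 (1 - (max 0 s) ^ 3))\<^sup>2 * - (3 * (max 0 s)\<^sup>2)"
    by (rule DERIV_chain2[OF p3 y])
  have u2: "DERIV (\<lambda>s. (max 0 (1 - (max 0 s) ^ 3))\<^sup>2) s :> 2 * max 0 (1 - (max 0 s) ^ 3) * - (3 * (max 0 s)\<^sup>2)"
    by (rule DERIV_chain2[OF p2 y])
  show "DERIV ramp s :> ramp' s"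
    unfolding ramp_def[abs_def] ramp'_def by (rule DERIV_cong[OF DERIV_diff[OF DERIV_const u3]]) simp
  show "DERIV ramp' s :> ramp'' s"
    unfolding ramp'_def[abs_def] ramp''_def
    by (rule DERIV_cong[OF DERIV_cmult[OF DERIV_mult[OF u2 p2]]]) (simp add: algebra_simps)
qed

lemma ramp_low: "s \<le> 0 \<Longrightarrow> ramp s = 0 \<and> ramp' s = 0 \<and> ramp'' s = 0"
  by (simp add: ramp_def ramp'_def ramp''_def)

lemma ramp_high: "1 \<le> s \<Longrightarrow> ramp s = 1 \<and> ramp' s = 0 \<and> ramp'' s = 0"
proof -
  assume "1 \<le> s"
  then have "1 \<le> (max 0 s) ^ 3" by simp
  then have "max 0 (1 - (max 0 s) ^ 3) = 0" by simp
  then show ?thesis unfolding ramp_def ramp'_def ramp''_def by simp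
qed

lemma ramp'_nonneg: "0 \<le> ramp' s"
  unfolding ramp'_def by simp

lemma ramp_mono: "s \<le> t \<Longrightarrow> ramp s \<le> ramp t"
  using DERIV_nonneg_imp_nondecreasing[of s t ramp] DERIV_ramp ramp'_nonneg by blast

lemma ramp_bounds: "\<bar>ramp' s\<bar> \<le> 9" "\<bar>ramp'' s\<bar> \<le> 72"
proof -
  have "\<bar>ramp' s\<bar> \<le> 9 \<and> \<bar>ramp'' s\<bar> \<le> 72"
  proof (cases "0 \<le> s \<and> s \<le> 1")
    case False
    then show ?thesis using ramp_low[of s] ramp_high[of s] by auto
  next
    case True
    define p u where "p = max 0 s" and "u = max 0 (1 - (max 0 s) ^ 3)"
    have p: "0 \<le> p" "p \<le> 1" using True by (auto simp: p_def)
    have u: "0 \<le> u" "u \<le> 1" by (auto simp: u_def)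
    have p2: "0 \<le> p\<^sup>2" "p\<^sup>2 \<le> 1" and u2: "0 \<le> u\<^sup>2" "u\<^sup>2 \<le> 1" using p u by (auto intro: power_le_one)
    have m: "0 \<le> x * y" "x * y \<le> 1" if "0 \<le> x" "x \<le> 1" "0 \<le> y" "y \<le> 1" for x y :: real
      using that by (auto intro: mult_le_one)
    have "ramp' s = 9 * (u\<^sup>2 * p\<^sup>2)" by (simp add: ramp'_def p_def u_def)
    moreover have "ramp'' s = 18 * (u\<^sup>2 * p) - 54 * ((u * p\<^sup>2) * p\<^sup>2)" by (simp add: ramp''_def p_def u_def)
    ultimately show ?thesis
      using m[OF u2 p2] m[OF u2 p] m[OF m[OF u p2] p2] by (simp add: abs_le_iff)
  qed
  then show "\<bar>ramp' s\<bar> \<le> 9" "\<bar>ramp'' s\<bar> \<le> 72" by auto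
qed

text \<open>In terms of r = |x|^2, this rises from 0 at |x| = 5R/4 to 1 at |x| = 7R/4: 25/16 is
  (5/4)^2, and 2/3 is the reciprocal of (7/4)^2 - (5/4)^2.\<close>

definition annular_cut :: "real \<Rightarrow> real \<Rightarrow> real" where "annular_cut R r = ramp ((r / R\<^sup>2 - 25 / 16) * (2 / 3))"
definition annular_cut' :: "real \<Rightarrow> real \<Rightarrow> real" where "annular_cut' R r = ramp' ((r / R\<^sup>2 - 25 / 16) * (2 / 3)) * (2 / 3) / R\<^sup>2"
definition annular_cut'' :: "real \<Rightarrow> real \<Rightarrow> real" where "annular_cut'' R r = ramp'' ((r / R\<^sup>2 - 25 / 16) * (2 / 3)) * (2 / 3) ^ 2 / R ^ 4"

lemma DERIV_annular_cut: "R \<noteq> 0 \<Longrightarrow> DERIV (annular_cut R) r :> annular_cut' R r" and DERIV_annular_cut': "R \<noteq> 0 \<Longrightarrow> DERIV (annular_cut' R) r :> annular_cut'' R r"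
proof -
  assume R: "R \<noteq> 0"
  have i: "DERIV (\<lambda>r. (r / R\<^sup>2 - 25 / 16) * (2 / 3)) r :> (2 / 3) / R\<^sup>2"
    using R by (auto intro!: derivative_eq_intros simp: field_simps)
  show "DERIV (annular_cut R) r :> annular_cut' R r"
    unfolding annular_cut_def[abs_def] annular_cut'_def using DERIV_chain2[OF DERIV_ramp i] by simp
  show "DERIV (annular_cut' R) r :> annular_cut'' R r"
    unfolding annular_cut'_def[abs_def] annular_cut''_def
    by (rule DERIV_cong[OF DERIV_cdivide[OF DERIV_cmult_right[OF DERIV_chain2[OF DERIV_ramp' i]]]])
      (simp add: power2_eq_square power4_eq_xxxx)
qed

lemma continuous_annular_cut'': "R \<noteq> 0 \<Longrightarrow> continuous_on S (annular_cut'' R)"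
  unfolding annular_cut''_def[abs_def] ramp''_def by (intro continuous_intros) auto

lemma continuous_annular_cut': "R \<noteq> 0 \<Longrightarrow> continuous_on S (annular_cut' R)"
  by (intro continuous_at_imp_continuous_on ballI DERIV_isCont[OF DERIV_annular_cut'])

lemma annular_cut_low: "0 < R \<Longrightarrow> r \<le> (5 / 4 * R)\<^sup>2 \<Longrightarrow> annular_cut R r = 0 \<and> annular_cut' R r = 0 \<and> annular_cut'' R r = 0"
  using ramp_low[of "(r / R\<^sup>2 - 25 / 16) * (2 / 3)"]
  by (simp add: annular_cut_def annular_cut'_def annular_cut''_def field_simps power2_eq_square)

lemma annular_cut_high: "0 < R \<Longrightarrow> (7 / 4 * R)\<^sup>2 \<le> r \<Longrightarrow> annular_cut R r = 1 \<and> annular_cut' R r = 0 \<and> annular_cut'' R r = 0"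
  using ramp_high[of "(r / R\<^sup>2 - 25 / 16) * (2 / 3)"]
  by (simp add: annular_cut_def annular_cut'_def annular_cut''_def field_simps power2_eq_square)

lemma annular_cut_scale: "0 < R \<Longrightarrow> annular_cut' R (R\<^sup>2 * r) = annular_cut' 1 r / R\<^sup>2" "0 < R \<Longrightarrow> annular_cut'' R (R\<^sup>2 * r) = annular_cut'' 1 r / R ^ 4"
  by (simp_all add: annular_cut'_def annular_cut''_def)

lemma annular_cut_outside: "0 < R \<Longrightarrow> x \<notin> ann (5 / 4 * R) (7 / 4 * R) \<Longrightarrow> annular_cut' R (x \<bullet> x) = 0 \<and> annular_cut'' R (x \<bullet> x) = 0"
proof -
  assume R: "0 < R" and x: "x \<notin> ann (5 / 4 * R) (7 / 4 * R)"
  have "norm x \<le> 5 / 4 * R \<or> 7 / 4 * R \<le> norm x" using x by (auto simp: ann_def)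
  then show ?thesis
  proof
    assume "norm x \<le> 5 / 4 * R"
    then have "x \<bullet> x \<le> (5 / 4 * R)\<^sup>2" unfolding dot_square_norm by (intro power_mono) auto
    then show ?thesis using annular_cut_low[OF R] by blast
  next
    assume "7 / 4 * R \<le> norm x"
    then have "(7 / 4 * R)\<^sup>2 \<le> x \<bullet> x" unfolding dot_square_norm using R by (intro power_mono) auto
    then show ?thesis using annular_cut_high[OF R] by blast
  qed
qed

text \<open>Makes the difference of two such cutoffs a nonnegative cutoff for the region between
  them.\<close>

lemma annular_cut_antimono: "0 < \<epsilon> \<Longrightarrow> \<epsilon> \<le> R \<Longrightarrow> 0 \<le> r \<Longrightarrow> annular_cut R r \<le> annular_cut \<epsilon> r"
proof -
  assume h: "0 < \<epsilon>" "\<epsilon> \<le> R" "0 \<le> r"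
  have "\<epsilon>\<^sup>2 \<le> R\<^sup>2" using h by (intro power_mono) auto
  then have "r / R\<^sup>2 \<le> r / \<epsilon>\<^sup>2" using h by (intro divide_left_mono) auto
  then show ?thesis unfolding annular_cut_def by (intro ramp_mono) simp
qed

section \<open>Rescaled solutions and smallness of tails\<close>

context NS4
begin

text \<open>The natural scaling of the equations. It preserves the constant \<open>M\<close>: the
  cube contributes R^3, the volume R^-4, and the enlarged ball R. Hence every estimate at unit scale
  holds on all rescaled annuli with the same constants.\<close>

lemma scaled:
  assumes R: "0 < R"
  shows "NS4 (\<lambda>x. R *\<^sub>R U (R *\<^sub>R x)) (\<lambda>i x. R\<^sup>2 *\<^sub>R A i (R *\<^sub>R x)) (\<lambda>i j x. R ^ 3 *\<^sub>R B i j (R *\<^sub>R x))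
    (\<lambda>x. R\<^sup>2 * P (R *\<^sub>R x)) (\<lambda>x. R ^ 3 *\<^sub>R G (R *\<^sub>R x)) M"
proof unfold_locales
  have nz: "R *\<^sub>R x \<noteq> 0" if "x \<noteq> 0" for x :: "real^4" using that R by simp
  have img: "(\<lambda>x. R *\<^sub>R x) ` (- {0}) \<subseteq> - {0::real^4}" using R by auto
  show "GDERIV (\<lambda>x. (R *\<^sub>R U (R *\<^sub>R x)) $ i) x :> R\<^sup>2 *\<^sub>R A i (R *\<^sub>R x)" if "x \<noteq> 0" for i x
    using GDERIV_scale[OF dU[OF nz[OF that]], of R] by (simp add: power2_eq_square)
  show "GDERIV (\<lambda>x. (R\<^sup>2 *\<^sub>R A i (R *\<^sub>R x)) $ j) x :> R ^ 3 *\<^sub>R B i j (R *\<^sub>R x)" if "x \<noteq> 0" for i j x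
    using GDERIV_scale[OF dA[OF nz[OF that]], of "R\<^sup>2"] by (simp add: power2_eq_square power3_eq_cube)
  show "GDERIV (\<lambda>x. R\<^sup>2 * P (R *\<^sub>R x)) x :> R ^ 3 *\<^sub>R G (R *\<^sub>R x)" if "x \<noteq> 0" for x
    using GDERIV_scale[OF dP[OF nz[OF that]], of "R\<^sup>2"] by (simp add: power2_eq_square power3_eq_cube)
  show "continuous_on (- {0}) (\<lambda>x. R ^ 3 *\<^sub>R B i j (R *\<^sub>R x))" for i j
    by (intro continuous_intros continuous_on_compose2[OF cB _ img])
  show "continuous_on (- {0}) (\<lambda>x. R ^ 3 *\<^sub>R G (R *\<^sub>R x))"
    by (intro continuous_intros continuous_on_compose2[OF cG _ img])
  show "(R ^ 3 *\<^sub>R G (R *\<^sub>R x)) $ i = (\<Sum>j\<in>UNIV. (R ^ 3 *\<^sub>R B i j (R *\<^sub>R x)) $ j)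
      - (\<Sum>j\<in>UNIV. (R *\<^sub>R U (R *\<^sub>R x)) $ j * (R\<^sup>2 *\<^sub>R A i (R *\<^sub>R x)) $ j)" if "x \<noteq> 0" for i x
    unfolding vector_scaleR_component real_scaleR_def momentum[OF nz[OF that]] right_diff_distrib sum_distrib_left
    by (simp add: power2_eq_square power3_eq_cube mult_ac)
  show "(\<Sum>i\<in>UNIV. (R\<^sup>2 *\<^sub>R A i (R *\<^sub>R x)) $ i) = 0" if "x \<noteq> 0" for x
    using incompressible[OF nz[OF that]] by (simp flip: sum_distrib_left)
  show "(\<integral>\<^sup>+x\<in>ball 0 \<rho>. ennreal (norm (R *\<^sub>R U (R *\<^sub>R x)) ^ 3) \<partial>lborel) \<le> ennreal (M * \<rho>)" if \<rho>: "0 < \<rho>" for \<rho>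
  proof -
    let ?f = "\<lambda>y. ennreal (norm (U y) ^ 3) * indicator (ball 0 (\<rho> * R)) y"
    have [measurable]: "ball (0::real^4) (\<rho> * R) \<in> sets borel" by simp
    have m: "?f \<in> borel_measurable borel" by measurable
    have eq: "ennreal (norm (R *\<^sub>R U (R *\<^sub>R x)) ^ 3) * indicator (ball 0 \<rho>) x = ennreal (R ^ 3) * ?f (0 + R *\<^sub>R x)" for x
      using R by (auto simp: power_mult_distrib ennreal_mult' indicator_def field_simps)
    \<comment> \<open>Multiplying by R turns R^3 into the Jacobian R^4; the factor is cancelled at
      the end.\<close>
    have "ennreal R * (\<integral>\<^sup>+x\<in>ball 0 \<rho>. ennreal (norm (R *\<^sub>R U (R *\<^sub>R x)) ^ 3) \<partial>lborel) =
        ennreal R * (ennreal (R ^ 3) * (\<integral>\<^sup>+x. ?f (0 + R *\<^sub>R x) \<partial>lborel))"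
    proof -
      have "(\<lambda>x. ?f (0 + R *\<^sub>R x)) \<in> borel_measurable lborel"
        by (rule measurable_compose[OF _ m]) simp
      then show ?thesis unfolding eq by (subst nn_integral_cmult) auto
    qed
    also have "\<dots> = ennreal (\<bar>R\<bar> ^ DIM(real^4)) * (\<integral>\<^sup>+x. ?f (0 + R *\<^sub>R x) \<partial>lborel)"
      using R by (simp add: ennreal_mult' power_numeral_reduce flip: mult.assoc ennreal_mult')
    also have "\<dots> = (\<integral>\<^sup>+y. ?f y \<partial>lborel)"
      using nn_integral_lborel_affine[OF m, of R 0] R by simp
    also have "\<dots> \<le> ennreal (M * (\<rho> * R))" by (rule morrey) (use R \<rho> in simp)
    also have "\<dots> = ennreal R * ennreal (M * \<rho>)" using R by (simp add: mult_ac flip: ennreal_mult')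
    finally show ?thesis using R by (subst (asm) ennreal_mult_le_mult_iff) auto
  qed
qed (rule M_nonneg)

text \<open>The hypothesis concerns open balls, so a closed annulus asks for a strictly larger
  radius \<open>c\<close>.\<close>

lemma cubic_le:
  assumes "0 < a" "a \<le> b" "b < c"
  shows "cubic a b \<le> M * c"
proof -
  have c_pos: "0 < c" using assms by linarith
  have i: "integrable lborel (\<lambda>x. indicator (ann a b) x *\<^sub>R norm (U x) ^ 3)"
    using set_integrable_ann[OF continuous_on_cube assms(1)] by (simp add: set_integrable_def)
  have "ennreal (cubic a b) = (\<integral>\<^sup>+x. ennreal (indicator (ann a b) x *\<^sub>R norm (U x) ^ 3) \<partial>lborel)"
    unfolding cubic_def set_lebesgue_integral_def by (rule nn_integral_eq_integral[OF i, symmetric]) auto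
  also have "\<dots> \<le> (\<integral>\<^sup>+x\<in>ball 0 c. ennreal (norm (U x) ^ 3) \<partial>lborel)"
    by (intro nn_integral_mono) (use assms in \<open>auto simp: ann_def indicator_def\<close>)
  also have "\<dots> \<le> ennreal (M * c)" by (rule morrey[OF c_pos])
  finally show ?thesis using M_nonneg c_pos by (simp add: ennreal_le_iff)
qed

end

text \<open>The bound of \<open>boundary_estimate\<close> with K = 600 and d = 1/4, with
  \<open>e\<close> in place of the energy.\<close>

definition boundary_const :: "real \<Rightarrow> real \<Rightarrow> real" where
  "boundary_const n e = 600 * ((vol4 + 1) * n\<^sup>2 + n ^ 3 + flux_const * (1 / 4 * n * (e + n\<^sup>2) + n ^ 3 / (1 / 4) + n\<^sup>2 + n ^ 3))"

text \<open>Every term, including the one with the energy, carries a factor \<open>n\<close>. Small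
  \<open>n\<close> thus makes the boundary terms small while the energy is merely bounded.\<close>

lemma boundary_const_le:
  assumes "0 < n" "n \<le> 1" "0 \<le> e"
  shows "boundary_const n e \<le> n * boundary_const 1 e"
proof -
  have p: "n\<^sup>2 \<le> n" "n ^ 3 \<le> n"
    using assms power_decreasing[of 1 2 n] power_decreasing[of 1 3 n] by auto
  have "boundary_const n e \<le> 600 * ((vol4 + 1) * n + n + flux_const * (1 / 4 * n * (e + 1) + n / (1 / 4) + n + n))"
    unfolding boundary_const_def
    by (intro mult_left_mono add_mono divide_right_mono p) (use assms p vol4_nonneg flux_const_nonneg in auto)
  also have "\<dots> = n * boundary_const 1 e"
    by (simp add: boundary_const_def algebra_simps)
  finally show ?thesis .
qed

text \<open>Pick an annulus whose integral is within \<delta> of the supremum. Any disjoint annulus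
  can be joined to it inside a larger one, so its own integral is less than \<delta>.\<close>

lemma small_tails:
  fixes T :: "real ^ 4 \<Rightarrow> real"
  assumes T: "continuous_on (- {0}) T" "\<And>x. 0 \<le> T x"
    and C: "\<And>a b. 0 < a \<Longrightarrow> a \<le> b \<Longrightarrow> (LINT x:ann a b|lborel. T x) \<le> C" and \<delta>: "0 < \<delta>"
  obtains p r where "0 < p" "0 < r"
    "\<And>c d. 0 < c \<Longrightarrow> c \<le> d \<Longrightarrow> d < p \<or> r < c \<Longrightarrow> (LINT x:ann c d|lborel. T x) < \<delta>"
proof -
  let ?I = "\<lambda>a b. LINT x:ann a b|lborel. T x"
  let ?S = "{?I a b | a b. 0 < a \<and> a \<le> b}"
  have bdd: "bdd_above ?S" using C by (auto intro!: bdd_aboveI[of _ C])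
  have "?I 1 1 \<in> ?S" by force
  then have ne: "?S \<noteq> {}" by blast
  have "Sup ?S - \<delta> < Sup ?S" using \<delta> by simp
  then obtain a b where ab: "0 < a" "a \<le> b" "Sup ?S - \<delta> < ?I a b"
    using less_cSup_iff[OF ne bdd] by blast
  have "?I c d < \<delta>" if cd: "0 < c" "c \<le> d" "d < a \<or> b < c" for c d
  proof -
    define m where "m = min a c"
    define M where "M = max b d"
    have m: "0 < m" "m \<le> M" "m \<le> a" "m \<le> c" "b \<le> M" "d \<le> M" using ab cd by (auto simp: m_def M_def)
    have disj: "ann a b \<inter> ann c d = {}" using cd by (auto simp: ann_def)
    have i: "set_integrable lborel (ann u v) T" if "0 < u" for u v
      by (rule set_integrable_ann[OF T(1) that])
    have "?I a b + ?I c d = (LINT x:ann a b \<union> ann c d|lborel. T x)"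
      using ab cd by (intro set_integral_Un[symmetric] disj i) auto
    also have "\<dots> \<le> ?I m M"
      using m by (intro set_integral_mono_set i T(2)) (auto simp: ann_def)
    also have "\<dots> \<le> Sup ?S" using m bdd by (intro cSup_upper) auto
    finally show ?thesis using ab(3) by linarith
  qed
  then show ?thesis using ab by (intro that[of a b]) auto
qed

section \<open>Boundary terms of a cutoff at one radius\<close>

context NS4
begin

text \<open>The Laplacian of \<open>annular_cut R (x \<bullet> x)\<close> in dimension four, as it
  occurs in \<open>energy_identity\<close>.\<close>

definition cut_laplacian :: "real \<Rightarrow> real ^ 4 \<Rightarrow> real" where
  "cut_laplacian R x = 8 * annular_cut' R (x \<bullet> x) + 4 * (annular_cut'' R (x \<bullet> x) * (x \<bullet> x))"

definition cut_flux :: "real \<Rightarrow> real ^ 4 \<Rightarrow> real" where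
  "cut_flux R x = 2 * annular_cut' R (x \<bullet> x) * (x \<bullet> U x)"

abbreviation "shell R \<equiv> ann (R * (5 / 4)) (R * (7 / 4))"

text \<open>The right side of \<open>energy_identity\<close> formed with
  \<open>annular_cut R\<close> alone. This cutoff equals 1 far out, so only differences of two such
  terms are covered by the identity.\<close>

definition boundary_term :: "real \<Rightarrow> real" where
  "boundary_term R = (LINT x:shell R|lborel. (U x \<bullet> U x) / 2 * cut_laplacian R x) + (LINT x:shell R|lborel. cut_flux R x * ((U x \<bullet> U x) / 2))
     + (LINT x:shell R|lborel. cut_flux R x * P x)"

definition mass_flux :: "real \<Rightarrow> real" where "mass_flux R = (LINT x:shell R|lborel. cut_flux R x)"

definition hardy_boundary :: "real \<Rightarrow> real" where "hardy_boundary R = (LINT x:shell R|lborel. \<bar>annular_cut' R (x \<bullet> x)\<bar> * (U x \<bullet> U x))"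

text \<open>In dimension four the integral of this density is invariant under
  \<open>scaled\<close>.\<close>

definition hardy_density :: "real ^ 4 \<Rightarrow> real" where "hardy_density x = (\<Sum>i\<in>UNIV. A i x \<bullet> A i x) + (U x \<bullet> U x) / (x \<bullet> x)"

lemma continuous_on_annular_cut:
  assumes "R \<noteq> 0"
  shows "continuous_on S (\<lambda>x::real^4. annular_cut' R (x \<bullet> x))" "continuous_on S (\<lambda>x::real^4. annular_cut'' R (x \<bullet> x))"
  using assms by (auto intro!: continuous_on_compose2[OF continuous_annular_cut'[of R UNIV]] continuous_on_compose2[OF continuous_annular_cut''[of R UNIV]] continuous_intros)

lemma continuous_on_cut_terms: "R \<noteq> 0 \<Longrightarrow> continuous_on (- {0}) (cut_laplacian R)" "R \<noteq> 0 \<Longrightarrow> continuous_on (- {0}) (cut_flux R)"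
  unfolding cut_laplacian_def[abs_def] cut_flux_def[abs_def] by (intro continuous_intros continuous_on_annular_cut cU; simp)+

lemma continuous_on_hardy_density: "continuous_on (- {0}) hardy_density"
  unfolding hardy_density_def[abs_def] by (intro continuous_intros cU cA) auto

lemma hardy_density_nonneg: "0 \<le> hardy_density x"
  unfolding hardy_density_def using energy_density_nonneg[of x] by simp

lemma unit_cut_bounds:
  assumes x: "x \<in> shell 1"
  shows "\<bar>cut_laplacian 1 x\<bar> \<le> 600" "\<bar>cut_flux 1 x\<bar> \<le> 600 * norm (U x)" "\<bar>annular_cut' 1 (x \<bullet> x)\<bar> \<le> 6"
proof -
  have nx: "norm x \<le> 7 / 4" using x by (simp add: ann_def)
  have xx: "0 \<le> x \<bullet> x" "x \<bullet> x \<le> 4" using power_mono[OF nx norm_ge_zero, of 2] by (auto simp: dot_square_norm power_divide)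
  show c: "\<bar>annular_cut' 1 (x \<bullet> x)\<bar> \<le> 6" using ramp_bounds(1) by (simp add: annular_cut'_def abs_mult)
  have c2: "\<bar>annular_cut'' 1 (x \<bullet> x)\<bar> \<le> 32" using ramp_bounds(2) by (simp add: annular_cut''_def abs_mult power_divide)
  have "\<bar>annular_cut'' 1 (x \<bullet> x) * (x \<bullet> x)\<bar> \<le> 32 * 4" unfolding abs_mult using c2 xx by (intro mult_mono) auto
  \<comment> \<open>8 * 6 + 4 * 128 = 560, rounded up to 600.\<close>
  then show "\<bar>cut_laplacian 1 x\<bar> \<le> 600" using c unfolding cut_laplacian_def by linarith
  have "\<bar>x \<bullet> U x\<bar> \<le> (7 / 4) * norm (U x)"
    using Cauchy_Schwarz_ineq2[of x "U x"] mult_right_mono[OF nx, of "norm (U x)"] by simp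
  then have "\<bar>2 * annular_cut' 1 (x \<bullet> x) * (x \<bullet> U x)\<bar> \<le> 2 * 6 * ((7 / 4) * norm (U x))"
    unfolding abs_mult using c by (intro mult_mono) auto
  also have "\<dots> \<le> 600 * norm (U x)" by simp
  finally show "\<bar>cut_flux 1 x\<bar> \<le> 600 * norm (U x)" by (simp add: cut_flux_def)
qed

lemma unit_boundary_bounds:
  assumes n: "0 < n" "cubic (1 / 8) 4 \<le> n ^ 3"
  shows "mass_flux 1 = 0 \<Longrightarrow> energy 1 2 \<le> e \<Longrightarrow> \<bar>boundary_term 1\<bar> \<le> boundary_const n e"
    and "\<bar>mass_flux 1\<bar> \<le> 600 * ((vol4 + 1) * n)"
    and "hardy_boundary 1 \<le> 600 * ((vol4 + 1) * n\<^sup>2)"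
proof -
  have N: "cubic (5 / 4) (7 / 4) \<le> n ^ 3" by (rule order_trans[OF cubic_mono n(2)]) auto
  have r: "shell 1 = ann (5 / 4) (7 / 4)" by simp
  note b = unit_cut_bounds[unfolded r]
  show "\<bar>boundary_term 1\<bar> \<le> boundary_const n e" if "mass_flux 1 = 0" and e: "energy 1 2 \<le> e"
  proof -
    \<comment> \<open>With d = 1/4 the annulus is enlarged by 1/32, so the energy needed is that
      between radii 1 and 2.\<close>
    have "\<bar>boundary_term 1\<bar> \<le> 600 * ((vol4 + 1) * n\<^sup>2 + n ^ 3 + flux_const * (1 / 4 * n * (energy (5 / 4 - 2 * (1 / 4) ^ 3) (7 / 4 + 2 * (1 / 4) ^ 3) + n\<^sup>2) + n ^ 3 / (1 / 4) + n\<^sup>2 + n ^ 3))"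
      unfolding boundary_term_def r
      by (rule boundary_estimate) (use n that(1) b continuous_on_cut_terms in \<open>auto simp: mass_flux_def r\<close>)
    also have "\<dots> \<le> boundary_const n e"
    proof -
      have "energy (5 / 4 - 2 * (1 / 4) ^ 3) (7 / 4 + 2 * (1 / 4) ^ 3) \<le> e"
        by (rule order_trans[OF energy_mono e]) (auto simp: power_divide)
      then show ?thesis
        unfolding boundary_const_def using n vol4_nonneg flux_const_nonneg by (intro mult_left_mono add_mono) auto
    qed
    finally show ?thesis .
  qed
  have "\<bar>mass_flux 1\<bar> \<le> (LINT x:ann (5 / 4) (7 / 4)|lborel. 600 * norm (U x))"
    unfolding mass_flux_def r by (intro set_integral_abs_le set_integrable_ann continuous_on_cut_terms b continuous_intros cU) auto
  also have "\<dots> = 600 * (LINT x:ann (5 / 4) (7 / 4)|lborel. norm (U x))" by simp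
  also have "\<dots> \<le> 600 * ((vol4 + 1) * n)" by (intro mult_left_mono first_integral_le n N) auto
  finally show "\<bar>mass_flux 1\<bar> \<le> 600 * ((vol4 + 1) * n)" .
  have "hardy_boundary 1 \<le> (LINT x:ann (5 / 4) (7 / 4)|lborel. 600 * (norm (U x))\<^sup>2)"
    unfolding hardy_boundary_def r
  proof (intro set_integral_mono set_integrable_ann continuous_intros cU continuous_on_annular_cut)
    fix x assume "x \<in> ann (5 / 4) (7 / 4)"
    then show "\<bar>annular_cut' 1 (x \<bullet> x)\<bar> * (U x \<bullet> U x) \<le> 600 * (norm (U x))\<^sup>2"
      using b(3)[of x] unfolding dot_square_norm by (intro mult_right_mono) auto
  qed auto
  also have "\<dots> = 600 * (LINT x:ann (5 / 4) (7 / 4)|lborel. (norm (U x))\<^sup>2)" by simp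
  also have "\<dots> \<le> 600 * ((vol4 + 1) * n\<^sup>2)" by (intro mult_left_mono square_integral_le n N) auto
  finally show "hardy_boundary 1 \<le> 600 * ((vol4 + 1) * n\<^sup>2)" .
qed

text \<open>256 = 4^4 belongs to the level with \<sigma> = 1/4, 16 is the maximum of |x|^2 on the
  inner annulus, and 6 rounds up 86/16.\<close>

definition tail_const :: "real \<Rightarrow> real" where "tail_const n = 16 * (256 * level_const * n) + 6 * level_const * n"

lemma tail_const_pos: "0 < n \<Longrightarrow> 0 < tail_const n"
  unfolding tail_const_def using level_const by (auto intro!: add_pos_pos mult_pos_pos)

text \<open>Small tails force a small cubic integral: below the level \<mu> one factor of the cube
  is at most \<mu> and the rest is a Hardy term, above it \<open>cube_tail\<close> gives the
  energy.\<close>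

lemma cubic_small:
  assumes n: "0 < n" "cubic (1 / 16) 8 \<le> n ^ 3"
  shows "cubic (1 / 8) 4 \<le> tail_const n * (LINT x:ann (1 / 16) 8|lborel. hardy_density x)"
proof -
  let ?T = "LINT x:ann (1 / 16) 8|lborel. hardy_density x"
  define \<mu> where "\<mu> = level_const * n / (1 / 4) ^ 4"
  have mu: "0 \<le> \<mu>" using level_const n by (simp add: \<mu>_def)
  let ?t = "\<lambda>x. if \<mu> < norm (U x) then norm (U x) ^ 3 else 0"
  have iT: "set_integrable lborel (ann (1 / 16) 8) hardy_density" by (rule set_integrable_ann[OF continuous_on_hardy_density]) simp
  have ch: "continuous_on (- {0}) (\<lambda>x. (U x \<bullet> U x) / (x \<bullet> x))" by (intro continuous_intros cU) auto
  have i2: "set_integrable lborel (ann (1 / 8) 4) (\<lambda>x. 16 * \<mu> * ((U x \<bullet> U x) / (x \<bullet> x)))"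
    by (intro set_integrable_mult_right set_integrable_ann ch) auto
  have i3: "set_integrable lborel (ann (1 / 8) 4) ?t" by (rule set_integrable_tail) simp
  have "cubic (1 / 8) 4 \<le> (LINT x:ann (1 / 8) 4|lborel. 16 * \<mu> * ((U x \<bullet> U x) / (x \<bullet> x)) + ?t x)"
    unfolding cubic_def
  proof (intro set_integral_mono set_integral_add(1) i2 i3 set_integrable_ann continuous_on_cube)
    fix x assume x: "x \<in> ann (1 / 8) 4"
    then have x0: "0 < x \<bullet> x" "x \<bullet> x \<le> 16"
      using ann_nonzero[of "1/8" 4] power_mono[of "norm x" 4 2] by (auto simp: dot_square_norm ann_def)
    have "\<mu> * (norm (U x))\<^sup>2 \<le> 16 * \<mu> * ((U x \<bullet> U x) / (x \<bullet> x))"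
    proof -
      have "(U x \<bullet> U x) * (x \<bullet> x) \<le> (U x \<bullet> U x) * 16" using x0 by (intro mult_left_mono) auto
      then have "(norm (U x))\<^sup>2 \<le> 16 * ((U x \<bullet> U x) / (x \<bullet> x))" using x0 by (simp add: dot_square_norm field_simps)
      then have "\<mu> * (norm (U x))\<^sup>2 \<le> \<mu> * (16 * ((U x \<bullet> U x) / (x \<bullet> x)))" using mu by (intro mult_left_mono)
      then show ?thesis by (simp add: mult_ac)
    qed
    moreover have "norm (U x) ^ 3 \<le> \<mu> * (norm (U x))\<^sup>2" if "\<not> \<mu> < norm (U x)"
      using mult_right_mono[of "norm (U x)" \<mu> "(norm (U x))\<^sup>2"] that by (simp add: power2_eq_square power3_eq_cube)
    moreover have "0 \<le> 16 * \<mu> * ((U x \<bullet> U x) / (x \<bullet> x))" using mu by simp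
    ultimately show "norm (U x) ^ 3 \<le> 16 * \<mu> * ((U x \<bullet> U x) / (x \<bullet> x)) + ?t x" by auto
  qed auto
  also have "\<dots> = 16 * \<mu> * (LINT x:ann (1 / 8) 4|lborel. (U x \<bullet> U x) / (x \<bullet> x)) + (LINT x:ann (1 / 8) 4|lborel. ?t x)"
    by (simp only: set_integral_add(2)[OF i2 i3] set_integral_mult_right)
  also have "\<dots> \<le> 16 * \<mu> * ?T + 6 * level_const * n * ?T"
  proof (intro add_mono mult_left_mono)
    have "(LINT x:ann (1 / 8) 4|lborel. (U x \<bullet> U x) / (x \<bullet> x)) \<le> (LINT x:ann (1 / 16) 8|lborel. (U x \<bullet> U x) / (x \<bullet> x))"
      by (intro set_integral_mono_set set_integrable_ann ch ann_mono) auto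
    also have "\<dots> \<le> ?T"
      by (intro set_integral_mono iT set_integrable_ann ch) (auto simp: hardy_density_def energy_density_nonneg)
    finally show "(LINT x:ann (1 / 8) 4|lborel. (U x \<bullet> U x) / (x \<bullet> x)) \<le> ?T" .
    have "(LINT x:ann (1 / 8) 4|lborel. ?t x) \<le> 86 * level_const * n * (1 / 4)\<^sup>2 * energy (1 / 8 - (1 / 4) ^ 3) (4 + (1 / 4) ^ 3)"
    proof (rule cube_tail[OF _ _ n(1) _ _ \<mu>_def])
      show "cubic (1 / 8 - (1 / 4) ^ 3) (4 + (1 / 4) ^ 3) \<le> n ^ 3"
        by (rule order_trans[OF cubic_mono n(2)]) (auto simp: power_divide)
    qed (auto simp: power_divide)
    also have "\<dots> \<le> 6 * level_const * n * ?T"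
    proof -
      have "energy (1 / 8 - (1 / 4) ^ 3) (4 + (1 / 4) ^ 3) \<le> energy (1 / 16) 8" by (rule energy_mono) (auto simp: power_divide)
      also have "\<dots> \<le> ?T"
        unfolding energy_def by (intro set_integral_mono iT set_integrable_ann continuous_on_energy_density) (auto simp: hardy_density_def)
      finally have "86 / 16 * energy (1 / 8 - (1 / 4) ^ 3) (4 + (1 / 4) ^ 3) \<le> 6 * ?T"
        using energy_nonneg[of "1 / 8 - (1 / 4) ^ 3" "4 + (1 / 4) ^ 3"] by linarith
      then have "(level_const * n) * (86 / 16 * energy (1 / 8 - (1 / 4) ^ 3) (4 + (1 / 4) ^ 3)) \<le> (level_const * n) * (6 * ?T)"
        using level_const n by (intro mult_left_mono) auto
      then show ?thesis by (simp add: power_divide mult_ac)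
    qed
    finally show "(LINT x:ann (1 / 8) 4|lborel. ?t x) \<le> 6 * level_const * n * ?T" .
  qed (use mu in auto)
  also have "\<dots> = tail_const n * ?T" by (simp add: tail_const_def \<mu>_def algebra_simps power_divide)
  finally show ?thesis .
qed

text \<open>Energy, Hardy integral and boundary terms are invariant. Only \<open>cubic\<close> and
  \<open>mass_flux\<close> change, by 1 / R and 1 / R^2; the second power is what kills the flux in
  \<open>mass_flux_zero\<close>.\<close>

lemma scaling_identities:
  assumes R: "0 < R" and a: "0 < a"
  defines "U' \<equiv> \<lambda>x. R *\<^sub>R U (R *\<^sub>R x)" and "A' \<equiv> \<lambda>i x. R\<^sup>2 *\<^sub>R A i (R *\<^sub>R x)" and "P' \<equiv> \<lambda>x. R\<^sup>2 * P (R *\<^sub>R x)"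
  shows "NS4.energy A' a b = energy (R * a) (R * b)"
    and "NS4.cubic U' a b = cubic (R * a) (R * b) / R"
    and "(LINT x:ann a b|lborel. NS4.hardy_density U' A' x) = (LINT x:ann (R * a) (R * b)|lborel. hardy_density x)"
    and "NS4.mass_flux U' 1 = mass_flux R / R\<^sup>2"
    and "NS4.hardy_boundary U' 1 = hardy_boundary R"
    and "NS4.boundary_term U' P' 1 = boundary_term R"
proof -
  interpret S: NS4 U' A' "\<lambda>i j x. R ^ 3 *\<^sub>R B i j (R *\<^sub>R x)" P' "\<lambda>x. R ^ 3 *\<^sub>R G (R *\<^sub>R x)" M
    unfolding U'_def A'_def P'_def by (rule scaled[OF R])
  have R0: "R \<noteq> 0" using R by simp
  have RR: "(R *\<^sub>R x) \<bullet> (R *\<^sub>R x) = R\<^sup>2 * (x \<bullet> x)" for x :: "real^4" by (simp add: power2_eq_square)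
  have UU: "U' x \<bullet> U' x = R\<^sup>2 * (U (R *\<^sub>R x) \<bullet> U (R *\<^sub>R x))" for x by (simp add: U'_def power2_eq_square)
  have eU: "R ^ 3 * norm (U (R *\<^sub>R y)) ^ 3 = norm (U' y) ^ 3" for y using R by (simp add: U'_def power_mult_distrib)
  have eA: "R ^ 4 * (\<Sum>i\<in>UNIV. A i (R *\<^sub>R y) \<bullet> A i (R *\<^sub>R y)) = (\<Sum>i\<in>UNIV. A' i y \<bullet> A' i y)" for y
    by (simp add: A'_def sum_distrib_left power2_eq_square power4_eq_xxxx mult_ac)
  \<comment> \<open>The change of variables reduces each identity to a pointwise one with Jacobian
    R^4.\<close>
  have gen: "(LINT x:ann (R * a) (R * b)|lborel. f x) = c * (LINT y:ann a b|lborel. h y)"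
    if "0 < a" "continuous_on (- {0}) f" "\<And>y. y \<in> ann a b \<Longrightarrow> R ^ 4 * f (R *\<^sub>R y) = c * h y" for f h :: "real^4 \<Rightarrow> real" and a b c
  proof -
    have "(LINT x:ann (R * a) (R * b)|lborel. f x) = R ^ 4 * (LINT y:ann a b|lborel. f (R *\<^sub>R y))"
      by (rule set_integral_ann_scale[OF R that(1,2)])
    also have "\<dots> = (LINT y:ann a b|lborel. R ^ 4 * f (R *\<^sub>R y))" by simp
    also have "\<dots> = (LINT y:ann a b|lborel. c * h y)" by (intro set_lebesgue_integral_cong) (auto simp: that(3))
    finally show ?thesis by simp
  qed
  show "S.energy a b = energy (R * a) (R * b)"
    unfolding energy_def S.energy_def using gen[OF a continuous_on_energy_density, where c = 1, OF _] eA by simp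
  show "S.cubic a b = cubic (R * a) (R * b) / R"
  proof -
    have "cubic (R * a) (R * b) = R * S.cubic a b"
      unfolding cubic_def S.cubic_def
    proof (rule gen[OF a continuous_on_cube])
      fix y
      have "R ^ 4 * norm (U (R *\<^sub>R y)) ^ 3 = R * (R ^ 3 * norm (U (R *\<^sub>R y)) ^ 3)"
        by (simp add: power4_eq_xxxx power3_eq_cube)
      then show "R ^ 4 * norm (U (R *\<^sub>R y)) ^ 3 = R * norm (U' y) ^ 3" by (simp only: eU)
    qed
    then show ?thesis using R by simp
  qed
  show "(LINT x:ann a b|lborel. S.hardy_density x) = (LINT x:ann (R * a) (R * b)|lborel. hardy_density x)"
  proof -
    have "(LINT x:ann (R * a) (R * b)|lborel. hardy_density x) = 1 * (LINT x:ann a b|lborel. S.hardy_density x)"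
    proof (rule gen[OF a continuous_on_hardy_density])
      fix y assume "y \<in> ann a b"
      then have "y \<bullet> y \<noteq> 0" using ann_nonzero[OF a] by auto
      then show "R ^ 4 * hardy_density (R *\<^sub>R y) = 1 * S.hardy_density y"
        unfolding hardy_density_def S.hardy_density_def distrib_left eA UU RR using R by (simp add: field_simps power2_eq_square power4_eq_xxxx)
    qed
    then show ?thesis by simp
  qed
  have c1: "annular_cut' R (R\<^sup>2 * r) = annular_cut' 1 r / R\<^sup>2" "annular_cut'' R (R\<^sup>2 * r) = annular_cut'' 1 r / R ^ 4" for r
    using annular_cut_scale[OF R] by auto
  have R4: "R ^ 4 = R\<^sup>2 * R\<^sup>2" by (simp flip: power_add)
  have ejl: "R\<^sup>2 * cut_laplacian R (R *\<^sub>R y) = S.cut_laplacian 1 y" for y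
  proof -
    have "R\<^sup>2 * (8 * (u / R\<^sup>2) + 4 * (v / R ^ 4 * (R\<^sup>2 * w))) = 8 * u + 4 * (v * w)" for u v w
      using R0 by (simp add: distrib_left power2_eq_square power4_eq_xxxx)
    then show ?thesis unfolding cut_laplacian_def S.cut_laplacian_def RR c1 .
  qed
  have ejg: "R\<^sup>2 * cut_flux R (R *\<^sub>R y) = S.cut_flux 1 y" for y
    unfolding cut_flux_def S.cut_flux_def RR c1 unfolding U'_def using R0 by (simp add: power2_eq_square)
  have a5: "0 < (5 / 4 :: real)" by simp
  show "S.mass_flux 1 = mass_flux R / R\<^sup>2"
  proof -
    have "mass_flux R = R\<^sup>2 * (LINT x:ann (5 / 4) (7 / 4)|lborel. S.cut_flux 1 x)"
      unfolding mass_flux_def by (rule gen[OF a5 continuous_on_cut_terms(2)[OF R0]]) (simp only: R4 ejg[symmetric] mult.assoc)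
    then show ?thesis using R0 by (simp add: S.mass_flux_def)
  qed
  show "S.hardy_boundary 1 = hardy_boundary R"
  proof -
    have "hardy_boundary R = 1 * (LINT x:ann (5 / 4) (7 / 4)|lborel. \<bar>annular_cut' 1 (x \<bullet> x)\<bar> * (U' x \<bullet> U' x))"
      unfolding hardy_boundary_def
    proof (rule gen[OF a5])
      show "continuous_on (- {0}) (\<lambda>x. \<bar>annular_cut' R (x \<bullet> x)\<bar> * (U x \<bullet> U x))" by (intro continuous_intros continuous_on_annular_cut R0 cU)
      show "R ^ 4 * (\<bar>annular_cut' R ((R *\<^sub>R y) \<bullet> (R *\<^sub>R y))\<bar> * (U (R *\<^sub>R y) \<bullet> U (R *\<^sub>R y))) = 1 * (\<bar>annular_cut' 1 (y \<bullet> y)\<bar> * (U' y \<bullet> U' y))" for y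
      proof -
        have "R ^ 4 * (\<bar>u / R\<^sup>2\<bar> * w) = 1 * (\<bar>u\<bar> * (R\<^sup>2 * w))" for u w
          using R0 by (simp add: abs_divide power2_eq_square power4_eq_xxxx)
        then show ?thesis unfolding RR c1 UU .
      qed
    qed
    then show ?thesis by (simp add: S.hardy_boundary_def)
  qed
  show "S.boundary_term 1 = boundary_term R"
  proof -
    have "(LINT x:shell R|lborel. (U x \<bullet> U x) / 2 * cut_laplacian R x) = 1 * (LINT x:ann (5 / 4) (7 / 4)|lborel. (U' x \<bullet> U' x) / 2 * S.cut_laplacian 1 x)"
    proof (rule gen[OF a5])
      show "continuous_on (- {0}) (\<lambda>x. (U x \<bullet> U x) / 2 * cut_laplacian R x)" by (intro continuous_intros continuous_on_cut_terms R0 cU) auto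
      show "R ^ 4 * ((U (R *\<^sub>R y) \<bullet> U (R *\<^sub>R y)) / 2 * cut_laplacian R (R *\<^sub>R y)) = 1 * ((U' y \<bullet> U' y) / 2 * S.cut_laplacian 1 y)" for y
        unfolding ejl[symmetric] UU by (simp add: power4_eq_xxxx power2_eq_square mult_ac)
    qed
    moreover have "(LINT x:shell R|lborel. cut_flux R x * ((U x \<bullet> U x) / 2)) = 1 * (LINT x:ann (5 / 4) (7 / 4)|lborel. S.cut_flux 1 x * ((U' x \<bullet> U' x) / 2))"
    proof (rule gen[OF a5])
      show "continuous_on (- {0}) (\<lambda>x. cut_flux R x * ((U x \<bullet> U x) / 2))" by (intro continuous_intros continuous_on_cut_terms R0 cU) auto
      show "R ^ 4 * (cut_flux R (R *\<^sub>R y) * ((U (R *\<^sub>R y) \<bullet> U (R *\<^sub>R y)) / 2)) = 1 * (S.cut_flux 1 y * ((U' y \<bullet> U' y) / 2))" for y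
        unfolding ejg[symmetric] UU by (simp add: power4_eq_xxxx power2_eq_square mult_ac)
    qed
    moreover have "(LINT x:shell R|lborel. cut_flux R x * P x) = 1 * (LINT x:ann (5 / 4) (7 / 4)|lborel. S.cut_flux 1 x * P' x)"
    proof (rule gen[OF a5])
      show "continuous_on (- {0}) (\<lambda>x. cut_flux R x * P x)" by (intro continuous_intros continuous_on_cut_terms R0 cP)
      show "R ^ 4 * (cut_flux R (R *\<^sub>R y) * P (R *\<^sub>R y)) = 1 * (S.cut_flux 1 y * P' y)" for y
        unfolding ejg[symmetric] P'_def by (simp add: power4_eq_xxxx power2_eq_square mult_ac)
    qed
    ultimately show ?thesis by (simp add: S.boundary_term_def boundary_term_def)
  qed
qed

text \<open>The difference of the cutoffs at \<epsilon> and R is an admissible cutoff equal to 1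
  between the two shells. Its derivatives split into one part on each shell, so
  \<open>flux_zero\<close>, \<open>energy_identity\<close> and \<open>hardy\<close> become
  comparisons of terms at \<epsilon> and at R.\<close>

lemma two_cutoffs:
  assumes e: "0 < \<epsilon>" "\<epsilon> \<le> R"
  shows "mass_flux \<epsilon> = mass_flux R"
    and "0 < a \<Longrightarrow> \<epsilon> * (7 / 4) \<le> a \<Longrightarrow> b \<le> R * (5 / 4) \<Longrightarrow> energy a b \<le> \<bar>boundary_term \<epsilon>\<bar> + \<bar>boundary_term R\<bar>"
    and "0 < a \<Longrightarrow> \<epsilon> * (7 / 4) \<le> a \<Longrightarrow> b \<le> R * (5 / 4) \<Longrightarrow>
      (LINT x:ann a b|lborel. (U x \<bullet> U x) / (x \<bullet> x)) \<le> 2 * (hardy_boundary \<epsilon> + hardy_boundary R) + \<bar>boundary_term \<epsilon>\<bar> + \<bar>boundary_term R\<bar>"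
proof -
  have R: "0 < R" using e by linarith
  have e0: "\<epsilon> \<noteq> 0" and R0: "R \<noteq> 0" using e R by auto
  let ?\<Theta> = "\<lambda>r. annular_cut \<epsilon> r - annular_cut R r" and ?\<Theta>' = "\<lambda>r. annular_cut' \<epsilon> r - annular_cut' R r" and ?\<Theta>'' = "\<lambda>r. annular_cut'' \<epsilon> r - annular_cut'' R r"
  have sq: "(5 / 4 * \<epsilon>)\<^sup>2 \<le> (5 / 4 * R)\<^sup>2" "(7 / 4 * \<epsilon>)\<^sup>2 \<le> (7 / 4 * R)\<^sup>2" using e by (intro power_mono; simp)+
  have sp: "?\<Theta> r = 0 \<and> ?\<Theta>' r = 0" if "r \<notin> {(\<epsilon> * (5 / 4))\<^sup>2..(R * (7 / 4))\<^sup>2}" for r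
  proof (cases "r < (5 / 4 * \<epsilon>)\<^sup>2")
    case True
    then show ?thesis using annular_cut_low[OF e(1), of r] annular_cut_low[OF R, of r] sq by simp
  next
    case False
    then have "(7 / 4 * R)\<^sup>2 < r" using that by (auto simp: mult.commute)
    then show ?thesis using annular_cut_high[OF e(1), of r] annular_cut_high[OF R, of r] sq by simp
  qed
  interpret C: NS4_cutoff U A B P G M ?\<Theta> ?\<Theta>' ?\<Theta>'' "\<epsilon> * (5 / 4)" "R * (7 / 4)"
  proof unfold_locales
    show "DERIV ?\<Theta> r :> ?\<Theta>' r" "DERIV ?\<Theta>' r :> ?\<Theta>'' r" for r
      by (intro DERIV_diff DERIV_annular_cut DERIV_annular_cut' e0 R0)+
    show "continuous_on UNIV ?\<Theta>''" by (intro continuous_intros continuous_annular_cut'' e0 R0)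
    show "?\<Theta> r = 0" "?\<Theta>' r = 0" if "r \<notin> {(\<epsilon> * (5 / 4))\<^sup>2..(R * (7 / 4))\<^sup>2}" for r
      using sp[OF that] by auto
  qed (use e R in auto)
  let ?D = "ann (\<epsilon> * (5 / 4)) (R * (7 / 4))" and ?q = "\<lambda>x. (U x \<bullet> U x) / 2"
  have \<alpha>: "0 < \<epsilon> * (5 / 4)" using e by simp
  have sub: "shell \<epsilon> \<subseteq> ?D" "shell R \<subseteq> ?D" using e by (intro ann_mono; simp)+
  have out: "annular_cut' \<rho> (x \<bullet> x) = 0 \<and> annular_cut'' \<rho> (x \<bullet> x) = 0" if "0 < \<rho>" "x \<notin> shell \<rho>" for \<rho> and x :: "real^4"
    using annular_cut_outside[of \<rho> x] that by (simp add: mult.commute)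
  have restr: "(LINT x:?D|lborel. f x) = (LINT x:shell \<rho>|lborel. f x)"
    if "\<rho> = \<epsilon> \<or> \<rho> = R" "\<And>x. x \<notin> shell \<rho> \<Longrightarrow> f x = 0" for \<rho> and f :: "real^4 \<Rightarrow> real"
    by (rule set_integral_restrict) (use that sub in auto)
  \<comment> \<open>The two shells may overlap; each integrand is restricted to its own shell
    separately.\<close>
  have split: "(LINT x:?D|lborel. f x - h x) = (LINT x:shell \<epsilon>|lborel. f x) - (LINT x:shell R|lborel. h x)"
    if "continuous_on (- {0}) f" "continuous_on (- {0}) h" "\<And>x. x \<notin> shell \<epsilon> \<Longrightarrow> f x = 0" "\<And>x. x \<notin> shell R \<Longrightarrow> h x = 0"
    for f h :: "real^4 \<Rightarrow> real"
    unfolding set_integral_diff(2)[OF set_integrable_ann[OF that(1) \<alpha>] set_integrable_ann[OF that(2) \<alpha>]]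
    using restr[of \<epsilon> f] restr[of R h] that by simp
  note cj = continuous_on_cut_terms(1)[OF e0] continuous_on_cut_terms(1)[OF R0] continuous_on_cut_terms(2)[OF e0] continuous_on_cut_terms(2)[OF R0]
  have outj: "cut_laplacian \<rho> x = 0 \<and> cut_flux \<rho> x = 0" if "0 < \<rho>" "x \<notin> shell \<rho>" for \<rho> x
    using out[OF that] by (simp add: cut_laplacian_def cut_flux_def)
  have gj: "2 * ?\<Theta>' (x \<bullet> x) * (x \<bullet> U x) = cut_flux \<epsilon> x - cut_flux R x" for x
    by (simp add: cut_flux_def algebra_simps)
  have lj: "8 * ?\<Theta>' (x \<bullet> x) + 4 * (?\<Theta>'' (x \<bullet> x) * (x \<bullet> x)) = cut_laplacian \<epsilon> x - cut_laplacian R x" for x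
    by (simp add: cut_laplacian_def algebra_simps)
  have "(LINT x:?D|lborel. cut_flux \<epsilon> x - cut_flux R x) = 0" using C.flux_zero unfolding gj .
  then show flux: "mass_flux \<epsilon> = mass_flux R"
    by (subst (asm) split) (use outj e R cj in \<open>auto simp: mass_flux_def\<close>)
  have J: "(LINT x:?D|lborel. ?\<Theta> (x \<bullet> x) * C.e x) = boundary_term \<epsilon> - boundary_term R"
  proof -
    have 1: "(LINT x:?D|lborel. ?q x * (cut_laplacian \<epsilon> x - cut_laplacian R x)) = (LINT x:shell \<epsilon>|lborel. ?q x * cut_laplacian \<epsilon> x) - (LINT x:shell R|lborel. ?q x * cut_laplacian R x)"
      unfolding right_diff_distrib by (rule split) (use outj e R in \<open>auto intro!: continuous_intros cj cU\<close>)
    have 2: "(LINT x:?D|lborel. (cut_flux \<epsilon> x - cut_flux R x) * ?q x) = (LINT x:shell \<epsilon>|lborel. cut_flux \<epsilon> x * ?q x) - (LINT x:shell R|lborel. cut_flux R x * ?q x)"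
      unfolding left_diff_distrib by (rule split) (use outj e R in \<open>auto intro!: continuous_intros cj cU\<close>)
    have 3: "(LINT x:?D|lborel. (cut_flux \<epsilon> x - cut_flux R x) * P x) = (LINT x:shell \<epsilon>|lborel. cut_flux \<epsilon> x * P x) - (LINT x:shell R|lborel. cut_flux R x * P x)"
      unfolding left_diff_distrib by (rule split) (use outj e R in \<open>auto intro!: continuous_intros cj cP\<close>)
    show ?thesis
      unfolding C.energy_identity gj lj 1 2 3 by (simp add: boundary_term_def)
  qed
  have Th0: "0 \<le> ?\<Theta> (x \<bullet> x)" for x :: "real^4" using annular_cut_antimono[OF e, of "x \<bullet> x"] by simp
  have cTe: "continuous_on (- {0}) (\<lambda>x. ?\<Theta> (x \<bullet> x) * C.e x)" by (intro continuous_intros C.radial_continuous cA)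
  have cTh: "continuous_on (- {0}) (\<lambda>x. ?\<Theta> (x \<bullet> x) * (U x \<bullet> U x) / (x \<bullet> x))"
    by (intro continuous_intros C.radial_continuous cU) auto
  have cH: "continuous_on (- {0}) (\<lambda>x. (U x \<bullet> U x) / (x \<bullet> x))" by (intro continuous_intros cU) auto
  have JJ: "boundary_term \<epsilon> - boundary_term R \<le> \<bar>boundary_term \<epsilon>\<bar> + \<bar>boundary_term R\<bar>" by linarith
  {
    assume ab: "0 < a" "\<epsilon> * (7 / 4) \<le> a" "b \<le> R * (5 / 4)"
    have Th1: "?\<Theta> (x \<bullet> x) = 1" if x: "x \<in> ann a b" for x :: "real^4"
    proof -
      have "(7 / 4 * \<epsilon>)\<^sup>2 \<le> x \<bullet> x" "x \<bullet> x \<le> (5 / 4 * R)\<^sup>2"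
        unfolding dot_square_norm using x ab e by (intro power_mono; simp add: ann_def)+
      then show ?thesis using annular_cut_high[OF e(1)] annular_cut_low[OF R] by simp
    qed
    have subab: "ann a b \<subseteq> ?D" using ab e by (intro ann_mono) auto
    have "energy a b = (LINT x:ann a b|lborel. ?\<Theta> (x \<bullet> x) * C.e x)"
      unfolding energy_def by (intro set_lebesgue_integral_cong) (auto simp: Th1)
    also have "\<dots> \<le> (LINT x:?D|lborel. ?\<Theta> (x \<bullet> x) * C.e x)"
      by (intro set_integral_mono_set set_integrable_ann \<alpha> cTe subab mult_nonneg_nonneg Th0 energy_density_nonneg) auto
    also have "\<dots> \<le> \<bar>boundary_term \<epsilon>\<bar> + \<bar>boundary_term R\<bar>" unfolding J by (rule JJ)
    finally show "energy a b \<le> \<bar>boundary_term \<epsilon>\<bar> + \<bar>boundary_term R\<bar>" .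
    have "(LINT x:ann a b|lborel. (U x \<bullet> U x) / (x \<bullet> x)) = (LINT x:ann a b|lborel. ?\<Theta> (x \<bullet> x) * (U x \<bullet> U x) / (x \<bullet> x))"
      by (intro set_lebesgue_integral_cong) (auto simp: Th1)
    also have "\<dots> \<le> (LINT x:?D|lborel. ?\<Theta> (x \<bullet> x) * (U x \<bullet> U x) / (x \<bullet> x))"
      by (intro set_integral_mono_set set_integrable_ann \<alpha> cTh subab divide_nonneg_nonneg mult_nonneg_nonneg Th0) auto
    also have "\<dots> \<le> 2 * (LINT x:?D|lborel. \<bar>?\<Theta>' (x \<bullet> x)\<bar> * (U x \<bullet> U x)) + (boundary_term \<epsilon> - boundary_term R)"
    proof -
      \<comment> \<open>\<open>hardy\<close> asks for nonnegativity at every real argument; at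
        negative ones both cutoffs vanish.\<close>
      have nn: "0 \<le> ?\<Theta> r" for r
      proof (cases "0 \<le> r")
        case True
        then show ?thesis using annular_cut_antimono[OF e, of r] by simp
      next
        case False
        then show ?thesis using annular_cut_low[OF e(1), of r] annular_cut_low[OF R, of r] by (smt (verit) zero_le_power2)
      qed
      show ?thesis using C.hardy[OF nn] unfolding J .
    qed
    also have "(LINT x:?D|lborel. \<bar>?\<Theta>' (x \<bullet> x)\<bar> * (U x \<bullet> U x)) \<le>
      (LINT x:?D|lborel. \<bar>annular_cut' \<epsilon> (x \<bullet> x)\<bar> * (U x \<bullet> U x) + \<bar>annular_cut' R (x \<bullet> x)\<bar> * (U x \<bullet> U x))"
    proof (intro set_integral_mono set_integrable_ann \<alpha> continuous_intros continuous_on_annular_cut e0 R0 cU)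
      fix x
      have "\<bar>?\<Theta>' (x \<bullet> x)\<bar> * (U x \<bullet> U x) \<le> (\<bar>annular_cut' \<epsilon> (x \<bullet> x)\<bar> + \<bar>annular_cut' R (x \<bullet> x)\<bar>) * (U x \<bullet> U x)"
        by (intro mult_right_mono) auto
      then show "\<bar>?\<Theta>' (x \<bullet> x)\<bar> * (U x \<bullet> U x) \<le> \<bar>annular_cut' \<epsilon> (x \<bullet> x)\<bar> * (U x \<bullet> U x) + \<bar>annular_cut' R (x \<bullet> x)\<bar> * (U x \<bullet> U x)"
        by (simp add: distrib_right)
    qed
    also have "\<dots> = hardy_boundary \<epsilon> + hardy_boundary R"
    proof -
      have c: "continuous_on (- {0}) (\<lambda>x. \<bar>annular_cut' \<rho> (x \<bullet> x)\<bar> * (U x \<bullet> U x))" if "\<rho> \<noteq> 0" for \<rho>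
        by (intro continuous_intros continuous_on_annular_cut that cU)
      show ?thesis
        unfolding hardy_boundary_def set_integral_add(2)[OF set_integrable_ann[OF c[OF e0] \<alpha>] set_integrable_ann[OF c[OF R0] \<alpha>]]
        using restr[of \<epsilon> "\<lambda>x. \<bar>annular_cut' \<epsilon> (x \<bullet> x)\<bar> * (U x \<bullet> U x)"] restr[of R "\<lambda>x. \<bar>annular_cut' R (x \<bullet> x)\<bar> * (U x \<bullet> U x)"] out e R
        by simp
    qed
    finally show "(LINT x:ann a b|lborel. (U x \<bullet> U x) / (x \<bullet> x)) \<le> 2 * (hardy_boundary \<epsilon> + hardy_boundary R) + \<bar>boundary_term \<epsilon>\<bar> + \<bar>boundary_term R\<bar>"
      using JJ by simp
  }
qed

section \<open>Bounds uniform in the scale, and vanishing of the solution\<close>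

definition cubic_cap :: real where "cubic_cap = max 1 (9 * M)"
definition energy_cap :: real where "energy_cap = 3 * (nested_const cubic_cap * 2 ^ 13) * (8 * 13) ^ 13"

text \<open>The rescaled annuli reach radius 8 and \<open>cubic_le\<close> asks for a strictly
  larger one, hence 9. The maximum with 1 lets the cube dominate.\<close>

lemma cubic_cap: "1 \<le> cubic_cap" "9 * M \<le> cubic_cap ^ 3"
proof -
  show 1: "1 \<le> cubic_cap" by (simp add: cubic_cap_def)
  have "9 * M \<le> cubic_cap" by (simp add: cubic_cap_def)
  also have "cubic_cap \<le> cubic_cap ^ 3" using 1 power_increasing[of 1 3 cubic_cap] by simp
  finally show "9 * M \<le> cubic_cap ^ 3" .
qed

lemma cubic_scale:
  assumes "0 < R" "0 < a" "a \<le> b" "b < 9"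
  shows "cubic (R * a) (R * b) / R \<le> cubic_cap ^ 3"
proof -
  have "cubic (R * a) (R * b) \<le> M * (R * 9)" using assms by (intro cubic_le) auto
  then have "cubic (R * a) (R * b) / R \<le> 9 * M" using assms by (simp add: field_simps)
  then show ?thesis using cubic_cap(2) by linarith
qed

text \<open>There is no source at the origin: the flux is the same on all shells by
  incompressibility, but at radius \<epsilon> it is at most a constant times \<epsilon>^2.\<close>

lemma mass_flux_zero: "0 < R \<Longrightarrow> mass_flux R = 0"
proof (rule ccontr)
  assume R: "0 < R" and F: "mass_flux R \<noteq> 0"
  define c where "c = 600 * ((vol4 + 1) * cubic_cap)"
  have c: "0 < c" using cubic_cap vol4_nonneg by (simp add: c_def)
  have b: "\<bar>mass_flux \<epsilon>\<bar> \<le> c * \<epsilon>\<^sup>2" if e: "0 < \<epsilon>" for \<epsilon>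
  proof -
    interpret S: NS4 "\<lambda>x. \<epsilon> *\<^sub>R U (\<epsilon> *\<^sub>R x)" "\<lambda>i x. \<epsilon>\<^sup>2 *\<^sub>R A i (\<epsilon> *\<^sub>R x)" "\<lambda>i j x. \<epsilon> ^ 3 *\<^sub>R B i j (\<epsilon> *\<^sub>R x)"
      "\<lambda>x. \<epsilon>\<^sup>2 * P (\<epsilon> *\<^sub>R x)" "\<lambda>x. \<epsilon> ^ 3 *\<^sub>R G (\<epsilon> *\<^sub>R x)" M
      by (rule scaled[OF e])
    have "\<bar>S.mass_flux 1\<bar> \<le> c"
      unfolding c_def
    proof (rule S.unit_boundary_bounds(2))
      show "S.cubic (1 / 8) 4 \<le> cubic_cap ^ 3" using cubic_scale[OF e, of "1/8" 4] scaling_identities(2)[OF e, of "1/8" 4] by simp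
    qed (use cubic_cap in auto)
    then show ?thesis using scaling_identities(4)[OF e, of 1] e by (simp add: abs_divide field_simps)
  qed
  \<comment> \<open>Small enough that the bound at \<epsilon> is at most half of the supposed
    flux.\<close>
  define \<epsilon> where "\<epsilon> = min R (min 1 (\<bar>mass_flux R\<bar> / (2 * c)))"
  have e: "0 < \<epsilon>" "\<epsilon> \<le> R" "\<epsilon> \<le> 1" "\<epsilon> \<le> \<bar>mass_flux R\<bar> / (2 * c)" using R F c by (auto simp: \<epsilon>_def)
  have "\<bar>mass_flux R\<bar> \<le> c * \<epsilon>\<^sup>2" using b[OF e(1)] two_cutoffs(1)[OF e(1,2)] by simp
  also have "\<dots> \<le> c * \<epsilon>" using c e power_decreasing[of 1 2 \<epsilon>] by (intro mult_left_mono) auto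
  also have "\<dots> \<le> c * (\<bar>mass_flux R\<bar> / (2 * c))" using c e by (intro mult_left_mono) auto
  also have "\<dots> = \<bar>mass_flux R\<bar> / 2" using c by simp
  finally show False using F by simp
qed

text \<open>Here \<open>n\<close> may be small at the given scale, while the energy enters through
  \<open>energy_cap\<close>, which is uniform in the scale.\<close>

lemma boundary_bounds:
  assumes R: "0 < R" and n: "0 < n" "cubic (R * (1 / 8)) (R * 4) / R \<le> n ^ 3"
  shows "\<bar>boundary_term R\<bar> \<le> boundary_const n energy_cap" "hardy_boundary R \<le> 600 * ((vol4 + 1) * n\<^sup>2)"
proof -
  interpret S: NS4 "\<lambda>x. R *\<^sub>R U (R *\<^sub>R x)" "\<lambda>i x. R\<^sup>2 *\<^sub>R A i (R *\<^sub>R x)" "\<lambda>i j x. R ^ 3 *\<^sub>R B i j (R *\<^sub>R x)"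
    "\<lambda>x. R\<^sup>2 * P (R *\<^sub>R x)" "\<lambda>x. R ^ 3 *\<^sub>R G (R *\<^sub>R x)" M
    by (rule scaled[OF R])
  have N: "S.cubic (1 / 8) 4 \<le> n ^ 3" using n scaling_identities(2)[OF R, of "1/8" 4] by simp
  have F: "S.mass_flux 1 = 0" using scaling_identities(4)[OF R, of 1] mass_flux_zero[OF R] by simp
  have N0: "S.cubic (1 / 8) 4 \<le> cubic_cap ^ 3" using cubic_scale[OF R, of "1/8" 4] scaling_identities(2)[OF R, of "1/8" 4] by simp
  have Eb: "S.energy 1 2 \<le> energy_cap" unfolding energy_cap_def by (rule S.energy_bound[OF _ N0]) (use cubic_cap in auto)
  show "\<bar>boundary_term R\<bar> \<le> boundary_const n energy_cap" using S.unit_boundary_bounds(1)[OF n(1) N F Eb] scaling_identities(6)[OF R, of 1] by simp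
  show "hardy_boundary R \<le> 600 * ((vol4 + 1) * n\<^sup>2)" using S.unit_boundary_bounds(3)[OF n(1) N] scaling_identities(5)[OF R, of 1] by simp
qed

lemma energy_cap_nonneg: "0 \<le> energy_cap"
  unfolding energy_cap_def nested_const_def using cubic_cap vol4_nonneg flux_const_nonneg by simp

text \<open>Two passes through \<open>two_cutoffs\<close>. With \<open>cubic_cap\<close> for
  \<open>n\<close>, it bounds the integral of \<open>hardy_density\<close> over all annuli. Tails of
  that integral are then small, so by \<open>cubic_small\<close> the cutoffs can be placed where
  \<open>n\<close> is at most \<delta>, and the second pass bounds the Hardy integral by a multiple
  of \<delta>.\<close>

lemma hardy_integral_zero:
  assumes a: "0 < a" "a \<le> b"
  shows "(LINT x:ann a b|lborel. (U x \<bullet> U x) / (x \<bullet> x)) \<le> 0"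
proof -
  have cap_pos: "0 < cubic_cap" using cubic_cap by simp
  define C where "C = 2 * (boundary_const cubic_cap energy_cap + boundary_const cubic_cap energy_cap) + 2 * (600 * ((vol4 + 1) * cubic_cap\<^sup>2) + 600 * ((vol4 + 1) * cubic_cap\<^sup>2))"
  have big: "(LINT x:ann c d|lborel. hardy_density x) \<le> C" if cd: "0 < c" "c \<le> d" for c d
  proof -
    \<comment> \<open>The cutoffs at c / 2 and at \<open>d\<close> have their shells inside and
      outside the annulus from \<open>c\<close> to \<open>d\<close>.\<close>
    define \<epsilon> where "\<epsilon> = c / 2"
    have e: "0 < \<epsilon>" "\<epsilon> \<le> d" "\<epsilon> * (7 / 4) \<le> c" "d \<le> d * (5 / 4)" "0 < d" using cd by (auto simp: \<epsilon>_def)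
    have N: "cubic (\<rho> * (1 / 8)) (\<rho> * 4) / \<rho> \<le> cubic_cap ^ 3" if "0 < \<rho>" for \<rho> using cubic_scale[OF that, of "1/8" 4] by simp
    have ch: "continuous_on (- {0}) (\<lambda>x. (U x \<bullet> U x) / (x \<bullet> x))" by (intro continuous_intros cU) auto
    have "(LINT x:ann c d|lborel. hardy_density x) = energy c d + (LINT x:ann c d|lborel. (U x \<bullet> U x) / (x \<bullet> x))"
      unfolding hardy_density_def energy_def
      by (rule set_integral_add(2)) (intro set_integrable_ann continuous_on_energy_density ch cd(1))+
    moreover have "t \<le> 2 * (j + j) + 2 * (h + h)"
      if "t = u + v" "u \<le> j1 + j2" "v \<le> 2 * (h1 + h2) + j1 + j2" "j1 \<le> j" "j2 \<le> j" "h1 \<le> h" "h2 \<le> h"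
      for t u v j1 j2 h1 h2 j h :: real
      using that by argo
    ultimately show ?thesis
      using two_cutoffs(2,3)[OF e(1,2) cd(1) e(3,4)] boundary_bounds[OF e(1) cap_pos N[OF e(1)]] boundary_bounds[OF e(5) cap_pos N[OF e(5)]]
      unfolding C_def by blast
  qed
  define k where "k = 2400 * (vol4 + 1) + 2 * boundary_const 1 energy_cap"
  have k: "0 \<le> k"
    unfolding k_def boundary_const_def using vol4_nonneg flux_const_nonneg energy_cap_nonneg by simp
  have small: "(LINT x:ann a b|lborel. (U x \<bullet> U x) / (x \<bullet> x)) \<le> \<delta> * k" if d: "0 < \<delta>" "\<delta> \<le> 1" for \<delta>
  proof -
    have tail_const: "0 < tail_const cubic_cap" by (rule tail_const_pos[OF cap_pos])
    have "0 < \<delta> ^ 3 / tail_const cubic_cap" using d tail_const by simp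
    from small_tails[OF continuous_on_hardy_density hardy_density_nonneg big this]
    obtain p r where pr: "0 < p" "0 < r" "\<And>c d. 0 < c \<Longrightarrow> c \<le> d \<Longrightarrow> d < p \<or> r < c \<Longrightarrow> (LINT x:ann c d|lborel. hardy_density x) < \<delta> ^ 3 / tail_const cubic_cap"
      by blast
    have N: "cubic (\<rho> * (1 / 8)) (\<rho> * 4) / \<rho> \<le> \<delta> ^ 3" if \<rho>: "0 < \<rho>" "\<rho> * 8 < p \<or> r < \<rho> * (1 / 16)" for \<rho>
    proof -
      interpret S: NS4 "\<lambda>x. \<rho> *\<^sub>R U (\<rho> *\<^sub>R x)" "\<lambda>i x. \<rho>\<^sup>2 *\<^sub>R A i (\<rho> *\<^sub>R x)" "\<lambda>i j x. \<rho> ^ 3 *\<^sub>R B i j (\<rho> *\<^sub>R x)"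
        "\<lambda>x. \<rho>\<^sup>2 * P (\<rho> *\<^sub>R x)" "\<lambda>x. \<rho> ^ 3 *\<^sub>R G (\<rho> *\<^sub>R x)" M
        by (rule scaled[OF \<rho>(1)])
      have N16: "S.cubic (1 / 16) 8 \<le> cubic_cap ^ 3"
        using cubic_scale[OF \<rho>(1), of "1/16" 8] scaling_identities(2)[OF \<rho>(1), of "1/16" 8] by simp
      have "S.cubic (1 / 8) 4 \<le> tail_const cubic_cap * (LINT x:ann (1 / 16) 8|lborel. S.hardy_density x)" by (rule S.cubic_small[OF cap_pos N16])
      also have "\<dots> = tail_const cubic_cap * (LINT x:ann (\<rho> * (1 / 16)) (\<rho> * 8)|lborel. hardy_density x)"
        using scaling_identities(3)[OF \<rho>(1), of "1/16" 8] by simp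
      also have "\<dots> \<le> tail_const cubic_cap * (\<delta> ^ 3 / tail_const cubic_cap)"
        using pr(3)[of "\<rho> * (1 / 16)" "\<rho> * 8"] \<rho> tail_const by (intro mult_left_mono) auto
      also have "\<dots> = \<delta> ^ 3" using tail_const by simp
      finally show ?thesis using scaling_identities(2)[OF \<rho>(1), of "1/8" 4] by simp
    qed
    \<comment> \<open>\<open>cubic_small\<close> looks at radii from \<rho> / 16 to 8 \<rho>.
      Dividing \<open>p\<close> by 9 and multiplying \<open>r\<close> by 17 puts both ranges
      strictly into the tails.\<close>
    define \<epsilon> where "\<epsilon> = min (a / 2) (p / 9)"
    define R where "R = max b (17 * r)"
    have e: "0 < \<epsilon>" "\<epsilon> \<le> a / 2" "\<epsilon> * 8 < p" using a pr by (auto simp: \<epsilon>_def min_def)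
    have R: "0 < R" "b \<le> R" "r < R * (1 / 16)" using a pr by (auto simp: R_def max_def)
    have eR: "\<epsilon> \<le> R" "\<epsilon> * (7 / 4) \<le> a" "b \<le> R * (5 / 4)" using e R a by auto
    have Ne: "cubic (\<epsilon> * (1 / 8)) (\<epsilon> * 4) / \<epsilon> \<le> \<delta> ^ 3" and NR: "cubic (R * (1 / 8)) (R * 4) / R \<le> \<delta> ^ 3"
      using N[of \<epsilon>] N[of R] e R by auto
    have ec: "boundary_const \<delta> energy_cap \<le> \<delta> * boundary_const 1 energy_cap" by (rule boundary_const_le[OF d energy_cap_nonneg])
    have "600 * ((vol4 + 1) * \<delta>\<^sup>2) \<le> 600 * ((vol4 + 1) * \<delta>)"
      using vol4_nonneg d power_decreasing[of 1 2 \<delta>] by (intro mult_left_mono) auto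
    moreover have "2 * (h1 + h2) + j1 + j2 \<le> 4 * h + 2 * j"
      if "h' \<le> h" "h1 \<le> h'" "h2 \<le> h'" "j' \<le> j" "j1 \<le> j'" "j2 \<le> j'" for h1 h2 h' h j1 j2 j' j :: real
      using that by argo
    ultimately have "2 * (hardy_boundary \<epsilon> + hardy_boundary R) + \<bar>boundary_term \<epsilon>\<bar> + \<bar>boundary_term R\<bar> \<le> 4 * (600 * ((vol4 + 1) * \<delta>)) + 2 * (\<delta> * boundary_const 1 energy_cap)"
      using boundary_bounds[OF e(1) d(1) Ne] boundary_bounds[OF R(1) d(1) NR] ec by blast
    also have "\<dots> = \<delta> * k" by (simp add: k_def algebra_simps)
    finally show ?thesis using two_cutoffs(3)[OF e(1) eR(1) a(1) eR(2,3)] by linarith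
  qed
  show ?thesis
  proof (rule ccontr)
    let ?I = "LINT x:ann a b|lborel. (U x \<bullet> U x) / (x \<bullet> x)"
    assume "\<not> ?I \<le> 0"
    then have I: "0 < ?I" by simp
    define \<delta> where "\<delta> = min 1 (?I / (2 * (k + 1)))"
    have "0 < \<delta>" "\<delta> \<le> 1" using I k by (auto simp: \<delta>_def)
    then have "?I \<le> \<delta> * k" by (rule small)
    also have "\<dots> \<le> (?I / (2 * (k + 1))) * k" using k by (intro mult_right_mono) (auto simp: \<delta>_def)
    also have "\<dots> < ?I"
    proof -
      have "?I * k < ?I * (2 * (k + 1))" using I k by (intro mult_strict_left_mono) auto
      then show ?thesis using k by (simp add: divide_less_eq)
    qed
    finally show False by simp
  qed
qed

text \<open>A nonzero value would, by continuity, give a ball on which the Hardy integrand exceeds a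
  positive constant, against \<open>hardy_integral_zero\<close>.\<close>

lemma velocity_zero:
  assumes x0: "x\<^sub>0 \<noteq> 0"
  shows "U x\<^sub>0 = 0"
proof (rule ccontr)
  assume U0: "U x\<^sub>0 \<noteq> 0"
  define f where "f x = (U x \<bullet> U x) / (x \<bullet> x)" for x
  have cf: "continuous_on (- {0}) f" unfolding f_def[abs_def] by (intro continuous_intros cU) auto
  have f0: "0 < f x\<^sub>0" using U0 x0 by (simp add: f_def)
  have fn: "0 \<le> f x" for x by (simp add: f_def)
  have "isCont f x\<^sub>0" using cf x0 by (simp add: continuous_on_eq_continuous_at open_Compl)
  then obtain d where d: "0 < d" "\<And>y. dist y x\<^sub>0 < d \<Longrightarrow> dist (f y) (f x\<^sub>0) < f x\<^sub>0 / 2"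
    unfolding continuous_at_eps_delta using f0 half_gt_zero by blast
  define e where "e = min (d / 2) (norm x\<^sub>0 / 2)"
  have e: "0 < e" "e < d" "e \<le> norm x\<^sub>0 / 2" using d x0 by (auto simp: e_def min_def)
  let ?a = "norm x\<^sub>0 / 2" and ?b = "2 * norm x\<^sub>0"
  have a: "0 < ?a" using x0 by simp
  have sub: "cball x\<^sub>0 e \<subseteq> ann ?a ?b"
  proof
    fix y assume "y \<in> cball x\<^sub>0 e"
    then have "norm (x\<^sub>0 - y) \<le> norm x\<^sub>0 / 2" using e by (simp add: dist_norm)
    then show "y \<in> ann ?a ?b"
      using norm_triangle_ineq2[of x\<^sub>0 y] norm_triangle_ineq2[of y x\<^sub>0] by (auto simp: ann_def norm_minus_commute)
  qed
  have i: "set_integrable lborel (ann ?a ?b) f" by (rule set_integrable_ann[OF cf a])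
  have "0 < f x\<^sub>0 / 2 * measure lborel (cball x\<^sub>0 e)" using f0 e by (simp add: content_cball_pos)
  also have "\<dots> = (LINT x:cball x\<^sub>0 e|lborel. f x\<^sub>0 / 2)" by (simp add: set_lebesgue_integral_def)
  also have "\<dots> \<le> (LINT x:cball x\<^sub>0 e|lborel. f x)"
  proof (intro set_integral_mono set_integrable_subset[OF i] sub set_integrable_compact compact_cball continuous_intros)
    fix y assume "y \<in> cball x\<^sub>0 e"
    then have "dist (f y) (f x\<^sub>0) < f x\<^sub>0 / 2" using e by (intro d(2)) (auto simp: dist_commute)
    then show "f x\<^sub>0 / 2 \<le> f y" unfolding dist_real_def by linarith
  qed auto
  also have "\<dots> \<le> (LINT x:ann ?a ?b|lborel. f x)" by (intro set_integral_mono_set i sub fn) auto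
  also have "\<dots> \<le> 0" unfolding f_def using a by (intro hardy_integral_zero) auto
  finally show False by simp
qed

text \<open>With \<open>U\<close> zero off the origin, its first and second derivatives vanish
  there, so momentum gives a zero pressure gradient. The punctured space is connected because the
  dimension exceeds one.\<close>

lemma pressure_constant: "\<exists>c. \<forall>x. x \<noteq> 0 \<longrightarrow> P x = c"
proof -
  have A0: "A i x = 0" if x: "x \<noteq> 0" for i x
  proof -
    have "((\<lambda>x. U x $ i) has_derivative (\<lambda>h. 0)) (at x)"
      by (rule has_derivative_transform_within_open[OF has_derivative_const[of 0], of "- {0}"]) (use x velocity_zero in auto)
    moreover have "((\<lambda>x. U x $ i) has_derivative (\<lambda>h. h \<bullet> A i x)) (at x)" using dU[OF x] by (simp add: gderiv_def)
    ultimately have "(\<lambda>h. h \<bullet> A i x) = (\<lambda>h. 0)" using has_derivative_unique by blast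
    from fun_cong[OF this, of "A i x"] show ?thesis by simp
  qed
  have B0: "B i j x = 0" if x: "x \<noteq> 0" for i j x
  proof -
    have "((\<lambda>x. A i x $ j) has_derivative (\<lambda>h. 0)) (at x)"
      by (rule has_derivative_transform_within_open[OF has_derivative_const[of 0], of "- {0}"]) (use x A0 in auto)
    moreover have "((\<lambda>x. A i x $ j) has_derivative (\<lambda>h. h \<bullet> B i j x)) (at x)" using dA[OF x] by (simp add: gderiv_def)
    ultimately have "(\<lambda>h. h \<bullet> B i j x) = (\<lambda>h. 0)" using has_derivative_unique by blast
    from fun_cong[OF this, of "B i j x"] show ?thesis by simp
  qed
  have G0: "G x = 0" if x: "x \<noteq> 0" for x
    by (simp add: vec_eq_iff momentum[OF x] A0[OF x] B0[OF x])
  have "connected (- {0 :: real ^ 4})" by (intro connected_punctured_universe) simp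
  moreover have "(P has_derivative (\<lambda>h. 0)) (at x)" if "x \<in> - {0}" for x
    using dP[of x] G0[of x] that by (simp add: gderiv_def)
  ultimately have "P x = P (axis 1 1)" if "x \<noteq> 0" for x
    using that by (intro has_derivative_zero_unique_connected[of "- {0}"]) (auto simp: open_Compl axis_eq_0_iff)
  then show ?thesis by blast
qed

end

section \<open>The Liouville theorem\<close>

lemma Ck_on_Suc_pderiv: "Ck_on (Suc k) S f \<Longrightarrow> Ck_on k S (pderiv_at j f)"
  by (simp add: pderiv_at_def[abs_def])

lemma Ck_on_has_derivative:
  fixes f :: "real ^ 'n::finite \<Rightarrow> 'b::real_normed_vector"
  assumes "Ck_on (Suc k) S f" "x \<in> S"
  shows "(f has_derivative (\<lambda>h. \<Sum>j\<in>UNIV. h $ j *\<^sub>R pderiv_at j f x)) (at x)"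
proof -
  let ?F = "frechet_derivative f (at x)"
  have d: "(f has_derivative ?F) (at x)"
    using assms by (auto simp: frechet_derivative_works[symmetric])
  then have lin: "linear ?F" by (rule has_derivative_linear)
  have "?F h = (\<Sum>j\<in>UNIV. h $ j *\<^sub>R pderiv_at j f x)" for h
  proof -
    have "?F h = ?F (\<Sum>j\<in>UNIV. h $ j *\<^sub>R axis j 1)"
      using basis_expansion[of h] by (simp add: scalar_mult_eq_scaleR)
    also have "\<dots> = (\<Sum>j\<in>UNIV. h $ j *\<^sub>R ?F (axis j 1))"
      using lin by (simp add: linear_sum linear_cmul)
    finally show ?thesis by (simp add: pderiv_at_def)
  qed
  then have "?F = (\<lambda>h. \<Sum>j\<in>UNIV. h $ j *\<^sub>R pderiv_at j f x)" by (rule ext)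
  with d show ?thesis by simp
qed

lemma Ck_on_GDERIV_component:
  fixes f :: "real ^ 'n::finite \<Rightarrow> real ^ 'm::finite"
  assumes "Ck_on (Suc k) S f" "x \<in> S"
  shows "GDERIV (\<lambda>x. f x $ i) x :> (\<chi> j. pderiv_at j f x $ i)"
  unfolding gderiv_def
  using bounded_linear.has_derivative[OF bounded_linear_vec_nth Ck_on_has_derivative[OF assms], of i]
  by (simp add: inner_vec_def)

lemma Ck_on_GDERIV_gradient:
  fixes f :: "real ^ 'n::finite \<Rightarrow> real"
  assumes "Ck_on (Suc k) S f" "x \<in> S"
  shows "GDERIV f x :> gradient f x"
  unfolding gderiv_def
  using Ck_on_has_derivative[OF assms] by (simp add: inner_vec_def gradient_def)

text \<open>The rows of the Jacobian become \<open>A i\<close>, the second derivatives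
  \<open>B i j\<close>, and the Laplacian of component i the trace of \<open>B i\<close>. The finite
  supremum is taken as the real constant \<open>M\<close>.\<close>

lemma NS4_of_stationary_NS:
  fixes U :: "real ^ 4 \<Rightarrow> real ^ 4" and P :: "real ^ 4 \<Rightarrow> real"
  assumes U: "smooth_on (- {0}) U" and P: "smooth_on (- {0}) P"
    and ns: "stationary_NS_on (- {0}) U P" and fin: "M34 U < \<infinity>"
  shows "NS4 U (\<lambda>i x. \<chi> j. pderiv_at j U x $ i) (\<lambda>i j x. \<chi> k. pderiv_at k (pderiv_at j U) x $ i) P (gradient P) (enn2real (M34 U))"
proof
  have CU: "Ck_on (Suc (Suc 0)) (- {0}) U" and CP: "Ck_on (Suc 0) (- {0}) P"
    using U P unfolding smooth_on_def by blast+
  have CdU: "Ck_on (Suc 0) (- {0}) (pderiv_at j U)" for j by (rule Ck_on_Suc_pderiv[OF CU])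
  show "GDERIV (\<lambda>x. U x $ i) x :> (\<chi> j. pderiv_at j U x $ i)" if "x \<noteq> 0" for i x
    using Ck_on_GDERIV_component[OF CU] that by simp
  show "GDERIV (\<lambda>x. (\<chi> j. pderiv_at j U x $ i) $ j) x :> (\<chi> k. pderiv_at k (pderiv_at j U) x $ i)" if "x \<noteq> 0" for i j x
    using Ck_on_GDERIV_component[OF CdU] that by simp
  show "GDERIV P x :> gradient P x" if "x \<noteq> 0" for x
    using Ck_on_GDERIV_gradient[OF CP] that by simp
  show "continuous_on (- {0}) (\<lambda>x. \<chi> k. pderiv_at k (pderiv_at j U) x $ i)" for i j
    using Ck_on_Suc_pderiv[OF CdU] by (intro continuous_on_vec_lambda continuous_intros) simp
  show "continuous_on (- {0}) (gradient P)"
    unfolding gradient_def[abs_def] using Ck_on_Suc_pderiv[OF CP] by (intro continuous_on_vec_lambda) simp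
  have eq: "- laplacian U x + convection U x + gradient P x = 0" "divergence U x = 0" if "x \<noteq> 0" for x
    using ns that by (auto simp: stationary_NS_on_def)
  show "gradient P x $ i = (\<Sum>j\<in>UNIV. (\<chi> k. pderiv_at k (pderiv_at j U) x $ i) $ j) - (\<Sum>j\<in>UNIV. U x $ j * (\<chi> j. pderiv_at j U x $ i) $ j)"
    if "x \<noteq> 0" for i x
  proof -
    have "(- laplacian U x + convection U x + gradient P x) $ i = 0" using eq(1)[OF that] by simp
    then show ?thesis by (simp add: laplacian_def convection_def sum_component)
  qed
  show "(\<Sum>i\<in>UNIV. (\<chi> j. pderiv_at j U x $ i) $ i) = 0" if "x \<noteq> 0" for x
    using eq(2)[OF that] by (simp add: divergence_def)
  show "(\<integral>\<^sup>+x\<in>ball 0 R. ennreal (norm (U x) ^ 3) \<partial>lborel) \<le> ennreal (enn2real (M34 U) * R)" if R: "0 < R" for R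
  proof -
    let ?I = "\<integral>\<^sup>+x\<in>ball 0 R. ennreal (norm (U x) ^ 3) \<partial>lborel"
    have "ennreal (1 / R) * ?I \<le> M34 U"
      unfolding M34_def sup_ball_mean_def using R by (intro SUP_upper) auto
    then have "ennreal R * (ennreal (1 / R) * ?I) \<le> ennreal R * M34 U" by (intro mult_left_mono) auto
    also have "ennreal R * (ennreal (1 / R) * ?I) = ?I"
      using R by (simp add: mult.assoc[symmetric] ennreal_mult'[symmetric])
    also have "ennreal R * M34 U = ennreal (enn2real (M34 U) * R)"
      using fin R by (simp add: ennreal_mult'' mult.commute)
    finally show ?thesis .
  qed
qed simp

section \<open>Functions that vanish off the origin, and the conclusion\<close>

lemma AE_zero: "(\<And>x. x \<noteq> 0 \<Longrightarrow> f x = 0) \<Longrightarrow> AE x in (lborel :: 'a::euclidean_space measure). f x = 0"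
  using AE_lborel_singleton[of "0::'a"] by (rule eventually_mono) blast

lemma measurable_zero_off_origin:
  fixes f :: "'a::euclidean_space \<Rightarrow> 'b::euclidean_space"
  assumes "\<And>x. x \<noteq> 0 \<Longrightarrow> f x = 0"
  shows "f \<in> borel_measurable borel"
proof (rule borel_measurable_punctured)
  show "continuous_on (- {0}) f"
    by (rule continuous_on_eq[OF continuous_on_const[of _ 0]]) (use assms in auto)
qed

lemma Lp_loc_zero_off_origin:
  fixes f :: "'a::euclidean_space \<Rightarrow> 'b::euclidean_space"
  assumes "\<And>x. x \<noteq> 0 \<Longrightarrow> f x = 0"
  shows "Lp_loc p f"
proof -
  have m: "f \<in> borel_measurable borel" by (rule measurable_zero_off_origin[OF assms])
  have "set_integrable lborel K (\<lambda>x. norm (f x) powr p)" if "compact K" for K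
  proof -
    have K: "K \<in> sets borel" using that by (rule borel_compact)
    have "AE x in lborel. indicator K x *\<^sub>R (norm (f x) powr p) = 0"
      by (rule AE_zero) (simp add: assms)
    then show ?thesis
      unfolding set_integrable_def
      using K m by (subst integrable_cong_AE[where g = "\<lambda>_. 0"]) auto
  qed
  then show ?thesis using m by (simp add: Lp_loc_def)
qed

lemma sup_ball_mean_zero:
  assumes "\<And>x. x \<noteq> 0 \<Longrightarrow> g x = 0"
  shows "sup_ball_mean g = 0"
proof -
  have "(\<integral>\<^sup>+x\<in>ball 0 R. ennreal (g x) \<partial>lborel) = (\<integral>\<^sup>+x. 0 \<partial>(lborel :: (real^4) measure))" for R
    by (rule nn_integral_cong_AE, rule eventually_mono[OF AE_zero[of g]]) (auto simp: assms)
  then show ?thesis by (simp add: sup_ball_mean_def)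
qed

theorem theorem1p11:
  "\<exists>C>0. \<forall>(U :: real ^ 4 \<Rightarrow> real ^ 4) (P0 :: real ^ 4 \<Rightarrow> real).
     smooth_on (- {0}) U \<and> smooth_on (- {0}) P0 \<and>
     stationary_NS_on (- {0}) U P0 \<and>
     M34 U < \<infinity> \<longrightarrow>
       (\<forall>x\<in>- {0}. U x = 0) \<and>
       (\<exists>c. (\<forall>x\<in>- {0}. P0 x = c) \<and>
            canonical_pressure C U P0 (\<lambda>x. P0 x - c) \<and>
            (\<forall>Q. canonical_pressure C U P0 Q \<longrightarrow> (\<forall>x\<in>- {0}. Q x = P0 x - c)) \<and>
            distributional_NS U (\<lambda>x. P0 x - c) \<and>
            pressure_growth (\<lambda>x. P0 x - c) < \<infinity> \<and>
            (\<forall>x\<in>- {0}. P0 x - c = 0))"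
\<comment> \<open>Any positive constant would do: once \<open>U\<close> vanishes off the origin,
  both sides of the normalization are 0.\<close>
proof (rule exI[of _ 1], intro conjI allI impI)
  fix U :: "real ^ 4 \<Rightarrow> real ^ 4" and P0 :: "real ^ 4 \<Rightarrow> real"
  assume "smooth_on (- {0}) U \<and> smooth_on (- {0}) P0 \<and> stationary_NS_on (- {0}) U P0 \<and> M34 U < \<infinity>"
  then interpret NS4 U "\<lambda>i x. \<chi> j. pderiv_at j U x $ i" "\<lambda>i j x. \<chi> k. pderiv_at k (pderiv_at j U) x $ i" P0
    "gradient P0" "enn2real (M34 U)"
    using NS4_of_stationary_NS by blast
  have U0: "U x = 0" if "x \<noteq> 0" for x using velocity_zero[OF that] .
  then show "\<forall>x\<in>- {0}. U x = 0" by simp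
  obtain c where c: "\<And>x. x \<noteq> 0 \<Longrightarrow> P0 x = c" using pressure_constant by blast
  have P0: "P0 x - c = 0" if "x \<noteq> 0" for x using c[OF that] by simp
  have growth: "pressure_growth (\<lambda>x. P0 x - c) = 0"
    unfolding pressure_growth_def by (rule sup_ball_mean_zero) (simp add: c)
  have M0: "M34 U = 0" unfolding M34_def by (rule sup_ball_mean_zero) (simp add: U0)
  have int0: "integral\<^sup>L lborel f = 0" if "\<And>x. x \<noteq> 0 \<Longrightarrow> f x = 0" for f :: "real^4 \<Rightarrow> real"
    by (rule integral_eq_zero_AE[OF AE_zero[OF that]])
  show "\<exists>c. (\<forall>x\<in>- {0}. P0 x = c) \<and>
            canonical_pressure 1 U P0 (\<lambda>x. P0 x - c) \<and>
            (\<forall>Q. canonical_pressure 1 U P0 Q \<longrightarrow> (\<forall>x\<in>- {0}. Q x = P0 x - c)) \<and>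
            distributional_NS U (\<lambda>x. P0 x - c) \<and>
            pressure_growth (\<lambda>x. P0 x - c) < \<infinity> \<and>
            (\<forall>x\<in>- {0}. P0 x - c = 0)"
  proof (intro exI[of _ c] conjI allI impI)
    show "\<forall>x\<in>- {0}. P0 x = c" by (simp add: c)
    show "canonical_pressure 1 U P0 (\<lambda>x. P0 x - c)"
      unfolding canonical_pressure_def using growth Lp_loc_zero_off_origin[of "\<lambda>x. P0 x - c", OF P0] by auto
    show "distributional_NS U (\<lambda>x. P0 x - c)"
      unfolding distributional_NS_def
      using Lp_loc_zero_off_origin[of U, OF U0] Lp_loc_zero_off_origin[of "\<lambda>x. P0 x - c", OF P0]
      by (simp add: int0 U0 c)
    show "pressure_growth (\<lambda>x. P0 x - c) < \<infinity>" by (simp add: growth)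
    show "\<forall>x\<in>- {0}. P0 x - c = 0" using P0 by simp
    \<comment> \<open>Uniqueness: a competitor equals the constant c - d off the origin, and since
      \<open>M34 U\<close> is 0 its growth is 0. The ball of radius 1 has positive volume, so the
      constant is 0.\<close>
    fix Q assume Q: "canonical_pressure 1 U P0 Q"
    then obtain d where d: "\<And>x. x \<noteq> 0 \<Longrightarrow> Q x = c - d"
      unfolding canonical_pressure_def using c by auto
    have "pressure_growth Q = 0" using Q by (simp add: canonical_pressure_def M0)
    moreover have "ennreal (1 / 1) * (\<integral>\<^sup>+x\<in>ball 0 1. ennreal (\<bar>Q x\<bar> powr (3 / 2)) \<partial>lborel) \<le> pressure_growth Q"
      unfolding pressure_growth_def sup_ball_mean_def by (rule SUP_upper) simp
    moreover have "(\<integral>\<^sup>+x\<in>ball 0 1. ennreal (\<bar>Q x\<bar> powr (3 / 2)) \<partial>lborel) =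
      (\<integral>\<^sup>+x\<in>ball (0::real^4) 1. ennreal (\<bar>c - d\<bar> powr (3 / 2)) \<partial>lborel)"
      by (rule nn_integral_cong_AE, rule eventually_mono[OF AE_lborel_singleton[of 0]]) (simp add: d)
    moreover have "\<dots> = ennreal (\<bar>c - d\<bar> powr (3 / 2)) * emeasure lborel (ball (0::real^4) 1)"
      by (simp add: nn_integral_cmult_indicator)
    ultimately have "ennreal (\<bar>c - d\<bar> powr (3 / 2)) * emeasure lborel (ball (0::real^4) 1) = 0" by simp
    moreover have "emeasure lborel (ball (0::real^4) 1) \<noteq> 0"
      using content_ball_pos[of 1 "0::real^4"] by (auto simp: measure_def)
    ultimately have "\<bar>c - d\<bar> powr (3 / 2) = 0" by (simp add: ennreal_eq_0_iff order_antisym)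
    then have "c = d" by simp
    then show "\<forall>x\<in>- {0}. Q x = P0 x - c" using d c by simp
  qed
qed simp

end
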